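(* Let $A_1,A_2\in\mathbb{R}^{n\times n}$, $e_1,e_2\in\mathbb{R}^n$, $c\in\mathbb{R}^n$ with $c\neq0$, and $f\in\mathbb{R}$, and consider the bimodal piecewise affine system $\dot x(t)\in F(x(t))$ determined by these data (see context). Let $h_i$ be the observability index of $(c^T,A_i)$ for $i=1,2$, and let $h:=\min\{h_1,h_2\}$. Consider the following statements. 1. Every Filippov solution of the system is right-unique. 2. Every Filippov solution of the system is both a forward and a backward Carathéodory solution. 3. There exist an integer $k$ with $1\leq k\leq h+1$ and a $(k+1)\times(k+1)$ lower triangular matrix $M$ with positive diagonal elements such that $$\begin{bmatrix}c^T\\ c^TA_1\\ \vdots\\ c^TA_1^k\end{bmatrix}=M\begin{bmatrix}c^T\\ c^TA_2\\ \vdots\\ c^TA_2^k\end{bmatrix},\qquad \begin{bmatrix}f\\ c^Te_1\\ \vdots\\ c^TA_1^{k-1}e_1\end{bmatrix}\succ M\begin{bmatrix}f\\ c^Te_2\\ \vdots\\ c^TA_2^{k-1}e_2\end{bmatrix}.$$ 4. There exists an $(h+1)\times(h+1)$ lower triangular matrix $M$ with positive diagonal elements such that $$\begin{bmatrix}c^T\\ c^TA_1\\ \vdots\\ c^TA_1^h\end{bmatrix}=M\begin{bmatrix}c^T\\ c^TA_2\\ \vdots\\ c^TA_2^h\end{bmatrix},\qquad \begin{bmatrix}f\\ c^Te_1\\ \vdots\\ c^TA_1^{h-1}e_1\end{bmatrix}= M\begin{bmatrix}f\\ c^Te_2\\ \vdots\\ c^TA_2^{h-1}e_2\end{bmatrix},$$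 and either ($h_1<h_2$ and $c^TA_1^{h_1}e_1-p_1^T\mathbf{e}_1^{h_1}>0$) or ($h_1>h_2$ and $c^TA_2^{h_2}e_2-p_2^T\mathbf{e}_2^{h_2}<0$), where $p_i\in\mathbb{R}^{h_i+1}$ is uniquely determined by $c^TA_i^{h_i+1}=p_i^TT_i^{h_i}$, $i=1,2$. 5. $h_1=h_2$ and there exists an $(h+2)\times(h+2)$ lower triangular matrix $M$ with positive diagonal elements such that $$\begin{bmatrix}c^T\\ c^TA_1\\ \vdots\\ c^TA_1^{h+1}\end{bmatrix}=M\begin{bmatrix}c^T\\ c^TA_2\\ \vdots\\ c^TA_2^{h+1}\end{bmatrix},\qquad \begin{bmatrix}f\\ c^Te_1\\ \vdots\\ c^TA_1^{h}e_1\end{bmatrix}= M\begin{bmatrix}f\\ c^Te_2\\ \vdots\\ c^TA_2^{h}e_2\end{bmatrix}.$$ 6. For all $\xi\in\mathbb{R}^n$, the following implication holds: $$\begin{bmatrix}c^T\\ c^TA_1\\ \vdots\\ c^TA_1^{h+1}\end{bmatrix}\xi+\begin{bmatrix}f\\ c^Te_1\\ \vdots\\ c^TA_1^{h}e_1\end{bmatrix}=0\ \Rightarrow\ A_1\xi+e_1=A_2\xi+e_2.$$ Then the following implications hold: A. $1\Rightarrow(3\text{ or }4\text{ or }5)$. B. $(1\text{ and }5)\Rightarrow 6$. C. $(5\text{ and }6)\Rightarrow 2$. D. $(5\text{ and }6)\Rightarrow 1$.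
   Context: System. $F(x)=\{A_1x+e_1\}$ if $c^Tx+f<0$, $F(x)=\{A_1x+e_1,A_2x+e_2\}$ if $c^Tx+f=0$, $F(x)=\{A_2x+e_2\}$ if $c^Tx+f>0$. The convexified mapping $G$ is given by $G(x)=\operatorname{conv}(F(x))$, i.e. $G(x)=F(x)$ if $c^Tx+f\neq0$ and $G(x)=\operatorname{conv}\{A_1x+e_1,A_2x+e_2\}$ if $c^Tx+f=0$. Solutions. Let $x:\mathbb{R}\to\mathbb{R}^n$ be absolutely continuous (on every compact interval). It is, for the initial state $\xi$, - a Carathéodory solution if $x(0)=\xi$ and $\dot x(t)\in F(x(t))$ for almost all $t\in\mathbb{R}$; - a forward Carathéodory solution if it is a Carathéodory solution and for each $t^*\in\mathbb{R}$ there exist $i\in\{1,2\}$ and $\epsilon_{t^*}>0$ such that $\dot x(t)=A_ix(t)+e_i$ and $(-1)^{i-1}[c^Tx(t)+f]\leq0$ for all $t\in(t^*,t^*+\epsilon_{t^*})$; - a backward Carathéodory solution if it is a Carathéodory solution and for each $t^*\in\mathbb{R}$ there exist $i\in\{1,2\}$ and $\epsilon_{t^*}>0$ such that $\dot x(t)=A_ix(t)+e_i$ and $(-1)^{i-1}[c^Tx(t)+f]\leq0$ for all $t\in(t^*-\epsilon_{t^*},t^* )$; - a Filippov solution if $x(0)=\xi$ and $\dot x(t)\in G(x(t))$ for almost all $t\in\mathbb{R}$. A Filippov solution $x$ for the initial state $\xi$ is right-unique if for any Filippov solution $x'$ for the initial state $\xi$ there exists $\epsilon>0$ such that $x(t)=x'(t)$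 for all $t\in[0,\epsilon)$. Notation. For a vector $v$, $v\succ0$ means $v$ is nonzero and its first nonzero entry is positive; $v\succ w$ means $v-w\succ0$. The observability index $h_i$ of $(c^T,A_i)$ is the largest integer such that the matrix with rows $c^T,c^TA_i,\dots,c^TA_i^{h_i}$ has full row rank. For $k\geq0$, $T_i^k$ is the $(k+1)\times n$ matrix with rows $c^T,c^TA_i,\dots,c^TA_i^k$, and $\mathbf{e}_i^k\in\mathbb{R}^{k+1}$ is the column vector with entries $f,c^Te_i,c^TA_ie_i,\dots,c^TA_i^{k-1}e_i$ (so $T_i^0=c^T$ and $\mathbf{e}_i^0=f$). When $h=0$, the stacked matrices and vectors in statement 4 are just $c^T$ and $f$. *)

theory Defs
  imports "HOL-Analysis.Analysis"
begin

text \<open>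
  The data of the system are families \<open>A\<close>, \<open>e\<close> of which only the members with index 1 and 2 are
  used, together with \<open>c\<close> and \<open>f\<close>.
\<close>

definition pwa_F ::
    "(nat \<Rightarrow> real^'n^'n) \<Rightarrow> (nat \<Rightarrow> real^'n) \<Rightarrow> real^'n \<Rightarrow> real \<Rightarrow> real^'n \<Rightarrow> (real^'n) set" where
  "pwa_F A e c f x =
     (if c \<bullet> x + f < 0 then {A 1 *v x + e 1}
      else if c \<bullet> x + f = 0 then {A 1 *v x + e 1, A 2 *v x + e 2}
      else {A 2 *v x + e 2})"

definition pwa_G ::
    "(nat \<Rightarrow> real^'n^'n) \<Rightarrow> (nat \<Rightarrow> real^'n) \<Rightarrow> real^'n \<Rightarrow> real \<Rightarrow> real^'n \<Rightarrow> (real^'n) set" where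
  "pwa_G A e c f x = convex hull (pwa_F A e c f x)"

definition abs_cont_on_interval :: "real \<Rightarrow> real \<Rightarrow> (real \<Rightarrow> 'a::real_normed_vector) \<Rightarrow> bool" where
  "abs_cont_on_interval a b x \<longleftrightarrow>
     (\<forall>\<epsilon>>0. \<exists>\<delta>>0. \<forall>(N::nat) u v.
        (\<forall>i<N. a \<le> u i \<and> u i \<le> v i \<and> v i \<le> b) \<and>
        disjoint_family_on (\<lambda>i. {u i<..<v i}) {..<N} \<and>
        (\<Sum>i<N. v i - u i) < \<delta> \<longrightarrow>
        (\<Sum>i<N. norm (x (v i) - x (u i))) < \<epsilon>)"

definition loc_abs_cont :: "(real \<Rightarrow> 'a::real_normed_vector) \<Rightarrow> bool" where
  "loc_abs_cont x \<longleftrightarrow> (\<forall>a b. a \<le> b \<longrightarrow> abs_cont_on_interval a b x)"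

definition inclusion_solution ::
    "('a \<Rightarrow> 'a set) \<Rightarrow> 'a \<Rightarrow> (real \<Rightarrow> 'a::real_normed_vector) \<Rightarrow> bool" where
  "inclusion_solution H \<xi> x \<longleftrightarrow>
     loc_abs_cont x \<and> x 0 = \<xi> \<and>
     (AE t in lebesgue. \<exists>v \<in> H (x t). (x has_vector_derivative v) (at t))"

definition caratheodory_solution ::
    "(nat \<Rightarrow> real^'n^'n) \<Rightarrow> (nat \<Rightarrow> real^'n) \<Rightarrow> real^'n \<Rightarrow> real \<Rightarrow> real^'n \<Rightarrow> (real \<Rightarrow> real^'n) \<Rightarrow> bool" where
  "caratheodory_solution A e c f \<xi> x \<longleftrightarrow> inclusion_solution (pwa_F A e c f) \<xi> x"

definition filippov_solution ::
    "(nat \<Rightarrow> real^'n^'n) \<Rightarrow> (nat \<Rightarrow> real^'n) \<Rightarrow> real^'n \<Rightarrow> real \<Rightarrow> real^'n \<Rightarrow> (real \<Rightarrow> real^'n) \<Rightarrow> bool" where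
  "filippov_solution A e c f \<xi> x \<longleftrightarrow> inclusion_solution (pwa_G A e c f) \<xi> x"

definition forward_caratheodory_solution ::
    "(nat \<Rightarrow> real^'n^'n) \<Rightarrow> (nat \<Rightarrow> real^'n) \<Rightarrow> real^'n \<Rightarrow> real \<Rightarrow> real^'n \<Rightarrow> (real \<Rightarrow> real^'n) \<Rightarrow> bool" where
  "forward_caratheodory_solution A e c f \<xi> x \<longleftrightarrow>
     caratheodory_solution A e c f \<xi> x \<and>
     (\<forall>s. \<exists>i\<in>{1,2}. \<exists>\<epsilon>>0. \<forall>t\<in>{s<..<s+\<epsilon>}.
        (x has_vector_derivative (A i *v x t + e i)) (at t) \<and>
        (-1)^(i-1) * (c \<bullet> x t + f) \<le> 0)"

definition backward_caratheodory_solution ::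
    "(nat \<Rightarrow> real^'n^'n) \<Rightarrow> (nat \<Rightarrow> real^'n) \<Rightarrow> real^'n \<Rightarrow> real \<Rightarrow> real^'n \<Rightarrow> (real \<Rightarrow> real^'n) \<Rightarrow> bool" where
  "backward_caratheodory_solution A e c f \<xi> x \<longleftrightarrow>
     caratheodory_solution A e c f \<xi> x \<and>
     (\<forall>s. \<exists>i\<in>{1,2}. \<exists>\<epsilon>>0. \<forall>t\<in>{s-\<epsilon><..<s}.
        (x has_vector_derivative (A i *v x t + e i)) (at t) \<and>
        (-1)^(i-1) * (c \<bullet> x t + f) \<le> 0)"

definition right_unique ::
    "(nat \<Rightarrow> real^'n^'n) \<Rightarrow> (nat \<Rightarrow> real^'n) \<Rightarrow> real^'n \<Rightarrow> real \<Rightarrow> real^'n \<Rightarrow> (real \<Rightarrow> real^'n) \<Rightarrow> bool" where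
  "right_unique A e c f \<xi> x \<longleftrightarrow>
     (\<forall>x'. filippov_solution A e c f \<xi> x' \<longrightarrow> (\<exists>\<epsilon>>0. \<forall>t\<in>{0..<\<epsilon>}. x t = x' t))"

text \<open>
  Vectors and matrices whose number \<open>m\<close> of rows varies inside the statement are functions on
  \<^typ>\<open>nat\<close>, rows and columns being numbered from 0; only the entries with index \<open>< m\<close> matter.
  The power operator \<open>^\<close> on \<^typ>\<open>real^'n^'n\<close> is componentwise, hence a separate \<open>mat_power\<close>.
\<close>

primrec mat_power :: "real^'n^'n \<Rightarrow> nat \<Rightarrow> real^'n^'n" where
  "mat_power B 0 = mat 1"
| "mat_power B (Suc k) = mat_power B k ** B"

definition obs_row :: "real^'n \<Rightarrow> real^'n^'n \<Rightarrow> nat \<Rightarrow> real^'n" where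
  "obs_row c B k = c v* mat_power B k"

fun obs_offset :: "real^'n \<Rightarrow> real \<Rightarrow> real^'n^'n \<Rightarrow> real^'n \<Rightarrow> nat \<Rightarrow> real" where
  "obs_offset c f B d 0 = f"
| "obs_offset c f B d (Suc k) = obs_row c B k \<bullet> d"

text \<open>Full row rank is expressed through the dimension of the row space.\<close>

definition obs_index :: "real^'n \<Rightarrow> real^'n^'n \<Rightarrow> nat" where
  "obs_index c B = (GREATEST k. dim {obs_row c B j | j. j \<le> k} = k + 1)"

text \<open>The vector \<open>p\<^sub>i\<close>, extended by zero beyond its \<open>h\<^sub>i + 1\<close> entries.\<close>

definition obs_coeffs :: "real^'n \<Rightarrow> real^'n^'n \<Rightarrow> nat \<Rightarrow> real" where
  "obs_coeffs c B =
     (THE p. (\<forall>j>obs_index c B. p j = 0) \<and>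
        obs_row c B (obs_index c B + 1) = (\<Sum>j\<le>obs_index c B. p j *\<^sub>R obs_row c B j))"

definition lower_tri_pos :: "nat \<Rightarrow> (nat \<Rightarrow> nat \<Rightarrow> real) \<Rightarrow> bool" where
  "lower_tri_pos m M \<longleftrightarrow> (\<forall>i<m. M i i > 0 \<and> (\<forall>j<m. i < j \<longrightarrow> M i j = 0))"

text \<open>
  Product of an \<open>m\<close> by \<open>m\<close> matrix with a stack of \<open>m\<close> rows; a row is a real number or a row vector.
\<close>

definition stack_mult :: "nat \<Rightarrow> (nat \<Rightarrow> nat \<Rightarrow> real) \<Rightarrow> (nat \<Rightarrow> 'a::real_vector) \<Rightarrow> nat \<Rightarrow> 'a" where
  "stack_mult m M w i = (\<Sum>j<m. M i j *\<^sub>R w j)"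

definition stack_eq :: "nat \<Rightarrow> (nat \<Rightarrow> 'a) \<Rightarrow> (nat \<Rightarrow> 'a) \<Rightarrow> bool" where
  "stack_eq m v w \<longleftrightarrow> (\<forall>i<m. v i = w i)"

definition lex_pos :: "nat \<Rightarrow> (nat \<Rightarrow> real) \<Rightarrow> bool" where
  "lex_pos m v \<longleftrightarrow> (\<exists>i<m. v i > 0 \<and> (\<forall>j<i. v j = 0))"

definition lex_greater :: "nat \<Rightarrow> (nat \<Rightarrow> real) \<Rightarrow> (nat \<Rightarrow> real) \<Rightarrow> bool" where
  "lex_greater m v w \<longleftrightarrow> lex_pos m (\<lambda>i. v i - w i)"

definition min_obs_index :: "(nat \<Rightarrow> real^'n^'n) \<Rightarrow> real^'n \<Rightarrow> nat" where
  "min_obs_index A c = min (obs_index c (A 1)) (obs_index c (A 2))"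

definition statement1 ::
    "(nat \<Rightarrow> real^'n^'n) \<Rightarrow> (nat \<Rightarrow> real^'n) \<Rightarrow> real^'n \<Rightarrow> real \<Rightarrow> bool" where
  "statement1 A e c f \<longleftrightarrow>
     (\<forall>\<xi> x. filippov_solution A e c f \<xi> x \<longrightarrow> right_unique A e c f \<xi> x)"

definition statement2 ::
    "(nat \<Rightarrow> real^'n^'n) \<Rightarrow> (nat \<Rightarrow> real^'n) \<Rightarrow> real^'n \<Rightarrow> real \<Rightarrow> bool" where
  "statement2 A e c f \<longleftrightarrow>
     (\<forall>\<xi> x. filippov_solution A e c f \<xi> x \<longrightarrow>
        forward_caratheodory_solution A e c f \<xi> x \<and> backward_caratheodory_solution A e c f \<xi> x)"

definition statement3 ::
    "(nat \<Rightarrow> real^'n^'n) \<Rightarrow> (nat \<Rightarrow> real^'n) \<Rightarrow> real^'n \<Rightarrow> real \<Rightarrow> bool" where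
  "statement3 A e c f \<longleftrightarrow>
     (\<exists>k M. 1 \<le> k \<and> k \<le> min_obs_index A c + 1 \<and> lower_tri_pos (k+1) M \<and>
        stack_eq (k+1) (obs_row c (A 1)) (stack_mult (k+1) M (obs_row c (A 2))) \<and>
        lex_greater (k+1) (obs_offset c f (A 1) (e 1))
          (stack_mult (k+1) M (obs_offset c f (A 2) (e 2))))"

definition statement4 ::
    "(nat \<Rightarrow> real^'n^'n) \<Rightarrow> (nat \<Rightarrow> real^'n) \<Rightarrow> real^'n \<Rightarrow> real \<Rightarrow> bool" where
  "statement4 A e c f \<longleftrightarrow>
     (let h1 = obs_index c (A 1); h2 = obs_index c (A 2); h = min_obs_index A c;
          p1 = obs_coeffs c (A 1); p2 = obs_coeffs c (A 2)
      in (\<exists>M. lower_tri_pos (h+1) M \<and>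
            stack_eq (h+1) (obs_row c (A 1)) (stack_mult (h+1) M (obs_row c (A 2))) \<and>
            stack_eq (h+1) (obs_offset c f (A 1) (e 1))
              (stack_mult (h+1) M (obs_offset c f (A 2) (e 2)))) \<and>
         (h1 < h2 \<and>
            obs_row c (A 1) h1 \<bullet> e 1 - (\<Sum>j\<le>h1. p1 j * obs_offset c f (A 1) (e 1) j) > 0 \<or>
          h1 > h2 \<and>
            obs_row c (A 2) h2 \<bullet> e 2 - (\<Sum>j\<le>h2. p2 j * obs_offset c f (A 2) (e 2) j) < 0))"

definition statement5 ::
    "(nat \<Rightarrow> real^'n^'n) \<Rightarrow> (nat \<Rightarrow> real^'n) \<Rightarrow> real^'n \<Rightarrow> real \<Rightarrow> bool" where
  "statement5 A e c f \<longleftrightarrow>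
     obs_index c (A 1) = obs_index c (A 2) \<and>
     (let h = min_obs_index A c
      in \<exists>M. lower_tri_pos (h+2) M \<and>
           stack_eq (h+2) (obs_row c (A 1)) (stack_mult (h+2) M (obs_row c (A 2))) \<and>
           stack_eq (h+2) (obs_offset c f (A 1) (e 1))
             (stack_mult (h+2) M (obs_offset c f (A 2) (e 2))))"

definition statement6 ::
    "(nat \<Rightarrow> real^'n^'n) \<Rightarrow> (nat \<Rightarrow> real^'n) \<Rightarrow> real^'n \<Rightarrow> real \<Rightarrow> bool" where
  "statement6 A e c f \<longleftrightarrow>
     (\<forall>\<xi>. (\<forall>j\<le>min_obs_index A c + 1.
              obs_row c (A 1) j \<bullet> \<xi> + obs_offset c f (A 1) (e 1) j = 0) \<longrightarrow>
           A 1 *v \<xi> + e 1 = A 2 *v \<xi> + e 2)"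

end

theory Submission
  imports Defs
begin

text \<open>
  Let \<open>y\<^sub>i\<^sup>j\<close> be the \<open>j\<close>-th derivative of \<open>c \<bullet> x + f\<close> along mode \<open>i\<close>, an affine function of the state.
  Since \<open>y\<^sub>i\<^sup>j\<close> vanishes for all \<open>j\<close> as soon as it does for \<open>j \<le> h\<^sub>i + 1\<close>, the first nonzero entry decides on which
  side of the hyperplane the mode \<open>i\<close> trajectory starts. If mode 1 could start into the negative side while mode 2
  does not, two different local solutions would emanate from one state, and both extend to Filippov
  solutions on the whole line because the convexified right-hand side is upper semicontinuous with
  linear growth. Hence right-uniqueness forces an order relation between the two lexicographic
  signs. Comparing one row at a time on the affine subspace where all earlier outputs vanish, an
  implication between two affine half-spaces yields either proportionality of the next rows, which extends
  the triangular matrix, or one of the strict alternatives 3 and 4.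

  Conversely, under statement 5 the derivative of \<open>y\<^sub>1\<^sup>j\<close> along every Filippov solution is a positive multiple
  of \<open>y\<^sub>1\<^sup>j\<^sup>+\<^sup>1\<close> up to a combination of \<open>y\<^sub>1\<^sup>0, \<dots>, y\<^sub>1\<^sup>j\<close>. So near any time either \<open>c \<bullet> x + f\<close> has a strict sign determined by
  the state, or all these outputs vanish identically and, by statement 6, both modes coincide along the solution.
\<close>

section \<open>Absolutely continuous functions\<close>

text \<open>A Filippov solution has a velocity only almost everywhere, and on the hyperplane it is a
  convex combination whose weight \<theta> has no regularity in time. The arguments about solutions
  therefore rest on a mean value inequality for absolutely continuous functions with a negligible
  exceptional set, and the chain lemmas use only pointwise bounds: the derivative of
  \<open>z j\<close> is \<mu> times \<open>z (Suc j)\<close> up to lower terms, with \<mu> between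
  fixed bounds. Under statement 5 mode 1 contributes the multiplier 1 and mode 2 the ratio
  \<open>M j j / M (Suc j) (Suc j)\<close>, and a convex combination of the two stays between them;
  this is where the positive diagonal enters. The chain closes after h + 2 outputs because row h + 1
  depends on the earlier rows and, at a common zero, the offsets obey the same relation. On the
  existence side, limits of Euler approximations satisfy the inclusion at points of
  differentiability, so almost everywhere differentiability of Lipschitz functions is established as
  well.\<close>

lemma negligible_outer_open:
  fixes N :: "'a::euclidean_space set" and d :: real
  assumes "negligible N" "d > 0"
  obtains U where "open U" "N \<subseteq> U" "U \<in> lmeasurable" "measure lebesgue U < d"
proof -
  have N: "N \<in> null_sets lebesgue" using assms(1) by (simp add: negligible_iff_null_sets)
  then obtain U where U: "open U" "N \<subseteq> U" "U - N \<in> lmeasurable" "emeasure lebesgue (U - N) < ennreal d"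
    using sets_lebesgue_outer_open[OF _ \<open>d > 0\<close>] by blast
  have US: "U \<in> sets lebesgue" using U(1) by simp
  have eq: "emeasure lebesgue U = emeasure lebesgue (U - N)"
    using emeasure_Diff_null_set[OF N US] by simp
  then have "emeasure lebesgue U < \<infinity>"
    using U(4) order.strict_trans[OF _ ennreal_less_top[of d]] by simp
  then have m: "U \<in> lmeasurable" using US by (rule fmeasurableI[rotated])
  moreover have "ennreal (measure lebesgue U) < ennreal d"
    using U(4) eq emeasure_eq_measure2[OF m] by simp
  then have "measure lebesgue U < d" using \<open>d > 0\<close> by (simp add: ennreal_less_iff)
  ultimately show ?thesis using that U by auto
qed

text \<open>The proof runs over a gauge-fine tagged division: intervals tagged outside \<open>N\<close> have nearly
  nonpositive increments, those tagged in \<open>N\<close> lie in an open set of small measure, where absolute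
  continuity takes over.\<close>

lemma abs_cont_decreasing:
  fixes u :: "real \<Rightarrow> real"
  assumes ab: "a \<le> b" and ac: "abs_cont_on_interval a b u" and N: "negligible N"
    and der: "\<And>t. t \<in> {a..b} - N \<Longrightarrow> \<exists>d\<le>0. (u has_real_derivative d) (at t)"
  shows "u b \<le> u a"
proof -
  have key: "u b - u a \<le> \<eta> * (b - a) + \<eta>" if eta: "\<eta> > 0" for \<eta>
  proof -
    obtain \<delta> where \<delta>: "\<delta> > 0" and acd: "\<forall>(m::nat) p q. (\<forall>i<m. a \<le> p i \<and> p i \<le> q i \<and> q i \<le> b) \<and>
        disjoint_family_on (\<lambda>i. {p i<..<q i}) {..<m} \<and> (\<Sum>i<m. q i - p i) < \<delta> \<longrightarrow>
        (\<Sum>i<m. norm (u (q i) - u (p i))) < \<eta>"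
      using ac[unfolded abs_cont_on_interval_def, rule_format, OF eta] by (elim exE conjE)
    obtain U where U: "open U" "N \<subseteq> U" "U \<in> lmeasurable" "measure lebesgue U < \<delta>"
      using negligible_outer_open[OF N \<delta>] by blast
    have "\<exists>r>0. (t \<in> N \<longrightarrow> ball t r \<subseteq> U) \<and>
            (t \<in> {a..b} - N \<longrightarrow> (\<exists>d\<le>0. \<forall>s. \<bar>s - t\<bar> < r \<longrightarrow> \<bar>u s - u t - d * (s - t)\<bar> \<le> \<eta> * \<bar>s - t\<bar>))" for t
    proof (cases "t \<in> N")
      case True
      then show ?thesis using U by (meson DiffD2 openE subsetD)
    next
      case False
      show ?thesis
      proof (cases "t \<in> {a..b}")
        case True
        with False der obtain d where d: "d \<le> 0" "(u has_real_derivative d) (at t)" by blast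
        then have "(u has_derivative (*) d) (at t)" by (simp add: has_field_derivative_def)
        then obtain r where "r > 0" "\<forall>s. norm (s - t) < r \<longrightarrow> norm (u s - u t - d * (s - t)) \<le> \<eta> * norm (s - t)"
          using \<open>\<eta> > 0\<close> unfolding has_derivative_at_alt by blast
        then show ?thesis using d False by auto
      qed (use False in \<open>auto intro: exI[of _ 1]\<close>)
    qed
    then have "\<forall>t. \<exists>r>0. (t \<in> N \<longrightarrow> ball t r \<subseteq> U) \<and>
            (t \<in> {a..b} - N \<longrightarrow> (\<exists>d\<le>0. \<forall>s. \<bar>s - t\<bar> < r \<longrightarrow> \<bar>u s - u t - d * (s - t)\<bar> \<le> \<eta> * \<bar>s - t\<bar>))"
      by blast
    from choice[OF this] obtain r where r: "\<And>t. r t > 0" "\<And>t. t \<in> N \<Longrightarrow> ball t (r t) \<subseteq> U"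
      "\<And>t. t \<in> {a..b} - N \<Longrightarrow> \<exists>d\<le>0. \<forall>s. \<bar>s - t\<bar> < r t \<longrightarrow> \<bar>u s - u t - d * (s - t)\<bar> \<le> \<eta> * \<bar>s - t\<bar>"
      by blast
    have "gauge (\<lambda>t. ball t (r t))" using r(1) by (simp add: gauge_def)
    then obtain P where P: "P tagged_division_of {a..b}" "(\<lambda>t. ball t (r t)) fine P"
      by (rule fine_division_exists_real)
    have finP: "finite P" using P(1) by blast
    have el: "\<exists>v w. K = {v..w} \<and> v \<le> w \<and> Inf K = v \<and> Sup K = w \<and> a \<le> v \<and> w \<le> b \<and> v \<le> t \<and> t \<le> w \<and> K \<subseteq> ball t (r t) \<and> t \<in> {a..b} \<and> measure lborel K = w - v"
      if "(t, K) \<in> P" for t K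
    proof -
      have "t \<in> K" "K \<subseteq> {a..b}" "\<exists>v w. K = cbox v w"
        using tagged_division_ofD(2-4)[OF P(1) that] by auto
      moreover have "K \<subseteq> ball t (r t)" using P(2) that unfolding fine_def by auto
      ultimately obtain v w where K: "K = {v..w}" "t \<in> K" "K \<subseteq> {a..b}" "K \<subseteq> ball t (r t)" by auto
      then have "v \<le> w" by auto
      with K show ?thesis by (intro exI[of _ v] exI[of _ w] conjI) auto
    qed
    let ?G = "{x \<in> P. fst x \<notin> N}" and ?B = "{x \<in> P. fst x \<in> N}"
    let ?\<Delta> = "\<lambda>x. u (Sup (snd x)) - u (Inf (snd x))"
    have "u b - u a = (\<Sum>x\<in>P. ?\<Delta> x)"
      using additive_tagged_division_1[OF ab P(1), of u] by (simp add: case_prod_unfold)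
    also have "P = ?G \<union> ?B" by auto
    also have "sum ?\<Delta> (?G \<union> ?B) = sum ?\<Delta> ?G + sum ?\<Delta> ?B"
      using finP by (intro sum.union_disjoint) auto
    finally have split: "u b - u a = sum ?\<Delta> ?G + sum ?\<Delta> ?B" .
    have "sum ?\<Delta> ?G \<le> (\<Sum>x\<in>?G. \<eta> * measure lborel (snd x))"
    proof (rule sum_mono)
      fix x assume x: "x \<in> ?G"
      obtain t K where tK: "x = (t, K)" by fastforce
      with x obtain v w where K: "K = {v..w}" "v \<le> w" "Inf K = v" "Sup K = w" "v \<le> t" "t \<le> w"
        "K \<subseteq> ball t (r t)" "t \<in> {a..b}" "measure lborel K = w - v"
        using el[of t K] by auto
      obtain d where d: "d \<le> 0" "\<And>s. \<bar>s - t\<bar> < r t \<Longrightarrow> \<bar>u s - u t - d * (s - t)\<bar> \<le> \<eta> * \<bar>s - t\<bar>"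
        using r(3)[of t] x tK K by auto
      have "v \<in> {v..w}" "w \<in> {v..w}" "{v..w} \<subseteq> ball t (r t)" using K by auto
      then have "v \<in> ball t (r t)" "w \<in> ball t (r t)" by blast+
      then have "\<bar>v - t\<bar> < r t" "\<bar>w - t\<bar> < r t" by (auto simp: dist_real_def)
      then have "\<bar>u v - u t - d * (v - t)\<bar> \<le> \<eta> * \<bar>v - t\<bar>" "\<bar>u w - u t - d * (w - t)\<bar> \<le> \<eta> * \<bar>w - t\<bar>"
        using d by auto
      then have "u w - u v \<le> d * (w - v) + \<eta> * (w - v)"
        using K by (auto simp: algebra_simps abs_if split: if_splits)
      also have "\<dots> \<le> \<eta> * (w - v)" using d(1) K(2) by (simp add: mult_nonpos_nonneg)
      finally show "?\<Delta> x \<le> \<eta> * measure lborel (snd x)" using K tK by simp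
    qed
    also have "\<dots> \<le> (\<Sum>x\<in>P. \<eta> * measure lborel (snd x))"
      using finP \<open>\<eta> > 0\<close> by (intro sum_mono2) auto
    also have "\<dots> = \<eta> * (b - a)"
      using additive_content_tagged_division[of P a b] P(1) ab
      by (simp add: sum_distrib_left[symmetric] case_prod_unfold)
    finally have good: "sum ?\<Delta> ?G \<le> \<eta> * (b - a)" .
    \<comment> \<open>Absolute continuity is phrased for intervals numbered from 0, so those tagged
      in \<open>N\<close> are enumerated by \<open>h\<close>; their interiors are disjoint and lie
      in \<open>U\<close>, which keeps the total length below \<delta>.\<close>
    have "finite ?B" using finP by auto
    from ex_bij_betw_nat_finite[OF this] obtain h where h: "bij_betw h {..<card ?B} ?B"
      unfolding atLeast0LessThan by (elim exE)
    define p q where "p i = Inf (snd (h i))" and "q i = Sup (snd (h i))" for i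
    have hi: "h i \<in> P \<and> fst (h i) \<in> N" if "i < card ?B" for i
      using h that by (auto simp: bij_betw_def)
    have pq: "a \<le> p i \<and> p i \<le> q i \<and> q i \<le> b \<and> snd (h i) = {p i..q i} \<and> {p i<..<q i} \<subseteq> U" if "i < card ?B" for i
    proof -
      have "(fst (h i), snd (h i)) \<in> P" using hi[OF that] by simp
      from el[OF this] obtain v w where vw: "snd (h i) = {v..w}" "v \<le> w" "Inf (snd (h i)) = v" "Sup (snd (h i)) = w"
        "a \<le> v" "w \<le> b" "snd (h i) \<subseteq> ball (fst (h i)) (r (fst (h i)))" by blast
      have "ball (fst (h i)) (r (fst (h i))) \<subseteq> U" using r(2) hi[OF that] by simp
      then have "{v<..<w} \<subseteq> U" using vw(1,7) by force
      then show ?thesis using vw unfolding p_def q_def by simp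
    qed
    have disj: "disjoint_family_on (\<lambda>i. {p i<..<q i}) {..<card ?B}"
      unfolding disjoint_family_on_def
    proof (intro ballI impI)
      fix i j assume ij: "i \<in> {..<card ?B}" "j \<in> {..<card ?B}" "i \<noteq> j"
      then have "h i \<noteq> h j" using h by (auto simp: bij_betw_def inj_on_def)
      moreover have "(fst (h i), snd (h i)) \<in> P" "(fst (h j), snd (h j)) \<in> P" using hi ij by auto
      ultimately have "interior (snd (h i)) \<inter> interior (snd (h j)) = {}"
        using tagged_division_ofD(5)[OF P(1)] by (metis prod.collapse)
      then show "{p i<..<q i} \<inter> {p j<..<q j} = {}" using pq ij by simp
    qed
    have "(\<Sum>i<card ?B. q i - p i) = (\<Sum>i<card ?B. measure lebesgue {p i<..<q i})"
      using pq by (intro sum.cong) auto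
    also have "\<dots> = measure lebesgue (\<Union>i\<in>{..<card ?B}. {p i<..<q i})"
      using disj pq by (intro measure_finite_Union[symmetric]) auto
    also have "\<dots> \<le> measure lebesgue U"
      using pq U(3) by (intro measure_mono_fmeasurable) auto
    finally have "(\<Sum>i<card ?B. q i - p i) < \<delta>" using U by linarith
    then have "(\<Sum>i<card ?B. norm (u (q i) - u (p i))) < \<eta>"
      using pq disj by (intro acd[rule_format] conjI) auto
    moreover have "sum ?\<Delta> ?B = (\<Sum>i<card ?B. u (q i) - u (p i))"
      unfolding p_def q_def using sum.reindex_bij_betw[OF h, of ?\<Delta>] by simp
    moreover have "\<dots> \<le> (\<Sum>i<card ?B. norm (u (q i) - u (p i)))"
      by (intro sum_mono) auto
    ultimately show ?thesis using split good by linarith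
  qed
  show ?thesis
  proof (rule ccontr)
    assume "\<not> u b \<le> u a"
    then have pos: "u b - u a > 0" by simp
    \<comment> \<open>With this choice \<eta> * (b - a) + \<eta> is half the supposed increase; the
      summand 1 keeps the denominator positive for a = b.\<close>
    define \<eta> where "\<eta> = (u b - u a) / (2 * (b - a + 1))"
    have "\<eta> > 0" using pos ab by (simp add: \<eta>_def)
    moreover have "\<eta> * (2 * (b - a + 1)) = u b - u a" using ab by (simp add: \<eta>_def)
    then have "\<eta> * (b - a) + \<eta> = (u b - u a) / 2" by argo
    ultimately show False using key[of \<eta>] pos by simp
  qed
qed

text \<open>The device behind the closure properties: increments of \<open>u\<close> cover
  restrictions and inner products, the linear term covers adding linear functions, and u = 0 gives
  Lipschitz functions.\<close>

lemma abs_cont_of_bound: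
  assumes u: "abs_cont_on_interval a b u" and sub: "a \<le> c" "d \<le> b"
    and K: "K \<ge> 0"
    and L: "\<And>s t. c \<le> s \<Longrightarrow> s \<le> t \<Longrightarrow> t \<le> d \<Longrightarrow> norm (w t - w s) \<le> K * norm (u t - u s) + K * (t - s)"
  shows "abs_cont_on_interval c d w"
  unfolding abs_cont_on_interval_def
proof (intro allI impI)
  fix eps :: real assume e: "eps > 0"
  define e' where "e' = eps / (2 * (K + 1))"
  have e': "e' > 0" using e K by (simp add: e'_def)
  then obtain \<delta> where d: "\<delta> > 0" and *: "\<And>(m::nat) p q. (\<forall>i<m. a \<le> p i \<and> p i \<le> q i \<and> q i \<le> b) \<Longrightarrow>
        disjoint_family_on (\<lambda>i. {p i<..<q i}) {..<m} \<Longrightarrow> (\<Sum>i<m. q i - p i) < \<delta> \<Longrightarrow>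
        (\<Sum>i<m. norm (u (q i) - u (p i))) < e'"
    using u[unfolded abs_cont_on_interval_def] by meson
  show "\<exists>\<delta>>0. \<forall>(N::nat) p q. (\<forall>i<N. c \<le> p i \<and> p i \<le> q i \<and> q i \<le> d) \<and>
        disjoint_family_on (\<lambda>i. {p i<..<q i}) {..<N} \<and> (\<Sum>i<N. q i - p i) < \<delta> \<longrightarrow>
        (\<Sum>i<N. norm (w (q i) - w (p i))) < eps"
  \<comment> \<open>The minimum controls both sums: the increments of \<open>u\<close> through
    \<delta>, the total length directly by \<open>e'\<close>. Each contributes at most K *
    e'.\<close>
  proof (intro exI[of _ "min \<delta> e'"] conjI allI impI)
    fix m :: nat and p q
    assume H: "(\<forall>i<m. c \<le> p i \<and> p i \<le> q i \<and> q i \<le> d) \<and>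
        disjoint_family_on (\<lambda>i. {p i<..<q i}) {..<m} \<and> (\<Sum>i<m. q i - p i) < min \<delta> e'"
    then have s: "(\<Sum>i<m. norm (u (q i) - u (p i))) < e'" using sub by (intro *) (auto intro: order_trans)
    have "(\<Sum>i<m. norm (w (q i) - w (p i))) \<le> (\<Sum>i<m. K * norm (u (q i) - u (p i)) + K * (q i - p i))"
      using H L by (intro sum_mono) auto
    also have "\<dots> = K * (\<Sum>i<m. norm (u (q i) - u (p i))) + K * (\<Sum>i<m. q i - p i)"
      by (simp add: sum.distrib sum_distrib_left)
    also have "\<dots> \<le> K * e' + K * e'"
      using K s H by (intro add_mono mult_left_mono) auto
    also have "\<dots> < 2 * (K + 1) * e'" using e' by (simp add: algebra_simps)
    also have "\<dots> = eps" using K by (simp add: e'_def)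
    finally show "(\<Sum>i<m. norm (w (q i) - w (p i))) < eps" .
  qed (use d e' in auto)
qed

lemma abs_cont_subinterval:
  "abs_cont_on_interval a b u \<Longrightarrow> a \<le> c \<Longrightarrow> d \<le> b \<Longrightarrow> abs_cont_on_interval c d u"
  by (erule abs_cont_of_bound[of _ _ _ _ _ 1]) auto

lemma abs_cont_lipschitz:
  assumes "L-lipschitz_on {a..b} w"
  shows "abs_cont_on_interval a b w"
proof -
  have "abs_cont_on_interval a b (\<lambda>t. 0::real)"
    by (auto simp: abs_cont_on_interval_def intro: exI[of _ 1])
  moreover have "L \<ge> 0" using assms lipschitz_on_nonneg by blast
  moreover have "norm (w t - w s) \<le> L * norm (0 - 0::real) + L * (t - s)" if "a \<le> s" "s \<le> t" "t \<le> b" for s t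
    using lipschitz_onD[OF assms, of t s] that by (simp add: dist_norm)
  ultimately show ?thesis by (rule abs_cont_of_bound[OF _ order_refl order_refl])
qed

lemma abs_cont_continuous_on:
  assumes u: "abs_cont_on_interval a b u"
  shows "continuous_on {a..b} u"
  unfolding continuous_on_iff
proof (intro ballI allI impI)
  fix t and e :: real assume t: "t \<in> {a..b}" and e: "e > 0"
  then obtain \<delta> where d: "\<delta> > 0" and *: "\<And>(m::nat) p q. (\<forall>i<m. a \<le> p i \<and> p i \<le> q i \<and> q i \<le> b) \<Longrightarrow>
        disjoint_family_on (\<lambda>i. {p i<..<q i}) {..<m} \<Longrightarrow> (\<Sum>i<m. q i - p i) < \<delta> \<Longrightarrow>
        (\<Sum>i<m. norm (u (q i) - u (p i))) < e"
    using u[unfolded abs_cont_on_interval_def] by meson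
  have "dist (u s) (u t) < e" if "s \<in> {a..b}" "dist s t < \<delta>" for s
    using *[of 1 "\<lambda>_. min s t" "\<lambda>_. max s t"] that t
    by (cases "s \<le> t") (auto simp: dist_norm disjoint_family_on_def norm_minus_commute)
  then show "\<exists>d>0. \<forall>s\<in>{a..b}. dist s t < d \<longrightarrow> dist (u s) (u t) < e" using d by blast
qed

lemma abs_cont_inner:
  fixes x :: "real \<Rightarrow> 'a::real_inner"
  assumes "abs_cont_on_interval a b x"
  shows "abs_cont_on_interval a b (\<lambda>t. r \<bullet> x t + k)"
proof (rule abs_cont_of_bound[OF assms order_refl order_refl norm_ge_zero[of r]])
  fix s t :: real assume "s \<le> t"
  have "norm (r \<bullet> x t + k - (r \<bullet> x s + k)) \<le> norm r * norm (x t - x s)"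
    using Cauchy_Schwarz_ineq2[of r "x t - x s"] by (simp add: inner_diff_right)
  also have "\<dots> \<le> norm r * norm (x t - x s) + norm r * (t - s)" using \<open>s \<le> t\<close> by simp
  finally show "norm (r \<bullet> x t + k - (r \<bullet> x s + k)) \<le> norm r * norm (x t - x s) + norm r * (t - s)" .
qed

lemma abs_cont_increment_le:
  fixes u :: "real \<Rightarrow> real"
  assumes ab: "a \<le> b" and ac: "abs_cont_on_interval a b u" and N: "negligible N"
    and der: "\<And>t. t \<in> {a<..<b} - N \<Longrightarrow> \<exists>d. (u has_real_derivative d) (at t) \<and> d \<le> B"
  shows "u b - u a \<le> B * (b - a)"
proof -
  have "abs_cont_on_interval a b (\<lambda>t. u t - B * t)"
  proof (rule abs_cont_of_bound[OF ac order_refl order_refl, of "\<bar>B\<bar> + 1"])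
    fix s t :: real assume st: "a \<le> s" "s \<le> t" "t \<le> b"
    have "norm (u t - B * t - (u s - B * s)) = \<bar>(u t - u s) - B * (t - s)\<bar>" by (simp add: algebra_simps)
    also have "\<dots> \<le> \<bar>u t - u s\<bar> + \<bar>B\<bar> * (t - s)"
      using abs_triangle_ineq4[of "u t - u s" "B * (t - s)"] st by (simp add: abs_mult)
    also have "\<dots> \<le> (\<bar>B\<bar> + 1) * norm (u t - u s) + (\<bar>B\<bar> + 1) * (t - s)"
      using st mult_right_mono[of 1 "\<bar>B\<bar> + 1" "norm (u t - u s)"] mult_right_mono[of "\<bar>B\<bar>" "\<bar>B\<bar> + 1" "t - s"] by simp
    finally show "norm (u t - B * t - (u s - B * s)) \<le> (\<bar>B\<bar> + 1) * norm (u t - u s) + (\<bar>B\<bar> + 1) * (t - s)" .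
  qed simp
  \<comment> \<open>The derivative bound is assumed only in the open interval, so the endpoints join
    the exceptional set.\<close>
  moreover have "negligible (N \<union> {a, b})" using N by simp
  moreover have "\<exists>d\<le>0. ((\<lambda>t. u t - B * t) has_real_derivative d) (at t)" if t: "t \<in> {a..b} - (N \<union> {a, b})" for t
  proof -
    obtain d where d: "(u has_real_derivative d) (at t)" "d \<le> B" using der[of t] t by auto
    then show ?thesis by (intro exI[of _ "d - B"]) (auto intro!: derivative_eq_intros)
  qed
  ultimately have "u b - B * b \<le> u a - B * a" using abs_cont_decreasing[OF ab] by blast
  then show ?thesis by (simp add: algebra_simps)
qed

text \<open>A vector-valued mean value inequality. Pairing the curve with its own defect
  \<open>D\<close> reduces it to the scalar estimate and bounds the square of \<open>norm D\<close>
  by norm D * B * (b - a).\<close>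

lemma abs_cont_increment:
  fixes x :: "real \<Rightarrow> 'a::euclidean_space"
  assumes ab: "a \<le> b" and ac: "abs_cont_on_interval a b x" and N: "negligible N"
    and der: "\<And>t. t \<in> {a<..<b} - N \<Longrightarrow> \<exists>v. (x has_vector_derivative v) (at t) \<and> norm (v - w) \<le> B"
  shows "norm (x b - x a - (b - a) *\<^sub>R w) \<le> B * (b - a)"
proof -
  define D where "D = x b - x a - (b - a) *\<^sub>R w"
  have "D \<bullet> x b + 0 - (D \<bullet> x a + 0) \<le> (D \<bullet> w + B * norm D) * (b - a)"
  proof (rule abs_cont_increment_le[OF ab abs_cont_inner[OF ac] N])
    fix t :: real assume t: "t \<in> {a<..<b} - N"
    obtain v where v: "(x has_vector_derivative v) (at t)" "norm (v - w) \<le> B" using der[OF t] by blast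
    have "((\<lambda>t. D \<bullet> x t) has_vector_derivative D \<bullet> v) (at t)"
      by (rule bounded_linear.has_vector_derivative[OF bounded_linear_inner_right v(1)])
    then have 1: "((\<lambda>t. D \<bullet> x t + 0) has_real_derivative D \<bullet> v) (at t)"
      by (simp add: has_real_derivative_iff_has_vector_derivative)
    have "D \<bullet> (v - w) \<le> norm D * B"
      using norm_cauchy_schwarz[of D "v - w"] v(2) by (meson mult_left_mono norm_ge_zero order_trans)
    then have "D \<bullet> v \<le> D \<bullet> w + B * norm D" by (simp add: inner_diff_right algebra_simps)
    with 1 show "\<exists>d. ((\<lambda>t. D \<bullet> x t + 0) has_real_derivative d) (at t) \<and> d \<le> D \<bullet> w + B * norm D" by blast
  qed
  then have "D \<bullet> D \<le> B * norm D * (b - a)"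
    by (simp add: D_def inner_diff_right algebra_simps)
  then have "norm D * norm D \<le> norm D * (B * (b - a))"
    by (simp add: algebra_simps dot_square_norm power2_eq_square)
  \<comment> \<open>Cancelling \<open>norm D\<close> leaves the case D = 0. There the sign of
    \<open>B\<close> comes from a time outside \<open>N\<close>, which exists because a
    nondegenerate interval is not negligible.\<close>
  moreover have "0 \<le> B * (b - a)" if "norm D = 0"
  proof (cases "a = b")
    case False
    have "\<not> {a<..<b} \<subseteq> N"
      using N False ab negligible_subset[OF N, of "box a b"] negligible_interval(2)[of a b] by auto
    then obtain t where "t \<in> {a<..<b} - N" by blast
    then show ?thesis using der[of t] ab by (meson diff_ge_0_iff_ge mult_nonneg_nonneg norm_ge_zero order_trans)
  qed simp
  ultimately show ?thesis unfolding D_def[symmetric]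
    by (metis mult_le_cancel_left_pos norm_ge_zero order_less_le)
qed

section \<open>Lipschitz functions are differentiable almost everywhere\<close>

text \<open>The Stieltjes measures of \<open>g\<close> and of \<open>t \<mapsto> t - g t\<close> add up to Lebesgue measure, which gives absolute
  continuity and hence a Radon--Nikodym density.\<close>

lemma monotone_density:
  fixes g :: "real \<Rightarrow> real"
  assumes g: "\<And>s t. s \<le> t \<Longrightarrow> 0 \<le> g t - g s \<and> g t - g s \<le> t - s"
  obtains \<phi> :: "real \<Rightarrow> real" where "\<And>a b. a \<le> b \<Longrightarrow> (\<phi> has_integral (g b - g a)) {a..b}"
proof -
  have cont: "continuous (at_right a) (\<lambda>t. k * g t + m * t)" "continuous_on UNIV (\<lambda>t. k * g t + m * t)" for a k m
  proof -
    have "1-lipschitz_on UNIV g"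
      using g by (intro lipschitz_on_leI) (force simp: dist_real_def abs_le_iff)+
    then have "continuous_on UNIV g" by (rule lipschitz_on_continuous_on)
    then show *: "continuous_on UNIV (\<lambda>t. k * g t + m * t)" by (intro continuous_intros)
    then show "continuous (at_right a) (\<lambda>t. k * g t + m * t)"
      using continuous_on_eq_continuous_at continuous_within_subset by blast
  qed
  define g2 where "g2 t = t - g t" for t
  let ?M = interval_measure
  have c: "continuous_on UNIV g" "continuous_on UNIV g2" "continuous (at_right a) g" "continuous (at_right a) g2" for a
    using cont(2)[of 1 0] cont(2)[of "-1" 1] cont(1)[of a 1 0] cont(1)[of a "-1" 1] by (simp_all add: g2_def[abs_def])
  have mono: "g s \<le> g t" "g2 s \<le> g2 t" if "s \<le> t" for s t
    using g[OF that] by (auto simp: g2_def)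
  have Icc: "emeasure (?M g) {a..b} = ennreal (g b - g a)" "emeasure (?M g2) {a..b} = ennreal (g2 b - g2 a)" if "a \<le> b" for a b
    using mono c that by (auto intro!: emeasure_interval_measure_Icc)
  have Ioc: "emeasure (?M g) {a<..b} = ennreal (g b - g a)" "emeasure (?M g2) {a<..b} = ennreal (g2 b - g2 a)" if "a \<le> b" for a b
    using mono c that by (auto intro!: emeasure_interval_measure_Ioc)
  \<comment> \<open>Continuity rules out atoms. Open intervals are the boxes on which
    \<open>lborel_eqI\<close> compares the sum measure with Lebesgue measure.\<close>
  have Ioo: "emeasure (?M g) {a<..<b} = ennreal (g b - g a)" "emeasure (?M g2) {a<..<b} = ennreal (g2 b - g2 a)" if "a \<le> b" for a b
  proof -
    have "{b} \<in> null_sets (?M g)" "{b} \<in> null_sets (?M g2)"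
      using Icc[of b b] by (auto simp: null_sets_def)
    then have "emeasure (?M g) ({a<..b} - {b}) = emeasure (?M g) {a<..b}"
         "emeasure (?M g2) ({a<..b} - {b}) = emeasure (?M g2) {a<..b}"
      by (auto intro!: emeasure_Diff_null_set)
    moreover have "{a<..b} - {b} = {a<..<b}" by auto
    ultimately show "emeasure (?M g) {a<..<b} = ennreal (g b - g a)" "emeasure (?M g2) {a<..<b} = ennreal (g2 b - g2 a)"
      using Ioc[OF that] by auto
  qed
  define S where "S = measure_of UNIV (sets borel) (\<lambda>A. emeasure (?M g) A + emeasure (?M g2) A)"
  have setsS: "sets S = sets borel" unfolding S_def
    by (metis sets.sets_measure_of_eq space_borel)
  have ca: "countably_additive (sets S) (\<lambda>A. emeasure (?M g) A + emeasure (?M g2) A)"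
    unfolding countably_additive_def setsS
    by (auto simp: suminf_add[symmetric] suminf_emeasure)
  have emS: "emeasure S A = emeasure (?M g) A + emeasure (?M g2) A" if "A \<in> sets borel" for A
    by (rule emeasure_measure_of[OF S_def _ _ ca]) (use that setsS in \<open>auto simp: positive_def\<close>)
  have "lborel = S"
  proof (rule lborel_eqI)
    fix l u :: real assume "\<And>b. b \<in> Basis \<Longrightarrow> l \<bullet> b \<le> u \<bullet> b"
    then have lu: "l \<le> u" by simp
    have "emeasure S (box l u) = ennreal (g u - g l) + ennreal (g2 u - g2 l)"
      using emS[of "{l<..<u}"] Ioo[OF lu] by simp
    also have "\<dots> = ennreal (u - l)"
      using g[OF lu] by (subst ennreal_plus[symmetric]) (auto simp: g2_def)
    finally show "emeasure S (box l u) = ennreal (\<Prod>b\<in>Basis. (u - l) \<bullet> b)" by simp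
  qed (rule setsS)
  then have dom: "emeasure (?M g) A \<le> emeasure lborel A" if "A \<in> sets borel" for A
    using emS[OF that] by simp
  have ac: "absolutely_continuous lborel (?M g)"
    unfolding absolutely_continuous_def
  proof
    fix A assume A: "A \<in> null_sets (lborel :: real measure)"
    then have "A \<in> sets borel" "emeasure lborel A = 0" by (auto simp: null_sets_def)
    then show "A \<in> null_sets (?M g)" using dom[of A] by (auto simp: null_sets_def)
  qed
  have sfm: "sigma_finite_measure (?M g)"
    using g cont(1)[of _ 1 0] by (intro sigma_finite_interval_measure) (auto simp: algebra_simps)
  define \<Phi> where "\<Phi> = RN_deriv lborel (?M g)"
  have m[measurable]: "\<Phi> \<in> borel_measurable borel"
    unfolding \<Phi>_def using borel_measurable_RN_deriv[of lborel "?M g"] by simp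
  have dens: "density lborel \<Phi> = ?M g"
    unfolding \<Phi>_def using ac by (intro sigma_finite_measure.density_RN_deriv sigma_finite_lborel) auto
  have fin: "AE x in lborel. \<Phi> x \<noteq> \<infinity>"
    unfolding \<Phi>_def using ac sfm by (intro sigma_finite_measure.RN_deriv_finite sigma_finite_lborel) auto
  define \<phi> where "\<phi> x = enn2real (\<Phi> x)" for x
  have "(\<phi> has_integral (g b - g a)) {a..b}" if "a \<le> b" for a b
  proof -
    have "(\<integral>\<^sup>+ x. ennreal (indicator {a..b} x * \<phi> x) \<partial>lborel) = (\<integral>\<^sup>+ x. \<Phi> x * indicator {a..b} x \<partial>lborel)"
      using fin by (intro nn_integral_cong_AE) (auto simp: \<phi>_def indicator_def less_top)
    also have "\<dots> = emeasure (density lborel \<Phi>) {a..b}"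
      by (subst emeasure_density) auto
    also have "\<dots> = ennreal (g b - g a)" using dens Icc(1)[OF that] by simp
    finally have "((\<lambda>x. indicator {a..b} x * \<phi> x) has_integral (g b - g a)) UNIV"
      using g[OF that] by (intro nn_integral_has_integral) (auto simp: \<phi>_def)
    also have "(\<lambda>x. indicator {a..b} x * \<phi> x) = (\<lambda>x. if x \<in> {a..b} then \<phi> x else 0)"
      by (auto simp: indicator_def)
    finally show ?thesis using has_integral_restrict_UNIV by blast
  qed
  then show ?thesis using that by blast
qed

text \<open>Lebesgue differentiation with averages over cubes whose lower corner is
  \<open>x\<close>, hence only for right-hand quotients; reflection will supply the left-hand
  ones.\<close>

lemma integral_right_derivative:
  fixes g \<phi> :: "real \<Rightarrow> real"
  assumes "\<And>a b. a \<le> b \<Longrightarrow> (\<phi> has_integral (g b - g a)) {a..b}"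
  obtains N where "negligible N"
    "\<And>x e. x \<notin> N \<Longrightarrow> e > 0 \<Longrightarrow> \<exists>d>0. \<forall>h. 0 < h \<and> h < d \<longrightarrow> \<bar>(g (x + h) - g x) / h - \<phi> x\<bar> < e"
proof -
  have "\<phi> integrable_on cbox a b" for a b
    using assms[of a b] by (cases "a \<le> b") auto
  then obtain N where N: "negligible N" "\<And>x e. \<lbrakk>x \<notin> N; 0 < e\<rbrakk> \<Longrightarrow>
      \<exists>d>0. \<forall>h. 0 < h \<and> h < d \<longrightarrow> norm (integral (cbox x (x + h *\<^sub>R One)) \<phi> /\<^sub>R h ^ DIM(real) - \<phi> x) < e"
    using integrable_ccontinuous_explicit[of \<phi>] by blast
  have "integral (cbox x (x + h *\<^sub>R One)) \<phi> /\<^sub>R h ^ DIM(real) = (g (x + h) - g x) / h" if "h > 0" for x h :: real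
    using integral_unique[OF assms, of x "x + h"] that by (simp add: divide_inverse_commute)
  then show ?thesis using that[OF N(1)] N(2) by simp
qed

text \<open>The density and its reflection t \<mapsto> \<phi>(- t) give right and left derivatives
  off two null sets, both with the value \<phi>(t).\<close>

lemma monotone_differentiable_ae:
  fixes g :: "real \<Rightarrow> real"
  assumes g: "\<And>s t. s \<le> t \<Longrightarrow> 0 \<le> g t - g s \<and> g t - g s \<le> t - s"
  obtains N where "negligible N" "\<And>t. t \<notin> N \<Longrightarrow> \<exists>d. (g has_real_derivative d) (at t)"
proof -
  obtain \<phi> where \<phi>: "\<And>a b. a \<le> b \<Longrightarrow> (\<phi> has_integral (g b - g a)) {a..b}"
    using monotone_density[OF g] by blast
  have \<psi>: "((\<lambda>t. \<phi> (- t)) has_integral (- g (-b) - (- g (-a)))) {a..b}" if "a \<le> b" for a b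
    using has_integral_reflect_real[where a = "-b" and b = "-a" and f = \<phi>] \<phi>[of "-b" "-a"] that by simp
  obtain N1 where N1: "negligible N1" "\<And>x e. x \<notin> N1 \<Longrightarrow> e > 0 \<Longrightarrow> \<exists>d>0. \<forall>h. 0 < h \<and> h < d \<longrightarrow> \<bar>(g (x + h) - g x) / h - \<phi> x\<bar> < e"
    using integral_right_derivative[of \<phi> g] \<phi> by blast
  obtain N2 where N2: "negligible N2" "\<And>x e. x \<notin> N2 \<Longrightarrow> e > 0 \<Longrightarrow> \<exists>d>0. \<forall>h. 0 < h \<and> h < d \<longrightarrow>
       \<bar>(- g (-(x + h)) - (- g (-x))) / h - \<phi> (- x)\<bar> < e"
    using integral_right_derivative[of "\<lambda>t. \<phi> (- t)" "\<lambda>t. - g (- t)"] \<psi> by blast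
  have "negligible (N1 \<union> uminus ` N2)"
    using N1 N2 by (intro negligible_Un negligible_differentiable_image_negligible) (auto intro!: derivative_intros)
  moreover have "(g has_real_derivative \<phi> t) (at t)" if "t \<notin> N1 \<union> uminus ` N2" for t
    unfolding DERIV_def LIM_eq
  proof (intro allI impI)
    fix e :: real assume "e > 0"
    have t: "t \<notin> N1" "- t \<notin> N2" using that by force+
    obtain d1 where d1: "d1 > 0" "\<And>h. 0 < h \<and> h < d1 \<Longrightarrow> \<bar>(g (t + h) - g t) / h - \<phi> t\<bar> < e"
      using N1(2)[OF t(1) \<open>e > 0\<close>] by blast
    obtain d2 where d2: "d2 > 0" "\<And>h. 0 < h \<and> h < d2 \<Longrightarrow> \<bar>(- g (-(- t + h)) - (- g (-(- t)))) / h - \<phi> (-(- t))\<bar> < e"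
      using N2(2)[OF t(2) \<open>e > 0\<close>] by blast
    have "norm ((g (t + h) - g t) / h - \<phi> t) < e" if "h \<noteq> 0" "norm (h - 0) < min d1 d2" for h
    proof (cases "h > 0")
      case False
      then have "(- g (-(- t + (-h))) - (- g (-(- t)))) / (-h) = (g (t + h) - g t) / h"
        by (simp add: minus_divide_left add.commute)
      then show ?thesis using d2(2)[of "-h"] that False by simp
    qed (use d1(2) that in auto)
    then show "\<exists>s>0. \<forall>h. h \<noteq> 0 \<and> norm (h - 0) < s \<longrightarrow> norm ((g (t + h) - g t) / h - \<phi> t) < e"
      using d1(1) d2(1) by (intro exI[of _ "min d1 d2"]) auto
  qed
  ultimately show ?thesis using that by blast
qed

lemma lipschitz_differentiable_ae:
  fixes f :: "real \<Rightarrow> real"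
  assumes L: "L-lipschitz_on UNIV f"
  obtains N where "negligible N" "\<And>t. t \<notin> N \<Longrightarrow> \<exists>d. (f has_real_derivative d) (at t)"
proof -
  define K where "K = L + 1"
  have K: "K > 0" using lipschitz_on_nonneg[OF L] by (simp add: K_def)
  \<comment> \<open>The normalisation maps slopes in [-K, K] to slopes in [0, 1], as the monotone
    case requires; K = L + 1 is positive even if L = 0.\<close>
  define g where "g t = (f t / K + t) / 2" for t
  have "0 \<le> g t - g s \<and> g t - g s \<le> t - s" if "s \<le> t" for s t
  proof -
    have "\<bar>f t - f s\<bar> \<le> K * (t - s)"
      using lipschitz_onD[OF L, of t s] that by (simp add: dist_real_def K_def algebra_simps)
    then have "\<bar>f t / K - f s / K\<bar> \<le> t - s"
      using K by (simp add: diff_divide_distrib[symmetric] abs_divide field_simps)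
    then show ?thesis unfolding g_def by argo
  qed
  then obtain N where N: "negligible N" "\<And>t. t \<notin> N \<Longrightarrow> \<exists>d. (g has_real_derivative d) (at t)"
    using monotone_differentiable_ae[of g thesis] by blast
  have feq: "f = (\<lambda>t. K * (2 * g t - t))" using K by (auto simp: g_def field_simps)
  have "\<exists>d. (f has_real_derivative d) (at t)" if t: "t \<notin> N" for t
  proof -
    obtain d where "(g has_real_derivative d) (at t)" using N(2)[OF t] by blast
    then have "(f has_real_derivative K * (2 * d - 1)) (at t)"
      by (subst feq) (auto intro!: derivative_eq_intros)
    then show ?thesis by blast
  qed
  then show ?thesis using that N(1) by blast
qed

text \<open>The working regularity class: it survives gluing, implies \<open>loc_abs_cont\<close>,
  and yields a derivative almost everywhere.\<close>

definition locally_lipschitz :: "(real \<Rightarrow> 'a::metric_space) \<Rightarrow> bool" where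
  "locally_lipschitz x \<longleftrightarrow> (\<forall>a b. \<exists>L. L-lipschitz_on {a..b} x)"

lemma locally_lipschitz_differentiable_ae:
  fixes x :: "real \<Rightarrow> 'a::euclidean_space"
  assumes x: "locally_lipschitz x"
  obtains N where "negligible N" "\<And>t. t \<notin> N \<Longrightarrow> \<exists>v. (x has_vector_derivative v) (at t)"
proof -
  \<comment> \<open>Clamping time to [-n, n] makes the curve globally Lipschitz without changing it
    near interior times; countably many \<open>n\<close> and finitely many coordinates still give
    one null set.\<close>
  define c where "c n t = max (- real n) (min (real n) t)" for n t
  have ex: "\<exists>N. negligible N \<and> (\<forall>t. t \<notin> N \<longrightarrow> (\<exists>d. ((\<lambda>t. x (c n t) \<bullet> b) has_real_derivative d) (at t)))"
    if b: "b \<in> Basis" for n b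
  proof -
    obtain L where L: "L-lipschitz_on {- real n..real n} x" using x by (auto simp: locally_lipschitz_def)
    have "L-lipschitz_on UNIV (\<lambda>t. x (c n t) \<bullet> b)"
    proof (rule lipschitz_onI)
      fix s t :: real
      have "dist (x (c n s) \<bullet> b) (x (c n t) \<bullet> b) \<le> dist (x (c n s)) (x (c n t))"
        using Basis_le_norm[OF b, of "x (c n s) - x (c n t)"] by (simp add: dist_norm inner_diff_left)
      also have "\<dots> \<le> L * dist (c n s) (c n t)"
        by (rule lipschitz_onD[OF L]) (auto simp: c_def)
      also have "\<dots> \<le> L * dist s t"
        using lipschitz_on_nonneg[OF L] by (intro mult_left_mono) (auto simp: c_def dist_real_def)
      finally show "dist (x (c n s) \<bullet> b) (x (c n t) \<bullet> b) \<le> L * dist s t" .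
    qed (rule lipschitz_on_nonneg[OF L])
    then show ?thesis by (rule lipschitz_differentiable_ae) blast
  qed
  then have "\<forall>n. \<forall>b\<in>Basis. \<exists>N. negligible N \<and> (\<forall>t. t \<notin> N \<longrightarrow> (\<exists>d. ((\<lambda>t. x (c n t) \<bullet> b) has_real_derivative d) (at t)))"
    by blast
  then have "\<forall>n. \<exists>N. \<forall>b\<in>Basis. negligible (N b) \<and> (\<forall>t. t \<notin> N b \<longrightarrow> (\<exists>d. ((\<lambda>t. x (c n t) \<bullet> b) has_real_derivative d) (at t)))"
    by (intro allI bchoice) blast
  from choice[OF this] obtain N where N: "\<And>n b. b \<in> Basis \<Longrightarrow> negligible (N n b)"
     "\<And>n b t. b \<in> Basis \<Longrightarrow> t \<notin> N n b \<Longrightarrow> \<exists>d. ((\<lambda>t. x (c n t) \<bullet> b) has_real_derivative d) (at t)"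
    by blast
  have "negligible (\<Union>n. \<Union>b\<in>Basis. N n b)"
    using N(1) by (intro negligible_Union_nat negligible_Union) auto
  moreover have "\<exists>v. (x has_vector_derivative v) (at t)" if t: "t \<notin> (\<Union>n. \<Union>b\<in>Basis. N n b)" for t
  proof -
    obtain n :: nat where n: "\<bar>t\<bar> < real n" using reals_Archimedean2 by blast
    have "\<exists>d. ((\<lambda>t. x t \<bullet> b) has_real_derivative d) (at t)" if b: "b \<in> Basis" for b
    proof -
      obtain d where "((\<lambda>t. x (c n t) \<bullet> b) has_real_derivative d) (at t)" using N(2)[OF b] t b by blast
      then have "((\<lambda>t. x t \<bullet> b) has_real_derivative d) (at t)"
        by (rule has_field_derivative_transform_within_open[of _ _ _ "{- real n <..< real n}"]) (use n in \<open>auto simp: c_def\<close>)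
      then show ?thesis by blast
    qed
    then have "\<exists>d. \<forall>b\<in>Basis. ((\<lambda>t. x t \<bullet> b) has_real_derivative d b) (at t)" by (intro bchoice) blast
    then obtain d where d: "\<And>b. b \<in> Basis \<Longrightarrow> ((\<lambda>t. x t \<bullet> b) has_real_derivative d b) (at t)" by blast
    have "(x has_vector_derivative (\<Sum>b\<in>Basis. d b *\<^sub>R b)) (at t)"
      unfolding has_vector_derivative_def
      by (subst has_derivative_componentwise_within)
         (use d in \<open>auto simp: has_real_derivative_iff_has_vector_derivative has_vector_derivative_def\<close>)
    then show ?thesis by blast
  qed
  ultimately show ?thesis using that by blast
qed

section \<open>Existence for differential inclusions\<close>

text \<open>A product of balls over an uncountable index type is compact but need not be
  sequentially compact, so the cluster point comes with a filter finer than
  \<open>sequentially\<close> instead of a subsequence.\<close>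

lemma pointwise_cluster:
  fixes X :: "nat \<Rightarrow> 'b \<Rightarrow> 'a::euclidean_space"
  assumes R: "\<And>n t. norm (X n t) \<le> R t"
  obtains x H where "H \<noteq> bot" "H \<le> sequentially" "\<And>t. ((\<lambda>n. X n t) \<longlongrightarrow> x t) H"
proof -
  let ?C = "\<Pi>\<^sub>E t\<in>UNIV. cball 0 (R t) :: 'a set"
  have "compactin (product_topology (\<lambda>t::'b. euclidean) UNIV) ?C"
    unfolding compactin_PiE by simp
  then have "compact ?C"
    by (simp add: euclidean_product_topology)
  moreover have "eventually (\<lambda>f. f \<in> ?C) (filtermap X sequentially)"
    unfolding eventually_filtermap using R by (intro always_eventually) auto
  moreover have "filtermap X sequentially \<noteq> bot" by (simp add: filtermap_bot_iff)
  ultimately obtain x where x: "inf (nhds x) (filtermap X sequentially) \<noteq> bot"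
    unfolding compact_filter by blast
  \<comment> \<open>The filter is generated by tails and preimages of neighbourhoods of
    \<open>x\<close>; it is proper because \<open>x\<close> is a cluster point.\<close>
  define H where "H = inf sequentially (filtercomap X (nhds x))"
  have "H \<noteq> bot"
  proof
    assume "H = bot"
    then have "eventually (\<lambda>n. False) H" by simp
    then obtain Q S where QS: "eventually Q sequentially" "eventually S (filtercomap X (nhds x))" "\<And>n. Q n \<Longrightarrow> S n \<Longrightarrow> False"
      unfolding H_def eventually_inf by blast
    obtain V where V: "eventually V (nhds x)" "\<And>n. V (X n) \<Longrightarrow> S n"
      using QS(2) unfolding eventually_filtercomap by blast
    have "eventually (\<lambda>f. \<not> V f) (filtermap X sequentially)"
      unfolding eventually_filtermap using QS(1) by (rule eventually_mono) (use QS V in blast)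
    then have "eventually (\<lambda>f. False) (inf (nhds x) (filtermap X sequentially))"
      unfolding eventually_inf using V(1) by blast
    then show False using x by (simp add: eventually_False)
  qed
  moreover have "H \<le> sequentially" by (simp add: H_def)
  moreover have "((\<lambda>n. X n t) \<longlongrightarrow> x t) H" for t
  proof -
    have "filterlim X (nhds x) H"
      unfolding H_def by (rule filterlim_mono[OF filterlim_filtercomap order_refl]) simp
    show ?thesis
    proof (rule topological_tendstoI)
      fix S :: "'a set" assume S: "open S" "x t \<in> S"
      have "open ((\<lambda>f. f t) -` S :: ('b \<Rightarrow> 'a) set)"
        by (intro open_vimage S continuous_on_product_coordinates)
      then have "eventually (\<lambda>f. f \<in> (\<lambda>f. f t) -` S) (nhds x)"
        using S(2) by (intro eventually_nhds_in_open) auto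
      then show "eventually (\<lambda>n. X n t \<in> S) H"
        using \<open>filterlim X (nhds x) H\<close> by (auto simp: filterlim_iff)
    qed
  qed
  ultimately show ?thesis using that by blast
qed

text \<open>The norm bound makes the approximations equi-Lipschitz up to the step; the half-space
  bound is what survives in the limit and puts the derivative into a convex hull.\<close>

lemma euler_increment:
  fixes p :: "nat \<Rightarrow> 'a::real_inner"
  assumes p: "\<And>k. p (Suc k) = p k + \<delta> *\<^sub>R v k" and "\<delta> > 0" "i \<le> j"
  shows "(\<And>k. i \<le> k \<Longrightarrow> k < j \<Longrightarrow> norm (v k) \<le> B) \<Longrightarrow> norm (p j - p i) \<le> real (j - i) * \<delta> * B"
    and "(\<And>k. i \<le> k \<Longrightarrow> k < j \<Longrightarrow> w \<bullet> v k \<le> \<sigma>) \<Longrightarrow> w \<bullet> (p j - p i) \<le> real (j - i) * \<delta> * \<sigma>"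
proof -
  have eq: "p j - p i = (\<Sum>k\<in>{i..<j}. \<delta> *\<^sub>R v k)"
    using sum_Suc_diff'[OF \<open>i \<le> j\<close>, of p] p by simp
  show "norm (p j - p i) \<le> real (j - i) * \<delta> * B" if "\<And>k. i \<le> k \<Longrightarrow> k < j \<Longrightarrow> norm (v k) \<le> B"
  proof -
    have "norm (p j - p i) \<le> (\<Sum>k\<in>{i..<j}. \<delta> * B)"
      unfolding eq using that \<open>\<delta> > 0\<close> by (intro sum_norm_le) auto
    then show ?thesis by simp
  qed
  show "w \<bullet> (p j - p i) \<le> real (j - i) * \<delta> * \<sigma>" if "\<And>k. i \<le> k \<Longrightarrow> k < j \<Longrightarrow> w \<bullet> v k \<le> \<sigma>"
  proof -
    have "w \<bullet> (p j - p i) \<le> (\<Sum>k\<in>{i..<j}. \<delta> * \<sigma>)"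
      unfolding eq inner_sum_right using that \<open>\<delta> > 0\<close> by (intro sum_mono) auto
    then show ?thesis by simp
  qed
qed

text \<open>Rounding both endpoints to the grid changes the elapsed time by at most one step, an
  error that vanishes with \<delta>.\<close>

lemma floor_steps:
  fixes \<delta> s t :: real
  assumes "\<delta> > 0" "0 \<le> s" "s \<le> t"
  defines "i \<equiv> nat \<lfloor>s / \<delta>\<rfloor>" and "j \<equiv> nat \<lfloor>t / \<delta>\<rfloor>"
  shows "i \<le> j" "real j * \<delta> \<le> t" "\<bar>real (j - i) * \<delta> - (t - s)\<bar> \<le> \<delta>"
proof -
  have le: "s / \<delta> \<le> t / \<delta>" "0 \<le> s / \<delta>" using assms by (auto intro: divide_right_mono)
  show ij: "i \<le> j" unfolding i_def j_def using le by (intro nat_mono floor_mono)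
  have i: "real i \<le> s / \<delta>" "s / \<delta> < real i + 1" and j: "real j \<le> t / \<delta>" "t / \<delta> < real j + 1"
    unfolding i_def j_def using le by linarith+
  have i': "real i * \<delta> \<le> s" "s < (real i + 1) * \<delta>" and j': "real j * \<delta> \<le> t" "t < (real j + 1) * \<delta>"
    using i j \<open>\<delta> > 0\<close> by (simp_all add: field_simps)
  show "real j * \<delta> \<le> t" by fact
  have "real (j - i) * \<delta> = real j * \<delta> - real i * \<delta>" using ij by (simp add: of_nat_diff algebra_simps)
  then show "\<bar>real (j - i) * \<delta> - (t - s)\<bar> \<le> \<delta>" using i' j' by (simp add: algebra_simps abs_le_iff)
qed

text \<open>Piecewise constant Euler approximations have a pointwise cluster point by Tychonoff's theorem;
  pointwise limits suffice because the approximations are equi-Lipschitz up to the step size.\<close>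

theorem differential_inclusion_exists:
  fixes F :: "'a::euclidean_space \<Rightarrow> 'a set"
  assumes ne: "\<And>x. F x \<noteq> {}" and cpt: "\<And>x. compact (F x)"
    and a: "a > 0" and growth: "\<And>x u. u \<in> F x \<Longrightarrow> norm u \<le> a * (1 + norm x)"
    and usc: "\<And>x w \<sigma>. (\<And>u. u \<in> F x \<Longrightarrow> w \<bullet> u < \<sigma>) \<Longrightarrow> \<exists>\<rho>>0. \<forall>z\<in>ball x \<rho>. \<forall>u\<in>F z. w \<bullet> u < \<sigma>"
  obtains x where "x 0 = \<xi>" "\<And>T. \<exists>L. L-lipschitz_on {0..T} x"
    "\<And>t v. t \<ge> 0 \<Longrightarrow> (x has_vector_derivative v) (at t) \<Longrightarrow> v \<in> convex hull F (x t)"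
proof -
  define v where "v z = (SOME u. u \<in> F z)" for z
  have v: "v z \<in> F z" for z unfolding v_def using ne by (metis some_in_eq)
  define \<delta> where "\<delta> n = 1 / real (Suc n)" for n
  have \<delta>: "\<delta> n > 0" "\<delta> n \<le> 1" for n by (auto simp: \<delta>_def)
  define p where "p n = rec_nat \<xi> (\<lambda>k z. z + \<delta> n *\<^sub>R v z)" for n
  have p0: "p n 0 = \<xi>" and pS: "p n (Suc k) = p n k + \<delta> n *\<^sub>R v (p n k)" for n k by (simp_all add: p_def)
  \<comment> \<open>Discrete Gronwall majorant: one Euler step multiplies 1 + norm by at most 1 + a
    * \<delta>, hence by at most exp (a * \<delta>).\<close>
  define R where "R t = (1 + norm \<xi>) * exp (a * t)" for t
  have Rmono: "R s \<le> R t" if "s \<le> t" for s t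
    unfolding R_def using a that by (intro mult_left_mono) auto
  have pR: "1 + norm (p n k) \<le> R (real k * \<delta> n)" for n k
  proof (induction k)
    case 0
    then show ?case by (simp add: p0 R_def)
  next
    case (Suc k)
    have "norm (p n (Suc k)) \<le> norm (p n k) + \<delta> n * norm (v (p n k))"
      unfolding pS using norm_triangle_ineq[of "p n k" "\<delta> n *\<^sub>R v (p n k)"] \<delta>(1)[of n] by simp
    also have "\<dots> \<le> norm (p n k) + \<delta> n * (a * (1 + norm (p n k)))"
      using growth[OF v] \<delta>(1)[of n] by (intro add_left_mono mult_left_mono) auto
    finally have "1 + norm (p n (Suc k)) \<le> (1 + norm (p n k)) * (1 + a * \<delta> n)" by (simp add: algebra_simps)
    also have "\<dots> \<le> R (real k * \<delta> n) * exp (a * \<delta> n)"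
      using Suc \<delta>(1)[of n] a by (intro mult_mono) (auto simp: R_def)
    also have "\<dots> = R (real (Suc k) * \<delta> n)"
      by (simp add: R_def mult.assoc exp_add[symmetric] algebra_simps)
    finally show ?case .
  qed
  define X where "X n t = p n (nat \<lfloor>t / \<delta> n\<rfloor>)" for n t
  have XR: "norm (X n t) \<le> R (max 0 t)" for n t
  proof (cases "t \<ge> 0")
    case True
    then have "real (nat \<lfloor>t / \<delta> n\<rfloor>) * \<delta> n \<le> t" using floor_steps(2)[OF \<delta>(1)] by blast
    then show ?thesis using pR[of n "nat \<lfloor>t / \<delta> n\<rfloor>"] Rmono True unfolding X_def by (smt (verit))
  next
    case False
    then have "nat \<lfloor>t / \<delta> n\<rfloor> = 0" using \<delta>(1)[of n] by (simp add: divide_nonpos_pos)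
    then show ?thesis using False by (simp add: X_def p0 R_def)
  qed
  obtain x H where H: "H \<noteq> bot" "H \<le> sequentially" and lim: "\<And>t. ((\<lambda>n. X n t) \<longlongrightarrow> x t) H"
    by (rule pointwise_cluster[OF XR]) (rule that)
  have "\<delta> \<longlonglongrightarrow> 0" unfolding \<delta>_def by (rule LIMSEQ_Suc) (rule lim_1_over_n)
  then have \<delta>H: "(\<delta> \<longlongrightarrow> 0) H" using H(2) tendsto_mono by blast
  have speed: "norm (v (p n k)) \<le> a * R t" if "real k * \<delta> n \<le> t" for n k t
    using growth[OF v, of "p n k"] pR[of n k] Rmono[OF that] a by (smt (verit) mult_left_mono)
  have step: "norm (p n j - p n (nat \<lfloor>s / \<delta> n\<rfloor>)) \<le> (t - s + \<delta> n) * (a * R t)"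
    if "0 \<le> s" "s \<le> t" "nat \<lfloor>s / \<delta> n\<rfloor> \<le> j" "j \<le> nat \<lfloor>t / \<delta> n\<rfloor>" for n j s t
  proof -
    note fs = floor_steps[OF \<delta>(1) that(1,2), of n]
    have "norm (p n j - p n (nat \<lfloor>s / \<delta> n\<rfloor>)) \<le> real (j - nat \<lfloor>s / \<delta> n\<rfloor>) * \<delta> n * (a * R t)"
    proof (rule euler_increment(1)[where p = "p n" and v = "\<lambda>k. v (p n k)" and \<delta> = "\<delta> n", OF pS \<delta>(1) that(3)])
      fix k assume "k < j"
      then have "real k * \<delta> n \<le> real (nat \<lfloor>t / \<delta> n\<rfloor>) * \<delta> n" using that \<delta>(1)[of n] by (intro mult_right_mono of_nat_mono) auto
      then show "norm (v (p n k)) \<le> a * R t" using fs(2) by (intro speed) auto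
    qed
    also have "\<dots> \<le> (t - s + \<delta> n) * (a * R t)"
    proof (rule mult_right_mono)
      have "real (j - nat \<lfloor>s / \<delta> n\<rfloor>) * \<delta> n \<le> real (nat \<lfloor>t / \<delta> n\<rfloor> - nat \<lfloor>s / \<delta> n\<rfloor>) * \<delta> n"
        using that \<delta>(1)[of n] by (intro mult_right_mono of_nat_mono diff_le_mono) auto
      then show "real (j - nat \<lfloor>s / \<delta> n\<rfloor>) * \<delta> n \<le> t - s + \<delta> n" using fs(3) by linarith
    qed (use a in \<open>auto simp: R_def\<close>)
    finally show ?thesis .
  qed
  have "x 0 = \<xi>"
  proof -
    have "((\<lambda>n. X n 0) \<longlongrightarrow> \<xi>) H" by (simp add: X_def p0)
    then show ?thesis using tendsto_unique[OF H(1) lim] by blast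
  qed
  moreover have "\<exists>L. L-lipschitz_on {0..T} x" for T
  proof -
    have "(a * R T)-lipschitz_on {0..T} x"
    proof (rule lipschitz_on_leI)
      fix s t assume st: "s \<in> {0..T}" "t \<in> {0..T}" "s \<le> t"
      have "norm (X n t - X n s) \<le> (t - s + \<delta> n) * (a * R t)" for n
        unfolding X_def using st floor_steps(1)[OF \<delta>(1)] by (intro step) auto
      moreover have "((\<lambda>n. norm (X n t - X n s)) \<longlongrightarrow> norm (x t - x s)) H"
        by (intro tendsto_intros lim)
      moreover have "((\<lambda>n. (t - s + \<delta> n) * (a * R t)) \<longlongrightarrow> (t - s + 0) * (a * R t)) H"
        by (intro tendsto_intros \<delta>H)
      ultimately have "norm (x t - x s) \<le> (t - s + 0) * (a * R t)"
        using tendsto_le[OF H(1)] always_eventually by blast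
      also have "\<dots> \<le> (t - s) * (a * R T)"
        using st a Rmono[of t T] by (auto intro!: mult_left_mono)
      finally show "dist (x s) (x t) \<le> a * R T * dist s t"
        using st by (simp add: dist_norm norm_minus_commute algebra_simps)
    qed (use a in \<open>auto simp: R_def\<close>)
    then show ?thesis by blast
  qed
  moreover have "u \<in> convex hull F (x t)" if t: "t \<ge> 0" and du: "(x has_vector_derivative u) (at t)" for t u
  proof -
    \<comment> \<open>Half-space form of the claim: a strict bound for \<open>F (x t)\<close> in
      direction \<open>w\<close> persists nearby, so it bounds the Euler increments and then the
      derivative. Separation turns all such half-spaces into the convex hull.\<close>
    have half: "w \<bullet> u \<le> \<sigma>" if w: "\<And>u. u \<in> F (x t) \<Longrightarrow> w \<bullet> u < \<sigma>" for w \<sigma>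
    proof -
      obtain \<rho> where \<rho>: "\<rho> > 0" "\<And>z u. dist (x t) z < \<rho> \<Longrightarrow> u \<in> F z \<Longrightarrow> w \<bullet> u < \<sigma>"
        using usc[OF w] by (metis mem_ball)
      define B where "B = a * R (t + 1)"
      have B: "B > 0" using a by (auto simp: B_def R_def intro!: mult_pos_pos add_pos_nonneg)
      \<comment> \<open>The radius \<rho> is split in three: the distance of \<open>X n t\<close>
        from \<open>x t\<close>, the way h * B travelled up to t + h, and the grid error \<delta> n
        * B. All Euler points in between then obey the bound \<sigma>.\<close>
      have incr: "(w \<bullet> x (t + h) - w \<bullet> x t) / h \<le> \<sigma>" if h: "0 < h" "h < min 1 (\<rho> / (3 * B))" for h
      proof -
        have hB: "h * B < \<rho> / 3" using h B by (simp add: field_simps)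
        have "eventually (\<lambda>n. dist (X n t) (x t) < \<rho> / 3) H"
          using tendstoD[OF lim[of t], of "\<rho> / 3"] \<rho>(1) by simp
        moreover have "eventually (\<lambda>n. dist (\<delta> n) 0 < \<rho> / (3 * B)) H"
          using tendstoD[OF \<delta>H, of "\<rho> / (3 * B)"] \<rho>(1) B by simp
        ultimately have ev: "eventually (\<lambda>n. w \<bullet> (X n (t + h) - X n t) \<le> h * \<sigma> + \<delta> n * \<bar>\<sigma>\<bar>) H"
        proof eventually_elim
          case (elim n)
          let ?i = "nat \<lfloor>t / \<delta> n\<rfloor>" and ?j = "nat \<lfloor>(t + h) / \<delta> n\<rfloor>"
          have th: "t \<le> t + h" using h by simp
          note fs = floor_steps[OF \<delta>(1) t th, of n]
          have dB: "\<delta> n * B < \<rho> / 3" using elim(2) \<delta>(1)[of n] B by (simp add: dist_real_def field_simps)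
          have "w \<bullet> (p n ?j - p n ?i) \<le> real (?j - ?i) * \<delta> n * \<sigma>"
          proof (rule euler_increment(2)[where p = "p n" and v = "\<lambda>k. v (p n k)" and \<delta> = "\<delta> n", OF pS \<delta>(1) fs(1)])
            fix k assume k: "?i \<le> k" "k < ?j"
            have "norm (p n k - X n t) \<le> (t + h - t + \<delta> n) * (a * R (t + h))"
              unfolding X_def using k t h by (intro step) auto
            also have "\<dots> \<le> (h + \<delta> n) * B"
              using Rmono[of "t + h" "t + 1"] h a \<delta>(1)[of n] unfolding B_def by (auto intro!: mult_left_mono)
            also have "\<dots> < 2 * \<rho> / 3" using hB dB by (simp add: algebra_simps)
            finally have "dist (x t) (p n k) < \<rho>"
              using elim(1) dist_triangle[of "x t" "p n k" "X n t"]
                dist_norm[of "p n k" "X n t"] dist_commute[of "X n t" "p n k"] dist_commute[of "x t" "X n t"]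
              by linarith
            then show "w \<bullet> v (p n k) \<le> \<sigma>" using \<rho>(2) v by (meson less_imp_le)
          qed
          also have "\<dots> = h * \<sigma> + (real (?j - ?i) * \<delta> n - h) * \<sigma>" by (simp add: algebra_simps)
          also have "(real (?j - ?i) * \<delta> n - h) * \<sigma> \<le> \<delta> n * \<bar>\<sigma>\<bar>"
          proof -
            have "(real (?j - ?i) * \<delta> n - h) * \<sigma> \<le> \<bar>real (?j - ?i) * \<delta> n - h\<bar> * \<bar>\<sigma>\<bar>"
              by (metis abs_ge_self abs_mult)
            also have "\<dots> \<le> \<delta> n * \<bar>\<sigma>\<bar>" using fs(3) by (intro mult_right_mono) auto
            finally show ?thesis .
          qed
          finally show ?case unfolding X_def by simp
        qed
        have l1: "((\<lambda>n. w \<bullet> (X n (t + h) - X n t)) \<longlongrightarrow> w \<bullet> (x (t + h) - x t)) H"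
          by (intro tendsto_intros lim)
        have l2: "((\<lambda>n. h * \<sigma> + \<delta> n * \<bar>\<sigma>\<bar>) \<longlongrightarrow> h * \<sigma> + 0 * \<bar>\<sigma>\<bar>) H"
          by (intro tendsto_intros \<delta>H)
        have "w \<bullet> (x (t + h) - x t) \<le> h * \<sigma> + 0 * \<bar>\<sigma>\<bar>"
          by (rule tendsto_le[OF H(1) l2 l1 ev])
        then show ?thesis using h by (simp add: inner_diff_right field_simps)
      qed
      have "((\<lambda>s. w \<bullet> x s) has_vector_derivative w \<bullet> u) (at t)"
        by (rule bounded_linear.has_vector_derivative[OF bounded_linear_inner_right du])
      then have "(\<lambda>h. (w \<bullet> x (t + h) - w \<bullet> x t) / h) \<midarrow>0\<rightarrow> w \<bullet> u"
        by (simp add: has_real_derivative_iff_has_vector_derivative[symmetric] DERIV_def)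
      then have "((\<lambda>h. (w \<bullet> x (t + h) - w \<bullet> x t) / h) \<longlongrightarrow> w \<bullet> u) (at_right 0)"
        by (rule filterlim_mono) (auto simp: at_le)
      moreover have "eventually (\<lambda>h. (w \<bullet> x (t + h) - w \<bullet> x t) / h \<le> \<sigma>) (at_right 0)"
        unfolding eventually_at_right_field
        using \<rho>(1) B incr by (intro exI[of _ "min 1 (\<rho> / (3 * B))"]) auto
      ultimately show ?thesis by (rule tendsto_upperbound) simp
    qed
    show ?thesis
    proof (rule ccontr)
      assume "u \<notin> convex hull F (x t)"
      then obtain w b where wb: "w \<bullet> u < b" "\<And>z. z \<in> convex hull F (x t) \<Longrightarrow> w \<bullet> z > b"
        using separating_hyperplane_closed_point[of "convex hull F (x t)" u] cpt
        by (metis compact_convex_hull compact_imp_closed convex_convex_hull)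
      have "- w \<bullet> z < - b" if "z \<in> F (x t)" for z
        using wb(2)[of z] hull_subset[of "F (x t)" convex] that by auto
      then have "- w \<bullet> u \<le> - b" using half[of "- w" "- b"] by blast
      then show False using wb(1) by simp
    qed
  qed
  ultimately show ?thesis using that by blast
qed

section \<open>Chains of derivatives\<close>

text \<open>A Gronwall argument on a short interval: at a maximum of the sum of norms, the mean
  value inequality from \<open>a\<close> returns that maximum with a factor below 1.\<close>

lemma abs_cont_zero_unique:
  fixes w :: "nat \<Rightarrow> real \<Rightarrow> 'a::euclidean_space"
  assumes ab: "a \<le> b" and ac: "\<And>j. j \<le> h \<Longrightarrow> abs_cont_on_interval a b (w j)" and N: "negligible N"
    and der: "\<And>t j. t \<in> {a<..<b} - N \<Longrightarrow> j \<le> h \<Longrightarrow>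
      \<exists>v. (w j has_vector_derivative v) (at t) \<and> norm v \<le> K * (\<Sum>l\<le>h. norm (w l t))"
    and zero: "\<And>j. j \<le> h \<Longrightarrow> w j a = 0"
    and K: "K \<ge> 0" "K * real (h + 1) * (b - a) < 1"
    and t: "t \<in> {a..b}" and j: "j \<le> h"
  shows "w j t = 0"
proof -
  define s where "s t = (\<Sum>l\<le>h. norm (w l t))" for t
  have "continuous_on {a..b} s"
    unfolding s_def using abs_cont_continuous_on[OF ac] by (intro continuous_on_sum continuous_on_norm) auto
  then obtain t0 where t0: "t0 \<in> {a..b}" "\<And>t. t \<in> {a..b} \<Longrightarrow> s t \<le> s t0"
    using continuous_attains_sup[of "{a..b}" s] ab by auto
  have s0: "s t \<ge> 0" for t unfolding s_def by (intro sum_nonneg) auto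
  have "norm (w j t0) \<le> K * s t0 * (b - a)" if j: "j \<le> h" for j
  proof -
    have "norm (w j t0 - w j a - (t0 - a) *\<^sub>R 0) \<le> K * s t0 * (t0 - a)"
    proof (rule abs_cont_increment)
      show "abs_cont_on_interval a t0 (w j)" using abs_cont_subinterval[OF ac[OF j]] t0(1) by auto
      fix t assume t: "t \<in> {a<..<t0} - N"
      then obtain v where v: "(w j has_vector_derivative v) (at t)" "norm v \<le> K * s t"
        unfolding s_def using der[OF _ j, of t] t0(1) by auto
      moreover have "K * s t \<le> K * s t0" using t0 t K(1) by (intro mult_left_mono) auto
      ultimately show "\<exists>v. (w j has_vector_derivative v) (at t) \<and> norm (v - 0) \<le> K * s t0" by auto
    qed (use t0 N in auto)
    also have "\<dots> \<le> K * s t0 * (b - a)" using t0(1) K(1) s0 by (intro mult_left_mono) auto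
    finally show ?thesis using zero[OF j] by simp
  qed
  then have "s t0 \<le> (\<Sum>l\<le>h. K * s t0 * (b - a))"
    unfolding s_def[of t0] by (intro sum_mono) (auto simp: s_def)
  also have "\<dots> = K * real (h + 1) * (b - a) * s t0" by simp
  finally have "s t0 * (1 - K * real (h + 1) * (b - a)) \<le> 0" by (simp add: algebra_simps)
  then have "s t0 = 0" using K(2) s0[of t0] by (simp add: mult_le_0_iff)
  then have "s t = 0" using t0(2)[OF t] s0[of t] by simp
  then show ?thesis using j unfolding s_def by (simp add: sum_nonneg_eq_0_iff)
qed

text \<open>Near \<open>a\<close> the function \<open>z j\<close> has exact order \<open>(t - a)^(k - j)\<close> when \<open>k\<close> is the first index with
  \<open>z k a \<noteq> 0\<close>, so the coupling to functions of smaller index is of higher order.\<close>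

lemma chain_upper_bound:
  fixes z :: "nat \<Rightarrow> real \<Rightarrow> real"
  assumes ab: "a \<le> b" "b \<le> a + 1" and ac: "\<And>j. j \<le> k \<Longrightarrow> abs_cont_on_interval a b (z j)" and N: "negligible N"
    and der: "\<And>t j. t \<in> {a<..<b} - N \<Longrightarrow> j < k \<Longrightarrow>
      \<exists>d. (z j has_real_derivative d) (at t) \<and> \<bar>d\<bar> \<le> K * (\<Sum>l\<le>Suc j. \<bar>z l t\<bar>)"
    and zero: "\<And>j. j < k \<Longrightarrow> z j a = 0" and K: "K \<ge> 0"
  shows "\<exists>C\<ge>0. \<forall>j\<le>k. \<forall>t\<in>{a..b}. \<bar>z j t\<bar> \<le> C * (t - a) ^ min i (k - j)"
\<comment> \<open>Each round feeds the previous bound into the mean value inequality and gains one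
  power of t - a, capped at k - j; \<open>k\<close> rounds reach every cap.\<close>
proof (induction i)
  case 0
  have "\<exists>C. \<forall>t\<in>{a..b}. \<bar>z j t\<bar> \<le> C" if "j \<le> k" for j
  proof -
    have "compact (z j ` {a..b})" using abs_cont_continuous_on[OF ac[OF that]] by (intro compact_continuous_image) auto
    then have "bounded (z j ` {a..b})" by (rule compact_imp_bounded)
    then show ?thesis unfolding bounded_iff by auto
  qed
  then obtain C where C: "\<And>j t. j \<le> k \<Longrightarrow> t \<in> {a..b} \<Longrightarrow> \<bar>z j t\<bar> \<le> C j" by metis
  have C0: "0 \<le> C j" if "j \<le> k" for j using C[OF that, of a] ab by auto
  have "\<bar>z j t\<bar> \<le> (\<Sum>l\<le>k. C l)" if "j \<le> k" "t \<in> {a..b}" for j t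
    using C[OF that] member_le_sum[of j "{..k}" C] C0 that by auto
  then show ?case using C0 by (intro exI[of _ "\<Sum>l\<le>k. C l"]) (auto intro!: sum_nonneg)
next
  case (Suc i)
  then obtain C where C: "C \<ge> 0" "\<And>j t. j \<le> k \<Longrightarrow> t \<in> {a..b} \<Longrightarrow> \<bar>z j t\<bar> \<le> C * (t - a) ^ min i (k - j)" by blast
  define C' where "C' = max C (K * (real (k + 1) * C))"
  have "\<bar>z j t\<bar> \<le> C' * (t - a) ^ min (Suc i) (k - j)" if j: "j \<le> k" and t: "t \<in> {a..b}" for j t
  proof (cases "j = k")
    case True
    then show ?thesis using C(2)[OF j t] by (simp add: C'_def)
  next
    case False
    then have jk: "j < k" using j by simp
    define q where "q = min i (k - Suc j)"
    have q: "min (Suc i) (k - j) = Suc q" using jk by (auto simp: q_def)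
    have "norm (z j t - z j a - (t - a) *\<^sub>R 0) \<le> K * (real (k + 1) * (C * (t - a) ^ q)) * (t - a)"
    proof (rule abs_cont_increment)
      show "abs_cont_on_interval a t (z j)" using abs_cont_subinterval[OF ac[OF j]] t by auto
      fix s assume s: "s \<in> {a<..<t} - N"
      then obtain d where d: "(z j has_real_derivative d) (at s)" "\<bar>d\<bar> \<le> K * (\<Sum>l\<le>Suc j. \<bar>z l s\<bar>)"
        using der[OF _ jk, of s] t by auto
      have "\<bar>z l s\<bar> \<le> C * (t - a) ^ q" if "l \<le> Suc j" for l
      proof -
        have "\<bar>z l s\<bar> \<le> C * (s - a) ^ min i (k - l)" using C(2)[of l s] that jk s t by auto
        also have "\<dots> \<le> C * (s - a) ^ q"
          using C(1) s t ab that by (intro mult_left_mono power_decreasing) (auto simp: q_def)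
        also have "\<dots> \<le> C * (t - a) ^ q" using C(1) s by (intro mult_left_mono power_mono) auto
        finally show ?thesis .
      qed
      then have "(\<Sum>l\<le>Suc j. \<bar>z l s\<bar>) \<le> real (card {..Suc j}) * (C * (t - a) ^ q)"
        by (intro sum_bounded_above) auto
      also have "\<dots> \<le> real (k + 1) * (C * (t - a) ^ q)"
        using jk C(1) t by (intro mult_right_mono) auto
      finally have "K * (\<Sum>l\<le>Suc j. \<bar>z l s\<bar>) \<le> K * (real (k + 1) * (C * (t - a) ^ q))"
        using K by (rule mult_left_mono)
      then show "\<exists>v. (z j has_vector_derivative v) (at s) \<and> norm (v - 0) \<le> K * (real (k + 1) * (C * (t - a) ^ q))"
        using d by (intro exI[of _ d]) (simp add: has_real_derivative_iff_has_vector_derivative)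
    qed (use t N in auto)
    then have "\<bar>z j t\<bar> \<le> K * (real (k + 1) * C) * (t - a) ^ Suc q"
      using zero[OF jk] by (simp add: algebra_simps)
    also have "\<dots> \<le> C' * (t - a) ^ Suc q" using t by (intro mult_right_mono) (auto simp: C'_def)
    finally show ?thesis using q by simp
  qed
  then show ?case using C(1) by (intro exI[of _ C']) (auto simp: C'_def)
qed

text \<open>Lower bounds descend from \<open>z k\<close>: a bound c * (t - a)^i for one function
  gives one with exponent i + 1 for its predecessor. By \<open>chain_upper_bound\<close> the
  coupling terms in the derivative are O((t - a)^(i + 1)), against a main term of order (t -
  a)^i.\<close>

lemma chain_positive:
  fixes z :: "nat \<Rightarrow> real \<Rightarrow> real"
  assumes ab: "a < b" and ac: "\<And>j. j \<le> k \<Longrightarrow> abs_cont_on_interval a b (z j)" and N: "negligible N"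
    and der: "\<And>t j. t \<in> {a<..<b} - N \<Longrightarrow> j < k \<Longrightarrow>
      \<exists>d \<mu>. (z j has_real_derivative d) (at t) \<and> m \<le> \<mu> \<and> \<mu> \<le> K \<and> \<bar>d - \<mu> * z (Suc j) t\<bar> \<le> K * (\<Sum>l\<le>j. \<bar>z l t\<bar>)"
    and m: "m > 0" and K: "K \<ge> 0"
    and zero: "\<And>j. j < k \<Longrightarrow> z j a = 0" and pos: "z k a > 0"
  shows "\<exists>eps>0. a + eps \<le> b \<and> (\<forall>t\<in>{a<..<a + eps}. z 0 t > 0)"
proof -
  \<comment> \<open>Within distance 1 of \<open>a\<close>, higher powers of t - a are bounded by
    lower ones.\<close>
  define b' where "b' = min b (a + 1)"
  have b': "a < b'" "b' \<le> b" "b' \<le> a + 1" using ab by (auto simp: b'_def)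
  have ac': "abs_cont_on_interval a b' (z j)" if "j \<le> k" for j
    using abs_cont_subinterval[OF ac[OF that]] b' by auto
  have "\<exists>C\<ge>0. \<forall>j\<le>k. \<forall>t\<in>{a..b'}. \<bar>z j t\<bar> \<le> C * (t - a) ^ min k (k - j)"
  proof (rule chain_upper_bound)
    fix t j assume t: "t \<in> {a<..<b'} - N" and j: "j < k"
    then obtain d \<mu> where d: "(z j has_real_derivative d) (at t)" "m \<le> \<mu>" "\<mu> \<le> K" "\<bar>d - \<mu> * z (Suc j) t\<bar> \<le> K * (\<Sum>l\<le>j. \<bar>z l t\<bar>)"
      using der[OF _ j, of t] b' by auto
    have "\<bar>\<mu> * z (Suc j) t\<bar> \<le> K * \<bar>z (Suc j) t\<bar>"
      using d(2,3) m by (auto simp: abs_mult intro!: mult_right_mono)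
    then have "\<bar>d\<bar> \<le> K * (\<Sum>l\<le>Suc j. \<bar>z l t\<bar>)" using d(4) by (simp add: algebra_simps)
    then show "\<exists>d. (z j has_real_derivative d) (at t) \<and> \<bar>d\<bar> \<le> K * (\<Sum>l\<le>Suc j. \<bar>z l t\<bar>)" using d(1) by blast
  qed (use b' ac' N zero K in auto)
  then obtain C where C: "C \<ge> 0" "\<And>j t. j \<le> k \<Longrightarrow> t \<in> {a..b'} \<Longrightarrow> \<bar>z j t\<bar> \<le> C * (t - a) ^ (k - j)"
    by (simp only: min.absorb2[OF diff_le_self]) blast
  have "\<exists>c>0. \<exists>eps>0. a + eps \<le> b' \<and> (\<forall>t\<in>{a..a + eps}. z (k - i) t \<ge> c * (t - a) ^ i)" if "i \<le> k" for i
    using that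
  proof (induction i)
    case 0
    have "continuous_on {a..b'} (z k)" using abs_cont_continuous_on[OF ac'] by simp
    then obtain r where r: "r > 0" "\<And>t. t \<in> {a..b'} \<Longrightarrow> dist t a < r \<Longrightarrow> dist (z k t) (z k a) < z k a / 2"
      unfolding continuous_on_iff using pos b'(1) by (metis atLeastAtMost_iff half_gt_zero less_imp_le order_refl)
    define eps where "eps = min (r / 2) (b' - a)"
    have "eps > 0" "a + eps \<le> b'" using r(1) b' by (auto simp: eps_def)
    moreover have "z k t \<ge> z k a / 2" if t: "t \<in> {a..a + eps}" for t
    proof -
      have "dist (z k t) (z k a) < z k a / 2" using t r(1) by (intro r(2)) (auto simp: eps_def dist_real_def)
      then show ?thesis by (simp add: dist_real_def abs_if split: if_splits)
    qed
    ultimately show ?case using pos by (intro exI[of _ "z k a / 2"]) auto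
  next
    case (Suc i)
    then obtain c eps where c: "c > 0" "eps > 0" "a + eps \<le> b'" "\<And>t. t \<in> {a..a + eps} \<Longrightarrow> z (k - i) t \<ge> c * (t - a) ^ i"
      by auto
    define j where "j = k - Suc i"
    have j: "j < k" "Suc j = k - i" "Suc i \<le> k - l \<longleftrightarrow> l \<le> j" for l using Suc.prems by (auto simp: j_def)
    define Q where "Q = K * (real (k + 1) * C)"
    have Q: "Q \<ge> 0" using K C(1) by (simp add: Q_def)
    \<comment> \<open>So short that the coupling, at most Q * (s - a)^(i + 1), takes away no more
      than half of the main term m * c * (s - a)^i.\<close>
    define eps' where "eps' = min eps (m * c / (2 * (Q + 1)))"
    have e': "eps' > 0" "eps' \<le> eps" using c m Q by (auto simp: eps'_def)
    have Qe: "Q * eps' \<le> m * c / 2"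
    proof -
      have "eps' \<le> m * c / (2 * (Q + 1))" by (simp add: eps'_def)
      then have "eps' * (2 * (Q + 1)) \<le> m * c" using Q by (subst (asm) pos_le_divide_eq) auto
      then show ?thesis using e'(1) by (simp add: algebra_simps)
    qed
    have low: "\<exists>d. (z j has_real_derivative d) (at s) \<and> d \<ge> m * c / 2 * (s - a) ^ i" if s: "s \<in> {a<..<a + eps'} - N" for s
    proof -
      have sb: "s \<in> {a<..<b} - N" "s \<in> {a..b'}" using s e' c b' by auto
      then obtain d \<mu> where d: "(z j has_real_derivative d) (at s)" "m \<le> \<mu>" "\<mu> \<le> K" "\<bar>d - \<mu> * z (Suc j) s\<bar> \<le> K * (\<Sum>l\<le>j. \<bar>z l s\<bar>)"
        using der[OF _ j(1), of s] by auto
      have pw: "0 \<le> (s - a) ^ i" using s by simp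
      have zs: "z (Suc j) s \<ge> c * (s - a) ^ i" unfolding j(2) using s e' by (intro c(4)) auto
      have "\<mu> * z (Suc j) s \<ge> m * (c * (s - a) ^ i)"
        using zs d(2) m c(1) pw by (intro mult_mono) auto
      moreover have "K * (\<Sum>l\<le>j. \<bar>z l s\<bar>) \<le> Q * (s - a) ^ Suc i"
      proof -
        have "\<bar>z l s\<bar> \<le> C * (s - a) ^ Suc i" if "l \<le> j" for l
        proof -
          have "\<bar>z l s\<bar> \<le> C * (s - a) ^ (k - l)" using that j(1) sb by (intro C(2)) auto
          also have "\<dots> \<le> C * (s - a) ^ Suc i"
            using that j(3)[of l] C(1) sb b' by (intro mult_left_mono power_decreasing) auto
          finally show ?thesis .
        qed
        then have "(\<Sum>l\<le>j. \<bar>z l s\<bar>) \<le> real (card {..j}) * (C * (s - a) ^ Suc i)"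
          by (intro sum_bounded_above) auto
        also have "\<dots> \<le> real (k + 1) * (C * (s - a) ^ Suc i)"
          using j(1) C(1) s by (intro mult_right_mono) auto
        finally show ?thesis using K unfolding Q_def
          by (metis mult.assoc mult_left_mono)
      qed
      moreover have "Q * (s - a) ^ Suc i \<le> m * c / 2 * (s - a) ^ i"
      proof -
        have "Q * (s - a) \<le> Q * eps'" using s Q by (intro mult_left_mono) auto
        then have "Q * (s - a) * (s - a) ^ i \<le> m * c / 2 * (s - a) ^ i" using Qe pw by (intro mult_right_mono) auto
        then show ?thesis by (simp add: mult.assoc)
      qed
      ultimately have "d \<ge> m * (c * (s - a) ^ i) - m * c / 2 * (s - a) ^ i" using d(4) by linarith
      then show ?thesis using d(1) by (intro exI[of _ d]) (simp add: algebra_simps)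
    qed
    have incr: "z j q - z j p \<ge> B * (q - p)" if pq: "a \<le> p" "p \<le> q" "q \<le> a + eps'" and B: "B \<le> m * c / 2 * (p - a) ^ i" for p q B
    proof -
      have "- z j q - - z j p \<le> (- B) * (q - p)"
      proof (rule abs_cont_increment_le[OF pq(2) _ N])
        have "abs_cont_on_interval p q (z j)"
          using abs_cont_subinterval[OF ac[of j], of p q] j(1) pq e' c b' by auto
        then show "abs_cont_on_interval p q (\<lambda>t. - z j t)"
          by (rule abs_cont_of_bound[of _ _ _ _ _ 1]) (auto simp: norm_minus_commute)
        fix s assume s: "s \<in> {p<..<q} - N"
        then obtain d where d: "(z j has_real_derivative d) (at s)" "d \<ge> m * c / 2 * (s - a) ^ i"
          using low[of s] pq by auto
        have "m * c / 2 * (p - a) ^ i \<le> m * c / 2 * (s - a) ^ i"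
          using s pq m c(1) by (intro mult_left_mono power_mono) auto
        then show "\<exists>d. ((\<lambda>t. - z j t) has_real_derivative d) (at s) \<and> d \<le> - B"
          using d B by (intro exI[of _ "- d"]) (auto intro: derivative_intros)
      qed
      then show ?thesis by simp
    qed
    \<comment> \<open>No power is integrated: \<open>z j\<close> does not decrease on the first half
      of the interval from \<open>a\<close> to \<open>t\<close>, and on the second half it grows at
      least at the rate guaranteed at the midpoint. The price is the factor 2^(i + 1).\<close>
    have "z j t \<ge> m * c / 2 / 2 ^ Suc i * (t - a) ^ Suc i" if t: "t \<in> {a..a + eps'}" for t
    proof -
      define p where "p = a + (t - a) / 2"
      have p: "a \<le> p" "p \<le> t" "p - a = (t - a) / 2" "t - p = (t - a) / 2" using t by (auto simp: p_def field_simps)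
      have "z j p - z j a \<ge> 0 * (p - a)" using p t m c(1) by (intro incr) auto
      moreover have "z j t - z j p \<ge> m * c / 2 * (p - a) ^ i * (t - p)" using p t by (intro incr) auto
      moreover have "m * c / 2 * (p - a) ^ i * (t - p) = m * c / 2 / 2 ^ Suc i * (t - a) ^ Suc i"
        unfolding p(3,4) by (simp add: power_divide)
      ultimately show ?thesis using zero[OF j(1)] by linarith
    qed
    then show ?case using e' c m
      by (intro exI[of _ "m * c / 2 / 2 ^ Suc i"] conjI exI[of _ eps']) (auto simp: j_def)
  qed
  from this[of k] obtain c eps where "c > 0" "eps > 0" "a + eps \<le> b'" and z: "\<And>t. t \<in> {a..a + eps} \<Longrightarrow> z 0 t \<ge> c * (t - a) ^ k"
    by auto
  moreover have "z 0 t > 0" if t: "t \<in> {a<..<a + eps}" for t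
  proof -
    have "0 < c * (t - a) ^ k" using t \<open>c > 0\<close> by simp
    also have "\<dots> \<le> z 0 t" using t by (intro z) auto
    finally show ?thesis .
  qed
  ultimately show ?thesis using b'(2) by (intro exI[of _ eps]) auto
qed

section \<open>Solutions of the piecewise affine system\<close>

text \<open>Promotes an almost everywhere derivative to a time at which the prescribed velocity is
  continuous, by the mean value inequality around \<open>G t\<close> on small intervals.\<close>

lemma abs_cont_derivative_everywhere:
  fixes x :: "real \<Rightarrow> 'a::euclidean_space"
  assumes t: "t \<in> {p<..<q}" and ac: "abs_cont_on_interval p q x" and N: "negligible N"
    and der: "\<And>s. s \<in> {p<..<q} - N \<Longrightarrow> (x has_vector_derivative G s) (at s)" and G: "isCont G t"
  shows "(x has_vector_derivative G t) (at t)"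
  unfolding has_vector_derivative_def has_derivative_at_alt
proof (intro conjI allI impI bounded_linear_scaleR_left)
  fix e :: real assume e: "e > 0"
  obtain r where r: "r > 0" "\<And>s. dist s t < r \<Longrightarrow> dist (G s) (G t) < e"
    using G e unfolding continuous_at_eps_delta by (auto simp: dist_commute)
  define d where "d = min r (min (t - p) (q - t))"
  have d: "d > 0" using r t by (simp add: d_def)
  have key: "norm (x v - x u - (v - u) *\<^sub>R G t) \<le> e * (v - u)" if uv: "u \<le> v" "\<bar>u - t\<bar> < d" "\<bar>v - t\<bar> < d" for u v
  proof (rule abs_cont_increment[OF uv(1) _ N])
    show "abs_cont_on_interval u v x" using uv by (intro abs_cont_subinterval[OF ac]) (auto simp: d_def)
    fix s assume s: "s \<in> {u<..<v} - N"
    then have "(x has_vector_derivative G s) (at s)" using uv by (intro der) (auto simp: d_def)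
    moreover have "dist (G s) (G t) < e" using s uv by (intro r) (auto simp: d_def dist_real_def)
    ultimately show "\<exists>v. (x has_vector_derivative v) (at s) \<and> norm (v - G t) \<le> e"
      by (intro exI[of _ "G s"]) (auto simp: dist_norm)
  qed
  show "\<exists>d>0. \<forall>s. norm (s - t) < d \<longrightarrow> norm (x s - x t - (s - t) *\<^sub>R G t) \<le> e * norm (s - t)"
  proof (intro exI[of _ d] conjI allI impI)
    fix s assume s: "norm (s - t) < d"
    show "norm (x s - x t - (s - t) *\<^sub>R G t) \<le> e * norm (s - t)"
    proof (cases "t \<le> s")
      case True
      then show ?thesis using key[of t s] s d by simp
    next
      case False
      have "x s - x t - (s - t) *\<^sub>R G t = - (x t - x s - (t - s) *\<^sub>R G t)" by (simp add: algebra_simps)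
      then have "norm (x s - x t - (s - t) *\<^sub>R G t) = norm (x t - x s - (t - s) *\<^sub>R G t)"
        by (simp only: norm_minus_cancel)
      then show ?thesis using key[of s t] s d False by simp
    qed
  qed (rule d)
qed

lemma locally_lipschitz_glue:
  assumes f: "\<And>T. \<exists>L. L-lipschitz_on {- T..b} f" and g: "\<And>T. \<exists>L. L-lipschitz_on {b..T} g" and "f b = g b"
  shows "locally_lipschitz (\<lambda>t. if t \<le> b then f t else g t)"
  unfolding locally_lipschitz_def
proof (intro allI)
  fix p q :: real
  obtain L M where "L-lipschitz_on {- (- p)..b} f" "M-lipschitz_on {b..q} g" using f g by blast
  then have "(max L M)-lipschitz_on {p..q} (\<lambda>t. if t \<le> b then f t else g t)"
    using lipschitz_on_concat_max[where f = f and g = g, OF _ _ assms(3)] by simp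
  then show "\<exists>L. L-lipschitz_on {p..q} (\<lambda>t. if t \<le> b then f t else g t)" by blast
qed

lemma locally_lipschitz_imp_loc_abs_cont: "locally_lipschitz x \<Longrightarrow> loc_abs_cont x"
  unfolding locally_lipschitz_def loc_abs_cont_def using abs_cont_lipschitz by blast

section \<open>The piecewise affine right-hand side and global existence of solutions\<close>

lemma pwa_F_subset: "pwa_F A e c f x \<subseteq> {A 1 *v x + e 1, A 2 *v x + e 2}"
  by (auto simp: pwa_F_def)

lemma pwa_G_compact_nonempty: "pwa_F A e c f x \<noteq> {}" "compact (pwa_F A e c f x)"
  by (auto simp: pwa_F_def)

lemma pwa_F_growth:
  obtains a where "a > 0" "\<And>x u. u \<in> pwa_F A e c f x \<Longrightarrow> norm u \<le> a * (1 + norm x)"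
proof -
  have "\<exists>K. \<forall>x. norm (A i *v x) \<le> norm x * K" for i :: nat
    using bounded_linear.bounded[OF matrix_vector_mul_bounded_linear[of "A i"]] by blast
  then obtain K where K: "\<And>i x. norm (A i *v x) \<le> norm x * K i" by metis
  define a where "a = 1 + \<bar>K 1\<bar> + \<bar>K 2\<bar> + norm (e 1) + norm (e 2)"
  have "norm (A i *v x + e i) \<le> a * (1 + norm x)" if "i = 1 \<or> i = 2" for i x
  proof -
    have "K i \<le> a \<and> norm (e i) \<le> a"
      using that norm_ge_zero[of "e 1"] norm_ge_zero[of "e 2"] unfolding a_def by (elim disjE; hypsubst) linarith+
    have "norm (A i *v x + e i) \<le> norm x * K i + norm (e i)"
      using norm_triangle_ineq[of "A i *v x" "e i"] K[of i x] by linarith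
    also have "\<dots> \<le> norm x * a + a"
      using \<open>K i \<le> a \<and> norm (e i) \<le> a\<close> by (intro add_mono mult_left_mono) auto
    finally show ?thesis by (simp add: algebra_simps)
  qed
  then have "norm u \<le> a * (1 + norm x)" if "u \<in> pwa_F A e c f x" for x u
    using subsetD[OF pwa_F_subset that] by auto
  moreover have "a > 0" by (auto simp: a_def intro!: add_pos_nonneg)
  ultimately show ?thesis using that by blast
qed

text \<open>Near \<open>x\<close> only modes active at \<open>x\<close> are active, and each open
  half-space condition persists by continuity. Upper semicontinuity is put in this form because
  \<open>differential_inclusion_exists\<close> tests one direction at a time.\<close>

lemma pwa_F_usc:
  fixes A :: "nat \<Rightarrow> real^'n^'n"
  assumes w: "\<And>u. u \<in> pwa_F A e c f x \<Longrightarrow> w \<bullet> u < \<sigma>"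
  shows "\<exists>\<rho>>0. \<forall>z\<in>ball x \<rho>. \<forall>u\<in>pwa_F A e c f z. w \<bullet> u < \<sigma>"
proof -
  define \<phi> where "\<phi> z = c \<bullet> z + f" for z
  define V where "V i = {z. w \<bullet> (A i *v z + e i) < \<sigma>}" for i
  have V: "open (V i)" for i
    unfolding V_def by (intro open_Collect_less continuous_intros matrix_vector_mult_linear_continuous_on)
  have o: "open {z. \<phi> z < 0}" "open {z. \<phi> z > 0}" unfolding \<phi>_def by (intro open_Collect_less continuous_intros)+
  have F: "pwa_F A e c f z = (if \<phi> z < 0 then {A 1 *v z + e 1} else if \<phi> z = 0 then {A 1 *v z + e 1, A 2 *v z + e 2} else {A 2 *v z + e 2})" for z
    by (simp add: pwa_F_def \<phi>_def)
  have "\<exists>U. open U \<and> x \<in> U \<and> (\<forall>z\<in>U. \<forall>u\<in>pwa_F A e c f z. w \<bullet> u < \<sigma>)"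
  proof -
    consider "\<phi> x < 0" | "\<phi> x = 0" | "\<phi> x > 0" by linarith
    then show ?thesis
    proof cases
      case 1
      then show ?thesis using V[of 1] o w by (intro exI[of _ "{z. \<phi> z < 0} \<inter> V 1"]) (auto simp: F V_def)
    next
      case 2
      then show ?thesis using V[of 1] V[of 2] w by (intro exI[of _ "V 1 \<inter> V 2"]) (auto simp: F V_def)
    next
      case 3
      then show ?thesis using V[of 2] o w by (intro exI[of _ "{z. \<phi> z > 0} \<inter> V 2"]) (auto simp: F V_def)
    qed
  qed
  then obtain U where U: "open U" "x \<in> U" "\<forall>z\<in>U. \<forall>u\<in>pwa_F A e c f z. w \<bullet> u < \<sigma>" by blast
  then obtain \<rho> where "\<rho> > 0" "ball x \<rho> \<subseteq> U" by (meson openE)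
  then show ?thesis using U(3) by blast
qed

lemma pwa_forward_exists:
  fixes A :: "nat \<Rightarrow> real^'n^'n"
  shows "\<exists>x. x 0 = \<xi> \<and> (\<forall>T. \<exists>L. L-lipschitz_on {0..T} x) \<and>
    (\<forall>t v. t \<ge> 0 \<longrightarrow> (x has_vector_derivative v) (at t) \<longrightarrow> v \<in> pwa_G A e c f (x t))"
proof -
  obtain a where a: "a > 0" "\<And>x u. u \<in> pwa_F A e c f x \<Longrightarrow> norm u \<le> a * (1 + norm x)"
    by (rule pwa_F_growth[of A e c f]) (rule that)
  obtain x where "x 0 = \<xi>" "\<And>T. \<exists>L. L-lipschitz_on {0..T} x"
    "\<And>t v. t \<ge> 0 \<Longrightarrow> (x has_vector_derivative v) (at t) \<Longrightarrow> v \<in> convex hull pwa_F A e c f (x t)"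
    by (rule differential_inclusion_exists[of "pwa_F A e c f" a \<xi>, OF pwa_G_compact_nonempty a pwa_F_usc]) (assumption | rule that)+
  then show ?thesis unfolding pwa_G_def by blast
qed

lemma pwa_G_uminus: "pwa_G (\<lambda>i. - A i) (\<lambda>i. - e i) c f x = uminus ` pwa_G A e c f x"
proof -
  have mv: "(- B) *v x + - d = - (B *v x + d)" for B d :: "_"
    by (simp add: vec_eq_iff matrix_vector_mult_def sum_negf)
  have "pwa_F (\<lambda>i. - A i) (\<lambda>i. - e i) c f x = uminus ` pwa_F A e c f x"
    unfolding pwa_F_def mv by simp
  then show ?thesis
    unfolding pwa_G_def using convex_hull_linear_image[of uminus "pwa_F A e c f x"] by (simp add: linear_uminus)
qed

text \<open>The past is a forward solution of the negated system run backwards. The inclusion is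
  asserted at every point of differentiability except the seam 0, so that gluing involves no null
  sets.\<close>

lemma pwa_pointwise_exists:
  fixes A :: "nat \<Rightarrow> real^'n^'n"
  shows "\<exists>x. x 0 = \<xi> \<and> locally_lipschitz x \<and>
    (\<forall>t v. t \<noteq> 0 \<longrightarrow> (x has_vector_derivative v) (at t) \<longrightarrow> v \<in> pwa_G A e c f (x t))"
proof -
  obtain xp where xp: "xp 0 = \<xi>" "\<And>T. \<exists>L. L-lipschitz_on {0..T} xp"
    "\<And>t v. t \<ge> 0 \<Longrightarrow> (xp has_vector_derivative v) (at t) \<Longrightarrow> v \<in> pwa_G A e c f (xp t)"
    using pwa_forward_exists[of \<xi> A e c f] by blast
  obtain xm where xm: "xm 0 = \<xi>" "\<And>T. \<exists>L. L-lipschitz_on {0..T} xm"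
    "\<And>t v. t \<ge> 0 \<Longrightarrow> (xm has_vector_derivative v) (at t) \<Longrightarrow> v \<in> pwa_G (\<lambda>i. - A i) (\<lambda>i. - e i) c f (xm t)"
    using pwa_forward_exists[of \<xi> "\<lambda>i. - A i" "\<lambda>i. - e i" c f] by blast
  define x where "x t = (if t \<le> 0 then xm (- t) else xp t)" for t
  have "locally_lipschitz x"
    unfolding x_def
  proof (rule locally_lipschitz_glue)
    fix T :: real
    obtain L where L: "L-lipschitz_on {0..T} xm" using xm(2) by blast
    have "L-lipschitz_on {- T..0} (\<lambda>t. xm (- t))"
    proof (rule lipschitz_onI)
      fix s t assume "s \<in> {- T..0}" "t \<in> {- T..0}"
      then have "dist (xm (- s)) (xm (- t)) \<le> L * dist (- s) (- t)" by (intro lipschitz_onD[OF L]) auto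
      then show "dist (xm (- s)) (xm (- t)) \<le> L * dist s t" by (simp add: dist_minus)
    qed (rule lipschitz_on_nonneg[OF L])
    then show "\<exists>L. L-lipschitz_on {- T..0} (\<lambda>t. xm (- t))" by blast
  qed (use xp xm in auto)
  moreover have "v \<in> pwa_G A e c f (x t)" if "t \<noteq> 0" and d: "(x has_vector_derivative v) (at t)" for t v
  proof (cases "t > 0")
    case True
    have "(xp has_vector_derivative v) (at t)"
      by (rule has_vector_derivative_transform_within_open[OF d, of "{0<..}"]) (use True in \<open>auto simp: x_def\<close>)
    then show ?thesis using xp(3)[of t v] True by (simp add: x_def)
  next
    case False
    then have t: "t < 0" using that by simp
    have "((\<lambda>s. x (- s)) has_vector_derivative - v) (at (- t))"
      using vector_diff_chain_at[of uminus "-1" "- t" x v] d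
      by (simp add: o_def has_vector_derivative_minus has_vector_derivative_id)
    then have "(xm has_vector_derivative - v) (at (- t))"
      by (rule has_vector_derivative_transform_within_open[of _ _ _ "{0<..}", simplified]) (use t in \<open>auto simp: x_def\<close>)
    then have "- v \<in> uminus ` pwa_G A e c f (xm (- t))"
      using xm(3)[of "- t" "- v"] t by (simp add: pwa_G_uminus)
    then show ?thesis using t by (auto simp: x_def)
  qed
  moreover have "x 0 = \<xi>" using xm by (simp add: x_def)
  ultimately show ?thesis by blast
qed

lemma linear_ode_exists:
  fixes B :: "real^'n^'n"
  shows "\<exists>x. x 0 = \<xi> \<and> locally_lipschitz x \<and> (\<forall>t. (x has_vector_derivative B *v x t + d) (at t))"
proof -
  \<comment> \<open>an affine system is a piecewise affine system with equal modes\<close>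
  obtain x where x: "x 0 = \<xi>" "locally_lipschitz x"
    "\<And>t v. t \<noteq> 0 \<Longrightarrow> (x has_vector_derivative v) (at t) \<Longrightarrow> v \<in> pwa_G (\<lambda>i. B) (\<lambda>i. d) 0 0 (x t)"
    using pwa_pointwise_exists[of \<xi> "\<lambda>i. B" "\<lambda>i. d" 0 0] by blast
  obtain N where N: "negligible N" "\<And>t. t \<notin> N \<Longrightarrow> \<exists>v. (x has_vector_derivative v) (at t)"
    using locally_lipschitz_differentiable_ae[OF x(2)] by blast
  have G: "pwa_G (\<lambda>i. B) (\<lambda>i. d) 0 0 z = {B *v z + d}" for z by (simp add: pwa_G_def pwa_F_def)
  have ac: "abs_cont_on_interval p q x" if "p \<le> q" for p q
    using locally_lipschitz_imp_loc_abs_cont[OF x(2)] that by (simp add: loc_abs_cont_def)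
  have "(x has_vector_derivative B *v x t + d) (at t)" for t
  proof (rule abs_cont_derivative_everywhere[where G = "\<lambda>t. B *v x t + d" and p = "t - 1" and q = "t + 1" and N = "insert 0 N"])
    fix s assume "s \<in> {t - 1<..<t + 1} - insert 0 N"
    then show "(x has_vector_derivative B *v x s + d) (at s)" using N(2)[of s] x(3)[of s] by (auto simp: G)
  next
    have "continuous_on {t - 1<..<t + 1} x"
      by (rule continuous_on_subset[OF abs_cont_continuous_on[OF ac[of "t - 1" "t + 1"]]]) auto
    then have "isCont x t" by (simp add: continuous_on_eq_continuous_at)
    then show "isCont (\<lambda>t. B *v x t + d) t"
      by (intro isCont_add[OF isCont_o2[OF _ linear_continuous_at[OF matrix_vector_mul_bounded_linear]]] continuous_const)
  qed (use ac N in auto)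
  then show ?thesis using x by blast
qed

text \<open>The finite set \<open>S\<close> collects the seams of a glued curve. Local Lipschitz
  continuity supplies the derivative almost everywhere, so only its value has to be checked.\<close>

lemma filippov_solutionI:
  fixes A :: "nat \<Rightarrow> real^'n^'n"
  assumes "x 0 = \<xi>" "locally_lipschitz x" "finite S"
    "\<And>t v. t \<notin> S \<Longrightarrow> (x has_vector_derivative v) (at t) \<Longrightarrow> v \<in> pwa_G A e c f (x t)"
  shows "filippov_solution A e c f \<xi> x"
proof -
  obtain N where N: "negligible N" "\<And>t. t \<notin> N \<Longrightarrow> \<exists>v. (x has_vector_derivative v) (at t)"
    using locally_lipschitz_differentiable_ae[OF assms(2)] by blast
  have "AE t in lebesgue. \<exists>v\<in>pwa_G A e c f (x t). (x has_vector_derivative v) (at t)"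
  proof (rule AE_I')
    show "N \<union> S \<in> null_sets lebesgue"
      using N(1) assms(3) by (auto simp: negligible_iff_null_sets[symmetric] intro: negligible_finite)
    show "{t \<in> space lebesgue. \<not> (\<exists>v\<in>pwa_G A e c f (x t). (x has_vector_derivative v) (at t))} \<subseteq> N \<union> S"
      using N(2) assms(4) by blast
  qed
  then show ?thesis using assms locally_lipschitz_imp_loc_abs_cont
    unfolding filippov_solution_def inclusion_solution_def by blast
qed

text \<open>The solutions in \<open>right_unique\<close> live on the whole line, so a piece of a
  mode trajectory is completed: some solution before 0, the mode up to \<open>eps\<close>, and then
  a shifted solution starting from \<open>x eps\<close>.\<close>

lemma mode_extension:
  fixes A :: "nat \<Rightarrow> real^'n^'n"
  assumes i: "i \<in> {1, 2}" and x: "x 0 = \<xi>" "locally_lipschitz x" "\<And>t. (x has_vector_derivative A i *v x t + e i) (at t)"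
    and eps: "eps > 0" and sgn: "\<And>t. t \<in> {0<..<eps} \<Longrightarrow> (-1)^(i-1) * (c \<bullet> x t + f) \<le> 0"
  shows "\<exists>X. filippov_solution A e c f \<xi> X \<and> (\<forall>t\<in>{0..<eps}. X t = x t)"
proof -
  obtain xp where xp: "xp 0 = x eps" "locally_lipschitz xp"
    "\<And>t v. t \<noteq> 0 \<Longrightarrow> (xp has_vector_derivative v) (at t) \<Longrightarrow> v \<in> pwa_G A e c f (xp t)"
    using pwa_pointwise_exists[of "x eps" A e c f] by blast
  obtain xm where xm: "xm 0 = \<xi>" "locally_lipschitz xm"
    "\<And>t v. t \<noteq> 0 \<Longrightarrow> (xm has_vector_derivative v) (at t) \<Longrightarrow> v \<in> pwa_G A e c f (xm t)"
    using pwa_pointwise_exists[of \<xi> A e c f] by blast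
  define y where "y t = (if t \<le> 0 then xm t else x t)" for t
  define X where "X t = (if t \<le> eps then y t else xp (t - eps))" for t
  have ly: "locally_lipschitz y"
    unfolding y_def using xm x by (intro locally_lipschitz_glue) (auto simp: locally_lipschitz_def)
  have "locally_lipschitz X"
    unfolding X_def
  proof (rule locally_lipschitz_glue)
    fix T
    obtain L where L: "L-lipschitz_on {0..T - eps} xp" using xp(2) by (auto simp: locally_lipschitz_def)
    have "L-lipschitz_on {eps..T} (\<lambda>t. xp (t - eps))"
    proof (rule lipschitz_onI)
      fix s t assume "s \<in> {eps..T}" "t \<in> {eps..T}"
      then have "dist (xp (s - eps)) (xp (t - eps)) \<le> L * dist (s - eps) (t - eps)" by (intro lipschitz_onD[OF L]) auto
      then show "dist (xp (s - eps)) (xp (t - eps)) \<le> L * dist s t" by (simp add: dist_norm)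
    qed (rule lipschitz_on_nonneg[OF L])
    then show "\<exists>L. L-lipschitz_on {eps..T} (\<lambda>t. xp (t - eps))" by blast
  qed (use ly xp eps in \<open>auto simp: locally_lipschitz_def y_def\<close>)
  moreover have "v \<in> pwa_G A e c f (X t)" if t: "t \<notin> {0, eps}" and d: "(X has_vector_derivative v) (at t)" for t v
  proof -
    consider "t < 0" | "0 < t" "t < eps" | "t > eps" using t by fastforce
    then show ?thesis
    proof cases
      case 1
      have "(xm has_vector_derivative v) (at t)"
        by (rule has_vector_derivative_transform_within_open[OF d, of "{..<0}"]) (use 1 eps in \<open>auto simp: X_def y_def\<close>)
      then show ?thesis using xm(3)[of t v] 1 eps by (simp add: X_def y_def)
    next
      case 2
      have "(x has_vector_derivative v) (at t)"
        by (rule has_vector_derivative_transform_within_open[OF d, of "{0<..<eps}"]) (use 2 in \<open>auto simp: X_def y_def\<close>)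
      then have "v = A i *v x t + e i" using x(3) vector_derivative_unique_at by blast
      moreover have "A i *v x t + e i \<in> pwa_F A e c f (x t)"
        using i sgn[of t] 2 by (auto simp: pwa_F_def)
      ultimately show ?thesis using 2 hull_inc by (simp add: X_def y_def pwa_G_def hull_inc)
    next
      case 3
      have "((\<lambda>s. s + eps) has_vector_derivative 1) (at (t - eps))"
        by (auto intro!: derivative_eq_intros)
      from vector_diff_chain_at[OF this, of X v] d
      have "((\<lambda>s. X (s + eps)) has_vector_derivative 1 *\<^sub>R v) (at (t - eps))"
        by (simp add: o_def)
      then have "((\<lambda>s. X (s + eps)) has_vector_derivative v) (at (t - eps))" by simp
      then have "(xp has_vector_derivative v) (at (t - eps))"
        by (rule has_vector_derivative_transform_within_open[of _ _ _ "{0<..}"]) (use 3 in \<open>auto simp: X_def\<close>)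
      then show ?thesis using xp(3)[of "t - eps" v] 3 eps by (simp add: X_def)
    qed
  qed
  moreover have "X 0 = \<xi>" using xm eps by (simp add: X_def y_def)
  ultimately have "filippov_solution A e c f \<xi> X" by (intro filippov_solutionI[of X \<xi> "{0, eps}"]) auto
  moreover have "\<forall>t\<in>{0..<eps}. X t = x t" using x(1) xm(1) by (auto simp: X_def y_def)
  ultimately show ?thesis by blast
qed

section \<open>Outputs of a mode\<close>

text \<open>\<open>close\<close> bounds the first function beyond the list by the list itself, so
  the functions with index up to \<open>h\<close> satisfy a closed linear differential
  inequality.\<close>

lemma chain_zero:
  fixes z :: "nat \<Rightarrow> real \<Rightarrow> real"
  assumes ab: "a < b" and ac: "\<And>j. j \<le> h \<Longrightarrow> abs_cont_on_interval a b (z j)" and N: "negligible N"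
    and der: "\<And>t j. t \<in> {a<..<b} - N \<Longrightarrow> j \<le> h \<Longrightarrow>
      \<exists>d \<mu>. (z j has_real_derivative d) (at t) \<and> 0 \<le> \<mu> \<and> \<mu> \<le> K \<and> \<bar>d - \<mu> * z (Suc j) t\<bar> \<le> K * (\<Sum>l\<le>j. \<bar>z l t\<bar>)"
    and K: "K \<ge> 0"
    and close: "\<And>t. t \<in> {a..b} \<Longrightarrow> \<bar>z (Suc h) t\<bar> \<le> P * (\<Sum>l\<le>h. \<bar>z l t\<bar>)"
    and zero: "\<And>j. j \<le> h \<Longrightarrow> z j a = 0"
  shows "\<exists>eps>0. a + eps \<le> b \<and> (\<forall>t\<in>{a..a + eps}. \<forall>j\<le>Suc h. z j t = 0)"
proof -
  \<comment> \<open>The factor max 1 P treats both kinds of successor at once: for j < h the next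
    function is in the list, for j = h it is bounded by \<open>close\<close>.\<close>
  define K' where "K' = K * (1 + max 1 P)"
  have K': "K' \<ge> 0" using K by (simp add: K'_def)
  define eps where "eps = min (b - a) (1 / (2 * (K' * real (h + 1) + 1)))"
  have pos: "K' * real (h + 1) + 1 > 0" using K' by (simp add: add_nonneg_pos)
  have e: "eps > 0" "a + eps \<le> b" using ab pos by (auto simp: eps_def)
  have "eps \<le> 1 / (2 * (K' * real (h + 1) + 1))" by (simp add: eps_def)
  then have "eps * (2 * (K' * real (h + 1) + 1)) \<le> 1" using pos by (subst (asm) pos_le_divide_eq) auto
  moreover have "K' * real (h + 1) * eps \<ge> 0" using K' e by simp
  ultimately have small: "K' * real (h + 1) * (a + eps - a) < 1" using e by (simp add: algebra_simps)
  have z0: "z j t = 0" if "t \<in> {a..a + eps}" "j \<le> h" for t j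
  proof (rule abs_cont_zero_unique[of a "a + eps" h z N K'])
    show "abs_cont_on_interval a (a + eps) (z j)" if "j \<le> h" for j
      using abs_cont_subinterval[OF ac[OF that]] e by auto
    fix t j assume t: "t \<in> {a<..<a + eps} - N" and j: "j \<le> h"
    obtain d \<mu> where d: "(z j has_real_derivative d) (at t)" "0 \<le> \<mu>" "\<mu> \<le> K" "\<bar>d - \<mu> * z (Suc j) t\<bar> \<le> K * (\<Sum>l\<le>j. \<bar>z l t\<bar>)"
      using der[OF _ j, of t] t e by auto
    let ?S = "\<Sum>l\<le>h. \<bar>z l t\<bar>"
    have S: "0 \<le> ?S" by (intro sum_nonneg) auto
    have "(\<Sum>l\<le>j. \<bar>z l t\<bar>) \<le> ?S" using j by (intro sum_mono2) auto
    then have 1: "K * (\<Sum>l\<le>j. \<bar>z l t\<bar>) \<le> K * ?S" using K by (rule mult_left_mono)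
    have "\<bar>z (Suc j) t\<bar> \<le> max 1 P * ?S"
    proof (cases "j = h")
      case True
      have "\<bar>z (Suc h) t\<bar> \<le> P * ?S" using t e by (intro close) auto
      also have "\<dots> \<le> max 1 P * ?S" using S by (intro mult_right_mono) auto
      finally show ?thesis using True by simp
    next
      case False
      then have "\<bar>z (Suc j) t\<bar> \<le> ?S" using j by (intro member_le_sum) auto
      also have "\<dots> \<le> max 1 P * ?S" using S mult_right_mono[of 1 "max 1 P" ?S] by simp
      finally show ?thesis .
    qed
    then have "\<mu> * \<bar>z (Suc j) t\<bar> \<le> K * (max 1 P * ?S)" using d K by (intro mult_mono) auto
    then have "\<bar>\<mu> * z (Suc j) t\<bar> \<le> K * (max 1 P * ?S)" using d(2) by (simp add: abs_mult)
    then have "\<bar>d\<bar> \<le> K' * ?S" using d(4) 1 by (simp add: K'_def algebra_simps)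
    then show "\<exists>v. (z j has_vector_derivative v) (at t) \<and> norm v \<le> K' * (\<Sum>l\<le>h. norm (z l t))"
      using d(1) by (intro exI[of _ d]) (simp add: has_real_derivative_iff_has_vector_derivative)
  qed (use that N zero K' small e in auto)
  moreover have "z (Suc h) t = 0" if "t \<in> {a..a + eps}" for t
    using close[of t] z0 that e by auto
  ultimately show ?thesis using e by (intro exI[of _ eps]) (auto simp: le_Suc_eq)
qed

text \<open>Lexicographic sign of an infinite sequence, with s = 1 for positive and s = -1 for
  negative. No cutoff is built in, so modes with different observability indices are treated
  alike.\<close>

definition first_sign :: "real \<Rightarrow> (nat \<Rightarrow> real) \<Rightarrow> bool" where
  "first_sign s y \<longleftrightarrow> (\<exists>k. (\<forall>j<k. y j = 0) \<and> s * y k > 0)"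

lemma first_nonzero_cases:
  fixes y :: "nat \<Rightarrow> real"
  obtains (neg) k where "k \<le> m" "\<And>j. j < k \<Longrightarrow> y j = 0" "y k < 0"
    | (pos) k where "k \<le> m" "\<And>j. j < k \<Longrightarrow> y j = 0" "y k > 0"
    | (zero) "\<And>j. j \<le> m \<Longrightarrow> y j = 0"
proof (cases "\<forall>j\<le>m. y j = 0")
  case False
  then obtain j where j: "j \<le> m" "y j \<noteq> 0" by blast
  define k where "k = (LEAST j. y j \<noteq> 0)"
  have "y k \<noteq> 0" "k \<le> j" "\<And>j. j < k \<Longrightarrow> y j = 0"
    unfolding k_def using LeastI[of "\<lambda>j. y j \<noteq> 0", OF j(2)] Least_le[of "\<lambda>j. y j \<noteq> 0", OF j(2)] not_less_Least
    by (blast, blast, blast)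
  then show ?thesis using neg pos j(1) by (metis linorder_neqE_linordered_idom order_trans)
qed (use zero in blast)

text \<open>The values at \<open>a\<close> alone decide the case. The closure bound is demanded only
  if they all vanish: row h + 1 depends on the earlier rows, but the offsets need not satisfy the
  same relation unless the outputs have a common zero.\<close>

lemma chain_trichotomy:
  fixes z :: "nat \<Rightarrow> real \<Rightarrow> real"
  assumes ab: "a < b" and ac: "\<And>j. j \<le> Suc h \<Longrightarrow> abs_cont_on_interval a b (z j)" and N: "negligible N"
    and der: "\<And>t j. t \<in> {a<..<b} - N \<Longrightarrow> j \<le> h \<Longrightarrow>
      \<exists>d \<mu>. (z j has_real_derivative d) (at t) \<and> m \<le> \<mu> \<and> \<mu> \<le> K \<and> \<bar>d - \<mu> * z (Suc j) t\<bar> \<le> K * (\<Sum>l\<le>j. \<bar>z l t\<bar>)"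
    and m: "m > 0" and K: "K \<ge> 0"
    and close: "(\<And>j. j \<le> Suc h \<Longrightarrow> z j a = 0) \<Longrightarrow> \<exists>P. \<forall>t. \<bar>z (Suc h) t\<bar> \<le> P * (\<Sum>l\<le>h. \<bar>z l t\<bar>)"
  obtains (pos) eps where "eps > 0" "a + eps \<le> b" "\<And>t. t \<in> {a<..<a + eps} \<Longrightarrow> z 0 t > 0" "first_sign 1 (\<lambda>j. z j a)"
  | (neg) eps where "eps > 0" "a + eps \<le> b" "\<And>t. t \<in> {a<..<a + eps} \<Longrightarrow> z 0 t < 0" "\<not> first_sign 1 (\<lambda>j. z j a)"
  | (zero) eps where "eps > 0" "a + eps \<le> b" "\<And>t j. t \<in> {a..a + eps} \<Longrightarrow> j \<le> Suc h \<Longrightarrow> z j t = 0"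
proof -
  have gen: "\<exists>eps>0. a + eps \<le> b \<and> (\<forall>t\<in>{a<..<a + eps}. s * z 0 t > 0)" if s: "s = 1 \<or> s = - 1" "s * z k a > 0" and k: "k \<le> Suc h" "\<And>j. j < k \<Longrightarrow> z j a = 0" for s k
  proof (rule chain_positive[where z = "\<lambda>j t. s * z j t", OF ab _ N _ m K _ s(2)])
    show "abs_cont_on_interval a b (\<lambda>t. s * z j t)" if "j \<le> k" for j
      using abs_cont_inner[of a b "z j" s 0] ac[of j] that k(1) by simp
    fix t j assume t: "t \<in> {a<..<b} - N" and jk: "j < k"
    then obtain d \<mu> where d: "(z j has_real_derivative d) (at t)" "m \<le> \<mu>" "\<mu> \<le> K" "\<bar>d - \<mu> * z (Suc j) t\<bar> \<le> K * (\<Sum>l\<le>j. \<bar>z l t\<bar>)"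
      using der[of t j] k(1) by auto
    have "\<bar>s * d - \<mu> * (s * z (Suc j) t)\<bar> = \<bar>s\<bar> * \<bar>d - \<mu> * z (Suc j) t\<bar>"
      unfolding abs_mult[symmetric] by (simp add: algebra_simps)
    then have "\<bar>s * d - \<mu> * (s * z (Suc j) t)\<bar> \<le> K * (\<Sum>l\<le>j. \<bar>s * z l t\<bar>)"
      using d(4) s(1) by (auto simp: abs_mult)
    moreover have "((\<lambda>t. s * z j t) has_real_derivative s * d) (at t)" using d(1) by (rule DERIV_cmult)
    ultimately show "\<exists>d \<mu>. ((\<lambda>t. s * z j t) has_real_derivative d) (at t) \<and> m \<le> \<mu> \<and> \<mu> \<le> K \<and>
      \<bar>d - \<mu> * (s * z (Suc j) t)\<bar> \<le> K * (\<Sum>l\<le>j. \<bar>s * z l t\<bar>)"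
      using d(2,3) by blast
  qed (use k(2) in auto)
  show ?thesis
  proof (cases rule: first_nonzero_cases[of "Suc h" "\<lambda>j. z j a"])
    case (pos k)
    then have "first_sign 1 (\<lambda>j. z j a)" unfolding first_sign_def by (intro exI[of _ k]) auto
    then show ?thesis using gen[of 1 k] pos that(1) by auto
  next
    case (neg k)
    have "\<not> first_sign 1 (\<lambda>j. z j a)"
    proof
      assume "first_sign 1 (\<lambda>j. z j a)"
      then obtain l where "\<forall>j<l. z j a = 0" "z l a > 0" unfolding first_sign_def by auto
      then show False using neg by (cases l k rule: linorder_cases) auto
    qed
    then show ?thesis using gen[of "- 1" k] neg that(2) by auto
  next
    case zero
    obtain P where P: "\<And>t. \<bar>z (Suc h) t\<bar> \<le> P * (\<Sum>l\<le>h. \<bar>z l t\<bar>)" using close[OF zero] by auto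
    have "\<exists>eps>0. a + eps \<le> b \<and> (\<forall>t\<in>{a..a + eps}. \<forall>j\<le>Suc h. z j t = 0)"
    proof (rule chain_zero[OF ab _ N _ K P])
      fix t j assume "t \<in> {a<..<b} - N" "j \<le> h"
      then obtain d \<mu> where "(z j has_real_derivative d) (at t)" "m \<le> \<mu>" "\<mu> \<le> K" "\<bar>d - \<mu> * z (Suc j) t\<bar> \<le> K * (\<Sum>l\<le>j. \<bar>z l t\<bar>)"
        using der by blast
      then show "\<exists>d \<mu>. (z j has_real_derivative d) (at t) \<and> 0 \<le> \<mu> \<and> \<mu> \<le> K \<and> \<bar>d - \<mu> * z (Suc j) t\<bar> \<le> K * (\<Sum>l\<le>j. \<bar>z l t\<bar>)"
        using m by (intro exI[of _ d] exI[of _ \<mu>]) auto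
    qed (use ac zero in auto)
    then show ?thesis using that(3) by blast
  qed
qed

text \<open>The output \<open>y\<^sub>i\<^sup>j\<close> of the overview for a mode with matrix
  \<open>B\<close> and offset \<open>d\<close>, an iterated Lie derivative of c \<bullet> x +
  f.\<close>

definition affine_output :: "real^'n \<Rightarrow> real \<Rightarrow> real^'n^'n \<Rightarrow> real^'n \<Rightarrow> nat \<Rightarrow> real^'n \<Rightarrow> real" where
  "affine_output c f B d j \<xi> = obs_row c B j \<bullet> \<xi> + obs_offset c f B d j"

lemma obs_row_0 [simp]: "obs_row c B 0 = c"
  by (simp add: obs_row_def)

lemma affine_output_0 [simp]: "affine_output c f B d 0 \<xi> = c \<bullet> \<xi> + f"
  by (simp add: affine_output_def)

lemma obs_row_Suc: "obs_row c B (Suc j) = obs_row c B j v* B"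
  by (simp add: obs_row_def vector_matrix_mul_assoc)

text \<open>This explains the shifted index in \<open>obs_offset\<close>: differentiating an output
  along its mode gives the next output.\<close>

lemma obs_row_field: "obs_row c B j \<bullet> (B *v \<xi> + d) = affine_output c f B d (Suc j) \<xi>"
  by (simp add: affine_output_def obs_row_Suc dot_lmul_matrix inner_add_right)

lemma affine_output_has_derivative:
  assumes "(x has_vector_derivative v) (at t)"
  shows "((\<lambda>t. affine_output c f B d j (x t)) has_real_derivative obs_row c B j \<bullet> v) (at t)"
proof -
  have "((\<lambda>t. obs_row c B j \<bullet> x t) has_vector_derivative obs_row c B j \<bullet> v) (at t)"
    by (rule bounded_linear.has_vector_derivative[OF bounded_linear_inner_right assms])
  then have "((\<lambda>t. obs_row c B j \<bullet> x t) has_real_derivative obs_row c B j \<bullet> v) (at t)"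
    by (simp add: has_real_derivative_iff_has_vector_derivative)
  then show ?thesis unfolding affine_output_def by (auto intro!: derivative_eq_intros)
qed

lemma abs_cont_affine_output:
  "abs_cont_on_interval a b x \<Longrightarrow> abs_cont_on_interval a b (\<lambda>t. affine_output c f B d j (x t))"
  unfolding affine_output_def by (rule abs_cont_inner)

text \<open>Each new row raises the rank by at most one, so full rank of the first h + 1 rows forces
  a jump at every one of them, while maximality of \<open>h\<close> makes the next row dependent.
  The dimension bounds the rank and so makes \<open>GREATEST\<close> meaningful.\<close>

lemma obs_index_rank:
  fixes B :: "real^'n^'n"
  assumes c: "c \<noteq> 0"
  shows "\<And>k. k \<le> obs_index c B \<Longrightarrow> obs_row c B k \<notin> span (obs_row c B ` {..<k})"
    and "obs_row c B (Suc (obs_index c B)) \<in> span (obs_row c B ` {..<Suc (obs_index c B)})"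
proof -
  let ?R = "obs_row c B"
  define D where "D k = dim (?R ` {..<k})" for k
  have DS: "D (Suc k) = D k + (if ?R k \<in> span (?R ` {..<k}) then 0 else 1)" for k
    by (simp add: D_def lessThan_Suc dim_insert)
  have Dle: "D (k + l) \<le> D k + l" for k l
    by (induction l) (auto simp: DS)
  have D0: "D 0 = 0" by (simp add: D_def)
  have set: "{?R j |j. j \<le> k} = ?R ` {..<Suc k}" for k by (auto simp: less_Suc_eq_le)
  define h where "h = obs_index c B"
  let ?P = "\<lambda>k. dim {?R j |j. j \<le> k} = k + 1"
  have P0: "?P 0" using c by (simp add: set dim_insert)
  have bnd: "k \<le> CARD('n)" if "?P k" for k
    using dim_subset_UNIV[of "{?R j |j. j \<le> k}"] that by simp
  have Ph: "D (Suc h) = Suc h"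
    using GreatestI_nat[of ?P 0, OF P0 bnd] unfolding h_def obs_index_def D_def set by simp
  have nP: "\<not> D (Suc (Suc h)) = Suc (Suc h)"
  proof
    assume "D (Suc (Suc h)) = Suc (Suc h)"
    then have "?P (Suc h)" by (simp add: D_def set)
    then have "Suc h \<le> h" unfolding h_def obs_index_def using Greatest_le_nat[of ?P "Suc h" "CARD('n)"] bnd by (simp add: h_def obs_index_def)
    then show False by simp
  qed
  show "?R (Suc (obs_index c B)) \<in> span (?R ` {..<Suc (obs_index c B)})"
    using nP DS[of "Suc h"] Ph unfolding h_def[symmetric] by (auto split: if_splits)
  fix k assume k: "k \<le> obs_index c B"
  have "D (Suc h) \<le> D (Suc k) + (h - k)" using Dle[of "Suc k" "h - k"] k by (simp add: h_def)
  moreover have "D k \<le> k" using Dle[of 0 k] D0 by simp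
  ultimately show "?R k \<notin> span (?R ` {..<k})"
    using DS[of k] Ph k by (auto simp: h_def split: if_splits)
qed

lemma span_lessThan_coeffs:
  fixes r :: "nat \<Rightarrow> 'a::real_vector"
  shows "v \<in> span (r ` {..<k}) \<Longrightarrow> \<exists>a. v = (\<Sum>j<k. a j *\<^sub>R r j)"
proof (induction k arbitrary: v)
  case (Suc k)
  then obtain s where "v - s *\<^sub>R r k \<in> span (r ` {..<k})" by (auto simp: lessThan_Suc span_insert)
  then obtain a where a: "v - s *\<^sub>R r k = (\<Sum>j<k. a j *\<^sub>R r j)" using Suc.IH by blast
  have "v = (\<Sum>j<Suc k. (a(k := s)) j *\<^sub>R r j)" using a by (simp add: algebra_simps)
  then show ?case by blast
qed simp

text \<open>A relation between rows carries over to outputs once they have a common zero \<xi>0: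
  relative to it the outputs are linear in \<xi> - \<xi>0 and the offsets drop out.\<close>

lemma affine_output_combination:
  assumes p: "obs_row c B k = (\<Sum>j<k. p j *\<^sub>R obs_row c B j)"
    and zero: "\<And>j. j \<le> k \<Longrightarrow> affine_output c f B d j \<xi>0 = 0"
  shows "affine_output c f B d k \<xi> = (\<Sum>j<k. p j * affine_output c f B d j \<xi>)"
proof -
  have row: "obs_row c B k \<bullet> \<eta> = (\<Sum>j<k. p j * (obs_row c B j \<bullet> \<eta>))" for \<eta>
    unfolding p by (simp add: inner_sum_left)
  have diff: "affine_output c f B d j \<xi> = obs_row c B j \<bullet> (\<xi> - \<xi>0)" if "j \<le> k" for j
    using zero[OF that] by (simp add: affine_output_def inner_diff_right)
  show ?thesis using diff row by simp
qed

lemma affine_output_close: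
  fixes B :: "real^'n^'n"
  assumes c: "c \<noteq> 0" and zero: "\<And>j. j \<le> Suc (obs_index c B) \<Longrightarrow> affine_output c f B d j \<xi>0 = 0"
  shows "\<exists>P. \<forall>\<xi>. \<bar>affine_output c f B d (Suc (obs_index c B)) \<xi>\<bar> \<le> P * (\<Sum>l\<le>obs_index c B. \<bar>affine_output c f B d l \<xi>\<bar>)"
proof -
  let ?h = "obs_index c B" and ?y = "affine_output c f B d"
  obtain p where p: "obs_row c B (Suc ?h) = (\<Sum>j<Suc ?h. p j *\<^sub>R obs_row c B j)"
    using span_lessThan_coeffs[OF obs_index_rank(2)[OF c]] by blast
  have "\<bar>?y (Suc ?h) \<xi>\<bar> \<le> (\<Sum>l\<le>?h. \<bar>p l\<bar>) * (\<Sum>l\<le>?h. \<bar>?y l \<xi>\<bar>)" for \<xi>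
  proof -
    have "?y (Suc ?h) \<xi> = (\<Sum>l<Suc ?h. p l * ?y l \<xi>)"
      by (rule affine_output_combination[OF p zero])
    then have "\<bar>?y (Suc ?h) \<xi>\<bar> = \<bar>\<Sum>l\<le>?h. p l * ?y l \<xi>\<bar>"
      by (simp only: lessThan_Suc_atMost)
    also have "\<dots> \<le> (\<Sum>l\<le>?h. \<bar>p l\<bar> * \<bar>?y l \<xi>\<bar>)" unfolding abs_mult[symmetric] by (rule sum_abs)
    also have "\<dots> \<le> (\<Sum>l\<le>?h. \<bar>p l\<bar> * (\<Sum>l\<le>?h. \<bar>?y l \<xi>\<bar>))"
      by (intro sum_mono mult_left_mono member_le_sum) auto
    finally show ?thesis by (simp add: sum_distrib_right)
  qed
  then show ?thesis by blast
qed

text \<open>Along one mode the outputs form an exact chain, with multiplier 1 and no coupling; the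
  sign \<open>s\<close> is absorbed into the functions.\<close>

lemma mode_output_sign:
  fixes B :: "real^'n^'n"
  assumes x: "locally_lipschitz x" "\<And>t. (x has_vector_derivative B *v x t + d) (at t)"
    and zero: "\<And>j. j < k \<Longrightarrow> affine_output c f B d j (x 0) = 0"
    and s: "s * affine_output c f B d k (x 0) > 0"
  shows "\<exists>eps>0. \<forall>t\<in>{0<..<eps}. s * (c \<bullet> x t + f) > 0"
proof -
  have ac: "abs_cont_on_interval 0 1 x"
    using locally_lipschitz_imp_loc_abs_cont[OF x(1)] by (simp add: loc_abs_cont_def)
  have "\<exists>eps>0. 0 + eps \<le> 1 \<and> (\<forall>t\<in>{0<..<0 + eps}. s * affine_output c f B d 0 (x t) > 0)"
  proof (rule chain_positive[where z = "\<lambda>j t. s * affine_output c f B d j (x t)" and N = "{}" and m = 1 and K = 1 and k = k])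
    show "abs_cont_on_interval 0 1 (\<lambda>t. s * affine_output c f B d j (x t))" for j
      using abs_cont_inner[OF abs_cont_affine_output[OF ac], of s c f B d j 0] by simp
    fix t j
    have "((\<lambda>t. s * affine_output c f B d j (x t)) has_real_derivative s * affine_output c f B d (Suc j) (x t)) (at t)"
      using DERIV_cmult[OF affine_output_has_derivative[OF x(2)[of t], of c f B d j], of s] obs_row_field[of c B j "x t" d f] by simp
    then show "\<exists>D \<mu>. ((\<lambda>t. s * affine_output c f B d j (x t)) has_real_derivative D) (at t) \<and> 1 \<le> \<mu> \<and> \<mu> \<le> 1 \<and>
        \<bar>D - \<mu> * (s * affine_output c f B d (Suc j) (x t))\<bar> \<le> 1 * (\<Sum>l\<le>j. \<bar>s * affine_output c f B d l (x t)\<bar>)"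
      by (intro exI[of _ "s * affine_output c f B d (Suc j) (x t)"] exI[of _ 1]) (auto intro!: sum_nonneg)
  qed (use zero s in auto)
  then show ?thesis by auto
qed

lemma mode_output_zero:
  fixes B :: "real^'n^'n"
  assumes c: "c \<noteq> 0" and x: "locally_lipschitz x" "\<And>t. (x has_vector_derivative B *v x t + d) (at t)"
    and zero: "\<And>j. j \<le> Suc (obs_index c B) \<Longrightarrow> affine_output c f B d j (x 0) = 0"
  shows "\<exists>eps>0. \<forall>t\<in>{0<..<eps}. c \<bullet> x t + f = 0"
proof -
  have ac: "abs_cont_on_interval 0 1 x"
    using locally_lipschitz_imp_loc_abs_cont[OF x(1)] by (simp add: loc_abs_cont_def)
  obtain P where P: "\<And>\<xi>. \<bar>affine_output c f B d (Suc (obs_index c B)) \<xi>\<bar> \<le> P * (\<Sum>l\<le>obs_index c B. \<bar>affine_output c f B d l \<xi>\<bar>)"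
    using affine_output_close[OF c zero] by blast
  have "\<exists>eps>0. 0 + eps \<le> 1 \<and> (\<forall>t\<in>{0..0 + eps}. \<forall>j\<le>Suc (obs_index c B). affine_output c f B d j (x t) = 0)"
  proof (rule chain_zero[where z = "\<lambda>j t. affine_output c f B d j (x t)" and N = "{}" and K = 1 and P = P])
    fix t j
    have "((\<lambda>t. affine_output c f B d j (x t)) has_real_derivative affine_output c f B d (Suc j) (x t)) (at t)"
      using affine_output_has_derivative[OF x(2)[of t], of c f B d j] obs_row_field[of c B j "x t" d f] by simp
    then show "\<exists>D \<mu>. ((\<lambda>t. affine_output c f B d j (x t)) has_real_derivative D) (at t) \<and> 0 \<le> \<mu> \<and> \<mu> \<le> 1 \<and>
        \<bar>D - \<mu> * affine_output c f B d (Suc j) (x t)\<bar> \<le> 1 * (\<Sum>l\<le>j. \<bar>affine_output c f B d l (x t)\<bar>)"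
      by (intro exI[of _ "affine_output c f B d (Suc j) (x t)"] exI[of _ 1]) (auto intro!: sum_nonneg)
  qed (use zero P abs_cont_affine_output[OF ac] in auto)
  then obtain eps where e: "eps > 0"
    "\<forall>t\<in>{0..0 + eps}. \<forall>j\<le>Suc (obs_index c B). affine_output c f B d j (x t) = 0" by blast
  have "c \<bullet> x t + f = 0" if "t \<in> {0<..<eps}" for t
    using e(2)[rule_format, of t 0] that by simp
  then show ?thesis using e(1) by blast
qed

section \<open>Comparing two stacks of affine functionals\<close>

text \<open>Induction on the number of rows: \<xi> is corrected along the component of the new row
  orthogonal to the earlier ones, which is nonzero by independence and leaves the earlier values
  unchanged.\<close>

lemma independent_rows_solvable:
  fixes r :: "nat \<Rightarrow> 'a::euclidean_space"
  assumes "\<And>j. j < k \<Longrightarrow> r j \<notin> span (r ` {..<j})"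
  shows "\<exists>\<xi>. \<forall>j<k. r j \<bullet> \<xi> = b j"
  using assms
proof (induction k)
  case (Suc k)
  then obtain \<xi> where \<xi>: "\<And>j. j < k \<Longrightarrow> r j \<bullet> \<xi> = b j" by auto
  obtain p d where p: "p \<in> span (r ` {..<k})" and d: "\<And>w. w \<in> span (r ` {..<k}) \<Longrightarrow> orthogonal d w" and rk: "r k = p + d"
    using orthogonal_subspace_decomp_exists[of "r ` {..<k}" "r k"] by blast
  have "d \<noteq> 0" using Suc.prems[of k] rk p by auto
  have rd: "r k \<bullet> d = d \<bullet> d" using d[OF p] by (simp add: rk inner_add_left inner_add_right orthogonal_def inner_commute)
  define \<eta> where "\<eta> = \<xi> + ((b k - r k \<bullet> \<xi>) / (d \<bullet> d)) *\<^sub>R d"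
  have "r j \<bullet> \<eta> = b j" if "j < Suc k" for j
  proof (cases "j = k")
    case True
    then show ?thesis using \<open>d \<noteq> 0\<close> rd by (simp add: \<eta>_def inner_add_right)
  next
    case False
    then have "orthogonal d (r j)" using that by (intro d span_base) auto
    then have "r j \<bullet> d = 0" by (simp add: orthogonal_def inner_commute)
    then show ?thesis using \<xi>[of j] that False by (simp add: \<eta>_def inner_add_right)
  qed
  then show ?case by blast
qed simp

text \<open>The test points are confined to the span of \<open>u\<close> and \<open>v\<close>, so
  that the implication can later be used inside the orthogonal complement of the rows already
  treated.\<close>

lemma halfspace_implication:
  fixes u v :: "'a::real_inner"
  assumes "u \<noteq> 0" "v \<noteq> 0"
    and imp: "\<And>\<alpha> \<beta>. a1 + u \<bullet> (\<alpha> *\<^sub>R u + \<beta> *\<^sub>R v) < 0 \<Longrightarrow> a2 + v \<bullet> (\<alpha> *\<^sub>R u + \<beta> *\<^sub>R v) \<le> 0"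
  shows "\<exists>m>0. u = m *\<^sub>R v \<and> m * a2 \<le> a1"
proof -
  have uu: "u \<bullet> u > 0" using assms by simp
  define \<rho> where "\<rho> = v \<bullet> u / (u \<bullet> u)"
  \<comment> \<open>A nonzero part of \<open>v\<close> orthogonal to \<open>u\<close> could raise
    the second value freely without touching the first.\<close>
  define w where "w = v - \<rho> *\<^sub>R u"
  have uw: "u \<bullet> w = 0" using uu by (simp add: w_def \<rho>_def inner_diff_right inner_commute)
  have vw: "v \<bullet> w = w \<bullet> w" using uw by (simp add: w_def inner_diff_left inner_diff_right inner_commute)
  have vu: "v \<bullet> u = \<rho> * (u \<bullet> u)" using uu by (simp add: \<rho>_def)
  have imp': "a2 + \<alpha> * \<rho> * (u \<bullet> u) + \<beta> * (w \<bullet> w) \<le> 0" if "a1 + \<alpha> * (u \<bullet> u) < 0" for \<alpha> \<beta>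
  proof -
    have eq: "(\<alpha> - \<beta> * \<rho>) *\<^sub>R u + \<beta> *\<^sub>R v = \<alpha> *\<^sub>R u + \<beta> *\<^sub>R w" by (simp add: w_def algebra_simps)
    have "a1 + u \<bullet> ((\<alpha> - \<beta> * \<rho>) *\<^sub>R u + \<beta> *\<^sub>R v) < 0"
      unfolding eq using that uw by (simp add: inner_add_right)
    from imp[OF this] show ?thesis unfolding eq using vw vu by (simp add: inner_add_right)
  qed
  have "w = 0"
  proof (rule ccontr)
    assume "w \<noteq> 0"
    then have ww: "w \<bullet> w > 0" by simp
    define \<alpha> where "\<alpha> = - (\<bar>a1\<bar> + 1) / (u \<bullet> u)"
    have "a1 + \<alpha> * (u \<bullet> u) < 0" using uu by (simp add: \<alpha>_def)
    from imp'[OF this, of "(\<bar>a2 + \<alpha> * \<rho> * (u \<bullet> u)\<bar> + 1) / (w \<bullet> w)"] ww show False by simp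
  qed
  then have v: "v = \<rho> *\<^sub>R u" by (simp add: w_def)
  then have "\<rho> \<noteq> 0" using assms by auto
  have "\<rho> > 0"
  proof (rule ccontr)
    assume "\<not> \<rho> > 0"
    then have neg: "\<rho> < 0" using \<open>\<rho> \<noteq> 0\<close> by simp
    \<comment> \<open>Lowering the first value by \<open>T\<close> makes it negative and, for
      negative \<rho>, raises the second to at least a2 + |a2| + 1.\<close>
    define T where "T = \<bar>a1\<bar> + 1 + (\<bar>a2\<bar> + 1) / (- \<rho>)"
    have T: "T \<ge> \<bar>a1\<bar> + 1" using neg by (simp add: T_def divide_nonneg_neg)
    have "- \<rho> * T = - \<rho> * (\<bar>a1\<bar> + 1) + (\<bar>a2\<bar> + 1)" using neg by (simp add: T_def field_simps)
    moreover have "- \<rho> * (\<bar>a1\<bar> + 1) \<ge> 0" using neg by (intro mult_nonneg_nonneg) auto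
    moreover have "a1 + (- T / (u \<bullet> u)) * (u \<bullet> u) < 0" using uu T by simp
    from imp'[OF this, of 0] have "a2 - \<rho> * T \<le> 0" using uu by (simp add: mult.commute)
    ultimately show False by simp
  qed
  have "\<rho> * a1 \<ge> a2"
  proof (rule ccontr)
    assume "\<not> \<rho> * a1 \<ge> a2"
    \<comment> \<open>Brings the first value down to - \<eta>, just inside its half-space, where the
      second value is still (a2 - \<rho> * a1) / 2 > 0.\<close>
    define \<eta> where "\<eta> = (a2 - \<rho> * a1) / (2 * \<rho>)"
    have \<eta>: "\<eta> > 0" "\<rho> * \<eta> = (a2 - \<rho> * a1) / 2" using \<open>\<rho> > 0\<close> \<open>\<not> \<rho> * a1 \<ge> a2\<close> by (auto simp: \<eta>_def)
    have "a1 + ((- a1 - \<eta>) / (u \<bullet> u)) * (u \<bullet> u) < 0" using uu \<eta> by simp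
    from imp'[OF this, of 0] have "a2 + (- a1 - \<eta>) * \<rho> \<le> 0" using uu by (simp add: mult.commute)
    then show False using \<eta> \<open>\<not> \<rho> * a1 \<ge> a2\<close> by (simp add: algebra_simps)
  qed
  moreover have "u = (1 / \<rho>) *\<^sub>R v" using v \<open>\<rho> \<noteq> 0\<close> by simp
  ultimately show ?thesis using \<open>\<rho> > 0\<close> by (intro exI[of _ "1 / \<rho>"]) (simp add: field_simps)
qed

section \<open>Triangular relations between stacks of rows\<close>

lemma stack_mult_lower:
  assumes "lower_tri_pos m M" "i < m"
  shows "stack_mult m M w i = (\<Sum>j<i. M i j *\<^sub>R w j) + M i i *\<^sub>R w i"
proof -
  have "stack_mult m M w i = (\<Sum>j<Suc i. M i j *\<^sub>R w j)"
    unfolding stack_mult_def using assms by (intro sum.mono_neutral_right) (auto simp: lower_tri_pos_def)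
  then show ?thesis by simp
qed

text \<open>Forward substitution: the positive diagonal entry expresses each row of the second stack
  through a row of the first and earlier rows of the second.\<close>

lemma stack_mult_span_eq:
  fixes r1 r2 :: "nat \<Rightarrow> 'a::real_vector"
  assumes M: "lower_tri_pos m M" and eq: "stack_eq m r1 (stack_mult m M r2)"
  shows "span (r1 ` {..<m}) = span (r2 ` {..<m})"
proof (rule order.antisym; rule span_minimal[OF _ subspace_span]; clarsimp)
  have r1: "r1 i = (\<Sum>j<i. M i j *\<^sub>R r2 j) + M i i *\<^sub>R r2 i" if "i < m" for i
    using eq that stack_mult_lower[OF M that] by (simp add: stack_eq_def)
  show "r1 i \<in> span (r2 ` {..<m})" if "i < m" for i
    unfolding r1[OF that] using that by (intro span_add span_sum span_scale span_base) auto
  show "r2 i \<in> span (r1 ` {..<m})" if "i < m" for i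
    using that
  proof (induction i rule: less_induct)
    case (less i)
    have "M i i > 0" using M less.prems by (simp add: lower_tri_pos_def)
    then have "r2 i = (1 / M i i) *\<^sub>R (r1 i - (\<Sum>j<i. M i j *\<^sub>R r2 j))" using r1[OF less.prems] by simp
    moreover have "r1 i \<in> span (r1 ` {..<m})" using less.prems by (intro span_base) auto
    moreover have "(\<Sum>j<i. M i j *\<^sub>R r2 j) \<in> span (r1 ` {..<m})"
      using less by (intro span_sum span_scale less.IH) auto
    ultimately show ?case by (metis span_diff span_scale)
  qed
qed

lemma stack_mult_inner:
  fixes w :: "nat \<Rightarrow> 'a::real_inner"
  shows "stack_mult m M w i \<bullet> \<xi> = stack_mult m M (\<lambda>j. w j \<bullet> \<xi>) i"
  by (simp add: stack_mult_def inner_sum_left)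

lemma stack_mult_add:
  "stack_mult m M (\<lambda>j. w j + w' j) i = stack_mult m M w i + stack_mult m M w' i"
  by (simp add: stack_mult_def scaleR_add_right sum.distrib)

text \<open>The bottom row of the new matrix consists of the span coefficients and \<mu>. At a
  common zero \<xi> of the earlier outputs, the offset defect in that row becomes a comparison of
  the two new outputs, weighted by \<mu>.\<close>

lemma stack_extend:
  fixes r1 r2 :: "nat \<Rightarrow> 'a::real_inner"
  assumes M: "lower_tri_pos m M" and r: "stack_eq m r1 (stack_mult m M r2)" and off: "stack_eq m o1 (stack_mult m M o2)"
    and \<mu>: "\<mu> > 0" and span: "r1 m - \<mu> *\<^sub>R r2 m \<in> span (r2 ` {..<m})"
    and \<xi>: "\<And>j. j < m \<Longrightarrow> r2 j \<bullet> \<xi> + o2 j = 0"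
  shows "\<exists>M'. lower_tri_pos (Suc m) M' \<and> stack_eq (Suc m) r1 (stack_mult (Suc m) M' r2) \<and>
    stack_eq m o1 (stack_mult (Suc m) M' o2) \<and>
    o1 m - stack_mult (Suc m) M' o2 m = (r1 m \<bullet> \<xi> + o1 m) - \<mu> * (r2 m \<bullet> \<xi> + o2 m)"
proof -
  obtain a where a: "r1 m - \<mu> *\<^sub>R r2 m = (\<Sum>j<m. a j *\<^sub>R r2 j)" using span_lessThan_coeffs[OF span] by blast
  define M' where "M' i j = (if i < m then (if j < m then M i j else 0) else if j < m then a j else \<mu>)" for i j
  have old: "stack_mult (Suc m) M' r2 i = stack_mult m M r2 i" "stack_mult (Suc m) M' o2 i = stack_mult m M o2 i"
    if "i < m" for i using that by (simp_all add: stack_mult_def M'_def)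
  have new: "stack_mult (Suc m) M' r2 m = (\<Sum>j<m. a j *\<^sub>R r2 j) + \<mu> *\<^sub>R r2 m"
    "stack_mult (Suc m) M' o2 m = (\<Sum>j<m. a j * o2 j) + \<mu> * o2 m"
    by (simp_all add: stack_mult_def M'_def)
  have "lower_tri_pos (Suc m) M'" using M \<mu> by (auto simp: lower_tri_pos_def M'_def less_Suc_eq)
  moreover have "stack_eq (Suc m) r1 (stack_mult (Suc m) M' r2)"
    unfolding stack_eq_def
  proof (intro allI impI)
    fix i assume "i < Suc m"
    then consider "i < m" | "i = m" by linarith
    then show "r1 i = stack_mult (Suc m) M' r2 i"
    proof cases
      case 2
      then show ?thesis using a new(1) by (simp add: algebra_simps)
    qed (use r old in \<open>auto simp: stack_eq_def\<close>)
  qed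
  moreover have "stack_eq m o1 (stack_mult (Suc m) M' o2)" using off old by (auto simp: stack_eq_def)
  moreover have "o1 m - stack_mult (Suc m) M' o2 m = (r1 m \<bullet> \<xi> + o1 m) - \<mu> * (r2 m \<bullet> \<xi> + o2 m)"
  proof -
    have "(r1 m - \<mu> *\<^sub>R r2 m) \<bullet> \<xi> = (\<Sum>j<m. a j * (r2 j \<bullet> \<xi>))" unfolding a by (simp add: inner_sum_left)
    also have "\<dots> = (\<Sum>j<m. - (a j * o2 j))"
    proof (intro sum.cong refl)
      fix j assume "j \<in> {..<m}"
      then have "r2 j \<bullet> \<xi> = - o2 j" using \<xi>[of j] by simp
      then show "a j * (r2 j \<bullet> \<xi>) = - (a j * o2 j)" by simp
    qed
    finally have "r1 m \<bullet> \<xi> - \<mu> * (r2 m \<bullet> \<xi>) = - (\<Sum>j<m. a j * o2 j)" by (simp add: inner_diff_left sum_negf)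
    then show ?thesis using new(2) by (simp add: algebra_simps)
  qed
  ultimately show ?thesis by blast
qed

text \<open>With m = h + 1 and m = h + 2 this is the matrix condition of statements 4 and 5;
  \<open>stacks_greater\<close> plays that role for statement 3, with m = k + 1.\<close>

definition stacks_related :: "nat \<Rightarrow> (nat \<Rightarrow> 'a::real_inner) \<Rightarrow> (nat \<Rightarrow> 'a) \<Rightarrow> (nat \<Rightarrow> real) \<Rightarrow> (nat \<Rightarrow> real) \<Rightarrow> bool" where
  "stacks_related m r1 r2 o1 o2 \<longleftrightarrow> (\<exists>M. lower_tri_pos m M \<and> stack_eq m r1 (stack_mult m M r2) \<and> stack_eq m o1 (stack_mult m M o2))"

definition stacks_greater :: "nat \<Rightarrow> (nat \<Rightarrow> 'a::real_inner) \<Rightarrow> (nat \<Rightarrow> 'a) \<Rightarrow> (nat \<Rightarrow> real) \<Rightarrow> (nat \<Rightarrow> real) \<Rightarrow> bool" where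
  "stacks_greater m r1 r2 o1 o2 \<longleftrightarrow> (\<exists>M. lower_tri_pos m M \<and> stack_eq m r1 (stack_mult m M r2) \<and> lex_greater m o1 (stack_mult m M o2))"

text \<open>The rows treated so far have the same span \<open>S\<close> in both stacks. On \<xi>
  plus the orthogonal complement of \<open>S\<close> all earlier outputs vanish and the next ones
  are a1 + d1 \<bullet> d and a2 + d2 \<bullet> d; the sign hypotheses become an implication between
  two half-spaces there. The cases are which of \<open>d1\<close>, \<open>d2\<close> vanish, that
  is, which of \<open>h1\<close>, \<open>h2\<close> equals \<open>k\<close>.\<close>

lemma stack_step:
  fixes r1 r2 :: "nat \<Rightarrow> 'a::euclidean_space"
  assumes rel: "stacks_related (Suc k) r1 r2 o1 o2" and k: "k \<le> h1" "k \<le> h2"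
    and ind1: "\<And>j. j \<le> h1 \<Longrightarrow> r1 j \<notin> span (r1 ` {..<j})" and dep1: "r1 (Suc h1) \<in> span (r1 ` {..<Suc h1})"
    and ind2: "\<And>j. j \<le> h2 \<Longrightarrow> r2 j \<notin> span (r2 ` {..<j})" and dep2: "r2 (Suc h2) \<in> span (r2 ` {..<Suc h2})"
    and neg: "\<And>\<xi> k. (\<And>j. j < k \<Longrightarrow> r1 j \<bullet> \<xi> + o1 j = 0) \<Longrightarrow> r1 k \<bullet> \<xi> + o1 k < 0 \<Longrightarrow>
        \<exists>l\<le>Suc h2. (\<forall>j<l. r2 j \<bullet> \<xi> + o2 j = 0) \<and> r2 l \<bullet> \<xi> + o2 l < 0"
    and pos: "\<And>\<xi> k. (\<And>j. j < k \<Longrightarrow> r2 j \<bullet> \<xi> + o2 j = 0) \<Longrightarrow> r2 k \<bullet> \<xi> + o2 k > 0 \<Longrightarrow>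
        \<exists>l\<le>Suc h1. (\<forall>j<l. r1 j \<bullet> \<xi> + o1 j = 0) \<and> r1 l \<bullet> \<xi> + o1 l > 0"
  obtains (greater) "stacks_greater (Suc (Suc k)) r1 r2 o1 o2"
    | (less) \<xi> where "k = h1" "h1 < h2" "\<And>j. j \<le> h1 \<Longrightarrow> r1 j \<bullet> \<xi> + o1 j = 0" "r1 (Suc h1) \<bullet> \<xi> + o1 (Suc h1) > 0"
    | (gr) \<xi> where "k = h2" "h2 < h1" "\<And>j. j \<le> h2 \<Longrightarrow> r2 j \<bullet> \<xi> + o2 j = 0" "r2 (Suc h2) \<bullet> \<xi> + o2 (Suc h2) < 0"
    | (related) "stacks_related (Suc (Suc k)) r1 r2 o1 o2" "k < h1 \<longleftrightarrow> k < h2"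
proof -
  obtain M where M: "lower_tri_pos (Suc k) M" "stack_eq (Suc k) r1 (stack_mult (Suc k) M r2)" "stack_eq (Suc k) o1 (stack_mult (Suc k) M o2)"
    using rel unfolding stacks_related_def by blast
  define S where "S = span (r2 ` {..<Suc k})"
  have S: "span (r1 ` {..<Suc k}) = S" "subspace S" unfolding S_def using stack_mult_span_eq[OF M(1,2)] by auto
  obtain \<xi> where "\<And>j. j < Suc k \<Longrightarrow> r2 j \<bullet> \<xi> = - o2 j"
    using independent_rows_solvable[of "Suc k" r2 "\<lambda>j. - o2 j"] ind2 k by auto
  then have y2: "r2 j \<bullet> \<xi> + o2 j = 0" if "j < Suc k" for j using that by simp
  have y1: "r1 j \<bullet> \<xi> + o1 j = 0" if "j < Suc k" for j
  proof -
    have "r1 j \<bullet> \<xi> + o1 j = stack_mult (Suc k) M (\<lambda>j. r2 j \<bullet> \<xi> + o2 j) j"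
      using M that by (simp add: stack_eq_def stack_mult_inner stack_mult_add)
    also have "\<dots> = 0" using y2 unfolding stack_mult_def by (intro sum.neutral) auto
    finally show ?thesis .
  qed
  define a1 a2 where "a1 = r1 (Suc k) \<bullet> \<xi> + o1 (Suc k)" and "a2 = r2 (Suc k) \<bullet> \<xi> + o2 (Suc k)"
  have dec: "\<exists>d. r - d \<in> S \<and> (\<forall>w\<in>S. w \<bullet> d = 0)" for r :: 'a
  proof -
    obtain p d where "p \<in> S" and d: "\<And>w. w \<in> S \<Longrightarrow> orthogonal d w" and "r = p + d"
      using orthogonal_subspace_decomp_exists[of "r2 ` {..<Suc k}" r] unfolding S_def by blast
    then show ?thesis by (intro exI[of _ d]) (auto simp: orthogonal_def inner_commute)
  qed
  obtain d1 where d1: "r1 (Suc k) - d1 \<in> S" "\<And>w. w \<in> S \<Longrightarrow> w \<bullet> d1 = 0" using dec by blast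
  obtain d2 where d2: "r2 (Suc k) - d2 \<in> S" "\<And>w. w \<in> S \<Longrightarrow> w \<bullet> d2 = 0" using dec by blast
  have rS: "r1 j \<in> S" "r2 j \<in> S" if "j < Suc k" for j
    using that S(1) unfolding S_def by (auto intro: span_base)
  have shift: "r1 j \<bullet> (\<xi> + d) + o1 j = 0" "r2 j \<bullet> (\<xi> + d) + o2 j = 0"
    if "j < Suc k" "\<And>w. w \<in> S \<Longrightarrow> w \<bullet> d = 0" for j d
    using y1[OF that(1)] y2[OF that(1)] that(2)[OF rS(1)[OF that(1)]] that(2)[OF rS(2)[OF that(1)]]
    by (simp_all add: inner_add_right)
  have top: "r1 (Suc k) \<bullet> (\<xi> + d) + o1 (Suc k) = a1 + d1 \<bullet> d" "r2 (Suc k) \<bullet> (\<xi> + d) + o2 (Suc k) = a2 + d2 \<bullet> d"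
    if "\<And>w. w \<in> S \<Longrightarrow> w \<bullet> d = 0" for d
    using that[OF d1(1)] that[OF d2(1)] by (simp_all add: a1_def a2_def inner_add_right inner_diff_left)
  \<comment> \<open>The first nonzero output of the second stack may come after row k + 1, whence
    only a weak inequality; if k = h2, the bound l \<le> Suc h2 leaves no later row and the
    inequality is strict.\<close>
  have C1: "a2 + d2 \<bullet> d \<le> 0" "k = h2 \<Longrightarrow> a2 + d2 \<bullet> d < 0"
    if d: "\<And>w. w \<in> S \<Longrightarrow> w \<bullet> d = 0" and n: "a1 + d1 \<bullet> d < 0" for d
  proof -
    obtain l where l: "l \<le> Suc h2" "\<forall>j<l. r2 j \<bullet> (\<xi> + d) + o2 j = 0" "r2 l \<bullet> (\<xi> + d) + o2 l < 0"
      using neg[of "Suc k" "\<xi> + d"] shift(1)[OF _ d] top(1)[OF d] n by auto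
    have "\<not> l < Suc k" using l(3) shift(2)[OF _ d, of l] by auto
    then have "l = Suc k \<or> Suc k < l" by linarith
    then show "a2 + d2 \<bullet> d \<le> 0" "k = h2 \<Longrightarrow> a2 + d2 \<bullet> d < 0" using l top(2)[OF d] by fastforce+
  qed
  have C2: "k = h1 \<Longrightarrow> a1 + d1 \<bullet> d > 0"
    if d: "\<And>w. w \<in> S \<Longrightarrow> w \<bullet> d = 0" and n: "a2 + d2 \<bullet> d > 0" for d
  proof -
    assume kh: "k = h1"
    obtain l where l: "l \<le> Suc h1" "\<forall>j<l. r1 j \<bullet> (\<xi> + d) + o1 j = 0" "r1 l \<bullet> (\<xi> + d) + o1 l > 0"
      using pos[of "Suc k" "\<xi> + d"] shift(2)[OF _ d] top(2)[OF d] n by auto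
    have "\<not> l < Suc k" using l(3) shift(1)[OF _ d, of l] by auto
    then have "l = Suc k" using l(1) kh by linarith
    then show "a1 + d1 \<bullet> d > 0" using l top(1)[OF d] by simp
  qed
  \<comment> \<open>The residual orthogonal to \<open>S\<close> vanishes exactly when the new row
    depends on the earlier ones.\<close>
  have zero1: "d1 = 0 \<longleftrightarrow> k = h1"
  proof
    assume "d1 = 0"
    then have "r1 (Suc k) \<in> span (r1 ` {..<Suc k})" using d1(1) S by simp
    then show "k = h1" using ind1[of "Suc k"] k by (meson le_antisym not_less_eq_eq)
  next
    assume "k = h1"
    then have "r1 (Suc k) \<in> S" using dep1 S by simp
    then have "d1 \<in> S" using d1(1) S(2) by (metis add_diff_cancel_left' diff_add_cancel subspace_diff)
    then show "d1 = 0" using d1(2)[of d1] by simp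
  qed
  have zero2: "d2 = 0 \<longleftrightarrow> k = h2"
  proof
    assume "d2 = 0"
    then have "r2 (Suc k) \<in> span (r2 ` {..<Suc k})" using d2(1) S_def by simp
    then show "k = h2" using ind2[of "Suc k"] k by (meson le_antisym not_less_eq_eq)
  next
    assume "k = h2"
    then have "r2 (Suc k) \<in> S" using dep2 S_def by simp
    then have "d2 \<in> S" using d2(1) S(2) by (metis add_diff_cancel_left' diff_add_cancel subspace_diff)
    then show "d2 = 0" using d2(2)[of d2] by simp
  qed
  \<comment> \<open>Equality \<mu> * a2 = a1 prolongs the triangular relation; strict inequality is
    a lexicographic gap at row k + 1.\<close>
  have finish: thesis if \<mu>: "\<mu> > 0" "d1 = \<mu> *\<^sub>R d2" "\<mu> * a2 \<le> a1" and iff: "k < h1 \<longleftrightarrow> k < h2" for \<mu>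
  proof -
    have "r1 (Suc k) - \<mu> *\<^sub>R r2 (Suc k) = (r1 (Suc k) - d1) - \<mu> *\<^sub>R (r2 (Suc k) - d2)"
      using \<mu>(2) by (simp add: algebra_simps)
    also have "\<dots> \<in> S" by (rule subspace_diff[OF S(2) d1(1) subspace_scale[OF S(2) d2(1)]])
    finally obtain M' where M': "lower_tri_pos (Suc (Suc k)) M'" "stack_eq (Suc (Suc k)) r1 (stack_mult (Suc (Suc k)) M' r2)"
      "stack_eq (Suc k) o1 (stack_mult (Suc (Suc k)) M' o2)" "o1 (Suc k) - stack_mult (Suc (Suc k)) M' o2 (Suc k) = a1 - \<mu> * a2"
      using stack_extend[OF M \<mu>(1) _ y2] unfolding S_def a1_def a2_def by blast
    show thesis
    proof (cases "\<mu> * a2 = a1")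
      case True
      then have "stack_eq (Suc (Suc k)) o1 (stack_mult (Suc (Suc k)) M' o2)"
        using M'(3,4) by (auto simp: stack_eq_def less_Suc_eq)
      then show thesis using M'(1,2) iff by (intro related) (auto simp: stacks_related_def)
    next
      case False
      then have "lex_pos (Suc (Suc k)) (\<lambda>i. o1 i - stack_mult (Suc (Suc k)) M' o2 i)"
        unfolding lex_pos_def using M'(3,4) \<mu>(3) by (intro exI[of _ "Suc k"]) (auto simp: stack_eq_def)
      then show thesis using M'(1,2) by (intro greater) (auto simp: stacks_greater_def lex_greater_def)
    qed
  qed
  consider "k < h1" "k < h2" | "k = h1" "k < h2" | "k < h1" "k = h2" | "k = h1" "k = h2" using k by linarith
  then show thesis
  proof cases
    case 1
    then have nz: "d1 \<noteq> 0" "d2 \<noteq> 0" using zero1 zero2 by auto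
    have "\<exists>m>0. d1 = m *\<^sub>R d2 \<and> m * a2 \<le> a1"
    proof (rule halfspace_implication[OF nz])
      fix \<alpha> \<beta> assume "a1 + d1 \<bullet> (\<alpha> *\<^sub>R d1 + \<beta> *\<^sub>R d2) < 0"
      then show "a2 + d2 \<bullet> (\<alpha> *\<^sub>R d1 + \<beta> *\<^sub>R d2) \<le> 0"
        using d1(2) d2(2) by (intro C1) (auto simp: inner_add_right)
    qed
    then show thesis using finish 1 by blast
  next
    case 2
    have d: "d1 = 0" "d2 \<noteq> 0" using zero1 zero2 2 by auto
    \<comment> \<open>The direction is scaled so that the second value becomes 1; since d1 = 0, the
      first stays a1.\<close>
    have "a1 + d1 \<bullet> (((1 - a2) / (d2 \<bullet> d2)) *\<^sub>R d2) > 0"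
      using d d2(2) 2 by (intro C2) auto
    then have "a1 > 0" using d by simp
    then show thesis using 2 y1 by (intro less[of \<xi>]) (auto simp: a1_def)
  next
    case 3
    have d: "d2 = 0" "d1 \<noteq> 0" using zero1 zero2 3 by auto
    \<comment> \<open>Symmetrically, the first value becomes -1 while the second stays a2.\<close>
    have "a2 + d2 \<bullet> (((- 1 - a1) / (d1 \<bullet> d1)) *\<^sub>R d1) < 0"
      using d d1(2) 3 by (intro C1(2)) auto
    then have "a2 < 0" using d by simp
    then show thesis using 3 y2 by (intro gr[of \<xi>]) (auto simp: a2_def)
  next
    case 4
    have d: "d1 = 0" "d2 = 0" using zero1 zero2 4 by auto
    have "a1 < 0 \<Longrightarrow> a2 < 0" using C1(2)[of 0] 4 by simp
    have "a2 > 0 \<Longrightarrow> a1 > 0" using C2[of 0] 4 by simp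
    \<comment> \<open>If a1 < 0 or a2 > 0, both have the same sign and a1 / a2 gives equality;
      otherwise a2 \<le> 0 \<le> a1 and \<mu> = 1 works.\<close>
    have "\<exists>\<mu>>0. \<mu> * a2 \<le> a1"
    proof (cases "a1 < 0 \<or> a2 > 0")
      case True
      with \<open>a1 < 0 \<Longrightarrow> a2 < 0\<close> \<open>a2 > 0 \<Longrightarrow> a1 > 0\<close> show ?thesis
        by (intro exI[of _ "a1 / a2"]) (auto simp: divide_neg_neg)
    qed (auto intro!: exI[of _ 1])
    then show thesis using finish 4 d by auto
  qed
qed

text \<open>Iterates \<open>stack_step\<close> from row 0. The alternatives with h1 \<noteq> h2 can
  occur only in the last step, because there \<open>k\<close> equals the smaller index.\<close>

theorem stacks_alternative:
  fixes r1 r2 :: "nat \<Rightarrow> 'a::euclidean_space"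
  assumes base: "r1 0 = r2 0" "o1 0 = o2 0"
    and ind1: "\<And>j. j \<le> h1 \<Longrightarrow> r1 j \<notin> span (r1 ` {..<j})" and dep1: "r1 (Suc h1) \<in> span (r1 ` {..<Suc h1})"
    and ind2: "\<And>j. j \<le> h2 \<Longrightarrow> r2 j \<notin> span (r2 ` {..<j})" and dep2: "r2 (Suc h2) \<in> span (r2 ` {..<Suc h2})"
    and neg: "\<And>\<xi> k. (\<And>j. j < k \<Longrightarrow> r1 j \<bullet> \<xi> + o1 j = 0) \<Longrightarrow> r1 k \<bullet> \<xi> + o1 k < 0 \<Longrightarrow>
        \<exists>l\<le>Suc h2. (\<forall>j<l. r2 j \<bullet> \<xi> + o2 j = 0) \<and> r2 l \<bullet> \<xi> + o2 l < 0"
    and pos: "\<And>\<xi> k. (\<And>j. j < k \<Longrightarrow> r2 j \<bullet> \<xi> + o2 j = 0) \<Longrightarrow> r2 k \<bullet> \<xi> + o2 k > 0 \<Longrightarrow>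
        \<exists>l\<le>Suc h1. (\<forall>j<l. r1 j \<bullet> \<xi> + o1 j = 0) \<and> r1 l \<bullet> \<xi> + o1 l > 0"
  defines "h \<equiv> min h1 h2"
  shows "(\<exists>k\<le>h. stacks_greater (Suc (Suc k)) r1 r2 o1 o2) \<or>
    stacks_related (Suc h) r1 r2 o1 o2 \<and>
     (h1 < h2 \<and> (\<exists>\<xi>. (\<forall>j\<le>h1. r1 j \<bullet> \<xi> + o1 j = 0) \<and> r1 (Suc h1) \<bullet> \<xi> + o1 (Suc h1) > 0) \<or>
      h2 < h1 \<and> (\<exists>\<xi>. (\<forall>j\<le>h2. r2 j \<bullet> \<xi> + o2 j = 0) \<and> r2 (Suc h2) \<bullet> \<xi> + o2 (Suc h2) < 0)) \<or>
    h1 = h2 \<and> stacks_related (Suc (Suc h)) r1 r2 o1 o2" (is "?G \<or> ?L \<or> ?E")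
proof (rule disjCI)
  assume no: "\<not> (?L \<or> ?E)"
  have step: "?G \<or> stacks_related (Suc (Suc k)) r1 r2 o1 o2 \<and> (k < h1 \<longleftrightarrow> k < h2)"
    if rel: "stacks_related (Suc k) r1 r2 o1 o2" and k: "k \<le> h" for k
  proof -
    have kh: "k \<le> h1" "k \<le> h2" using k by (auto simp: h_def)
    show ?thesis
    proof (rule stack_step[OF rel kh])
      show "r1 j \<notin> span (r1 ` {..<j})" if "j \<le> h1" for j using that by (rule ind1)
      show "r2 j \<notin> span (r2 ` {..<j})" if "j \<le> h2" for j using that by (rule ind2)
      show "\<exists>l\<le>Suc h2. (\<forall>j<l. r2 j \<bullet> \<xi> + o2 j = 0) \<and> r2 l \<bullet> \<xi> + o2 l < 0"
        if "\<And>j. j < k \<Longrightarrow> r1 j \<bullet> \<xi> + o1 j = 0" "r1 k \<bullet> \<xi> + o1 k < 0" for \<xi> k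
        using that by (rule neg)
      show "\<exists>l\<le>Suc h1. (\<forall>j<l. r1 j \<bullet> \<xi> + o1 j = 0) \<and> r1 l \<bullet> \<xi> + o1 l > 0"
        if "\<And>j. j < k \<Longrightarrow> r2 j \<bullet> \<xi> + o2 j = 0" "r2 k \<bullet> \<xi> + o2 k > 0" for \<xi> k
        using that by (rule pos)
    next
      assume "stacks_greater (Suc (Suc k)) r1 r2 o1 o2"
      then show ?thesis using k by blast
    next
      fix \<xi> assume "k = h1" "h1 < h2" "\<And>j. j \<le> h1 \<Longrightarrow> r1 j \<bullet> \<xi> + o1 j = 0" "r1 (Suc h1) \<bullet> \<xi> + o1 (Suc h1) > 0"
      moreover from this have "h = k" by (simp add: h_def)
      ultimately show ?thesis using no rel by blast
    next
      fix \<xi> assume "k = h2" "h2 < h1" "\<And>j. j \<le> h2 \<Longrightarrow> r2 j \<bullet> \<xi> + o2 j = 0" "r2 (Suc h2) \<bullet> \<xi> + o2 (Suc h2) < 0"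
      moreover from this have "h = k" by (simp add: h_def)
      ultimately show ?thesis using no rel by blast
    qed (use dep1 dep2 in auto)
  qed
  have "stacks_related (Suc 0) r1 r2 o1 o2"
    unfolding stacks_related_def using base
    by (intro exI[of _ "\<lambda>i j. 1"]) (auto simp: lower_tri_pos_def stack_eq_def stack_mult_def)
  then have "?G \<or> stacks_related (Suc k) r1 r2 o1 o2" if "k \<le> h" for k
    using that
  proof (induction k)
    case (Suc k)
    then have "k \<le> h" by simp
    then show ?case using Suc step[of k] by blast
  qed simp
  then have "?G \<or> stacks_related (Suc (Suc h)) r1 r2 o1 o2 \<and> (h < h1 \<longleftrightarrow> h < h2)" using step by blast
  then show ?G using no by (auto simp: h_def min_def split: if_splits)
qed

section \<open>Consequences of right-uniqueness\<close>

text \<open>Only weak inequalities are asked, so this serves both modes that leave the hyperplane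
  and modes that stay inside it.\<close>

lemma mode_solutions_agree:
  fixes A :: "nat \<Rightarrow> real^'n^'n"
  assumes st1: "statement1 A e c f"
    and x1: "x1 0 = \<xi>" "locally_lipschitz x1" "\<And>t. (x1 has_vector_derivative A 1 *v x1 t + e 1) (at t)"
    and x2: "x2 0 = \<xi>" "locally_lipschitz x2" "\<And>t. (x2 has_vector_derivative A 2 *v x2 t + e 2) (at t)"
    and eps1: "eps1 > 0" "\<And>t. t \<in> {0<..<eps1} \<Longrightarrow> c \<bullet> x1 t + f \<le> 0"
    and eps2: "eps2 > 0" "\<And>t. t \<in> {0<..<eps2} \<Longrightarrow> c \<bullet> x2 t + f \<ge> 0"
  shows "\<exists>\<delta>>0. \<forall>t\<in>{0..<\<delta>}. x1 t = x2 t"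
proof -
  obtain X1 where X1: "filippov_solution A e c f \<xi> X1" "\<And>t. t \<in> {0..<eps1} \<Longrightarrow> X1 t = x1 t"
    using mode_extension[of 1 x1 \<xi> A e eps1 c f] x1 eps1 by auto
  have "\<exists>X. filippov_solution A e c f \<xi> X \<and> (\<forall>t\<in>{0..<eps2}. X t = x2 t)"
  proof (rule mode_extension[of 2 x2 \<xi> A e eps2 c f, OF _ x2 eps2(1)])
    show "(-1)^(2-1) * (c \<bullet> x2 t + f) \<le> 0" if "t \<in> {0<..<eps2}" for t using eps2(2)[OF that] by simp
  qed simp
  then obtain X2 where X2: "filippov_solution A e c f \<xi> X2" "\<And>t. t \<in> {0..<eps2} \<Longrightarrow> X2 t = x2 t" by blast
  obtain \<delta> where "\<delta> > 0" "\<And>t. t \<in> {0..<\<delta>} \<Longrightarrow> X1 t = X2 t"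
    using st1 X1(1) X2(1) unfolding statement1_def right_unique_def by blast
  then show ?thesis using eps1(1) eps2(1) X1(2) X2(2)
    by (intro exI[of _ "min \<delta> (min eps1 eps2)"]) (metis atLeastLessThan_iff min_less_iff_conj)
qed

lemma mode_starts:
  fixes B :: "real^'n^'n"
  assumes c: "c \<noteq> 0"
    and y: "first_sign s (\<lambda>j. affine_output c f B d j \<xi>) \<or> (\<forall>j\<le>Suc (obs_index c B). affine_output c f B d j \<xi> = 0)"
  shows "\<exists>x eps. x 0 = \<xi> \<and> locally_lipschitz x \<and> (\<forall>t. (x has_vector_derivative B *v x t + d) (at t)) \<and> eps > 0 \<and>
    (\<forall>t\<in>{0<..<eps}. s * (c \<bullet> x t + f) \<ge> 0) \<and>
    (first_sign s (\<lambda>j. affine_output c f B d j \<xi>) \<longrightarrow> (\<forall>t\<in>{0<..<eps}. s * (c \<bullet> x t + f) > 0))"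
proof -
  obtain x where x: "x 0 = \<xi>" "locally_lipschitz x" "\<And>t. (x has_vector_derivative B *v x t + d) (at t)"
    using linear_ode_exists[of \<xi> B d] by blast
  show ?thesis
  proof (cases "first_sign s (\<lambda>j. affine_output c f B d j \<xi>)")
    case True
    then obtain k where "\<And>j. j < k \<Longrightarrow> affine_output c f B d j \<xi> = 0" "s * affine_output c f B d k \<xi> > 0"
      unfolding first_sign_def by blast
    then obtain eps where "eps > 0" "\<forall>t\<in>{0<..<eps}. s * (c \<bullet> x t + f) > 0"
      using mode_output_sign[OF x(2,3), of k c f s] x(1) by auto
    then show ?thesis using x by (intro exI[of _ x] exI[of _ eps]) (auto intro: less_imp_le)
  next
    case False
    then obtain eps where "eps > 0" "\<forall>t\<in>{0<..<eps}. c \<bullet> x t + f = 0"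
      using mode_output_zero[OF c x(2,3), of f] y x(1) by auto
    then show ?thesis using x False by (intro exI[of _ x] exI[of _ eps]) auto
  qed
qed

text \<open>If each mode can start on its own side, possibly inside the hyperplane, right-uniqueness
  makes the two trajectories agree for a while, and neither can then leave it strictly.\<close>

lemma statement1_no_splitting:
  fixes A :: "nat \<Rightarrow> real^'n^'n" and e :: "nat \<Rightarrow> real^'n" and c :: "real^'n" and f :: real
  defines "y \<equiv> \<lambda>i \<xi> j. affine_output c f (A i) (e i) j \<xi>"
  assumes c: "c \<noteq> 0" and st1: "statement1 A e c f"
    and 1: "first_sign (-1) (y 1 \<xi>) \<or> (\<forall>j\<le>Suc (obs_index c (A 1)). y 1 \<xi> j = 0)"
    and 2: "first_sign 1 (y 2 \<xi>) \<or> (\<forall>j\<le>Suc (obs_index c (A 2)). y 2 \<xi> j = 0)"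
  shows "\<not> first_sign (-1) (y 1 \<xi>) \<and> \<not> first_sign 1 (y 2 \<xi>)"
proof -
  obtain x1 eps1 where x1: "x1 0 = \<xi>" "locally_lipschitz x1" "\<And>t. (x1 has_vector_derivative A 1 *v x1 t + e 1) (at t)"
    and e1: "eps1 > 0" "\<And>t. t \<in> {0<..<eps1} \<Longrightarrow> -1 * (c \<bullet> x1 t + f) \<ge> 0"
      "first_sign (-1) (y 1 \<xi>) \<Longrightarrow> t \<in> {0<..<eps1} \<Longrightarrow> -1 * (c \<bullet> x1 t + f) > 0" for t
    using mode_starts[OF c 1[unfolded y_def]] unfolding y_def by blast
  obtain x2 eps2 where x2: "x2 0 = \<xi>" "locally_lipschitz x2" "\<And>t. (x2 has_vector_derivative A 2 *v x2 t + e 2) (at t)"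
    and e2: "eps2 > 0" "\<And>t. t \<in> {0<..<eps2} \<Longrightarrow> 1 * (c \<bullet> x2 t + f) \<ge> 0"
      "first_sign 1 (y 2 \<xi>) \<Longrightarrow> t \<in> {0<..<eps2} \<Longrightarrow> 1 * (c \<bullet> x2 t + f) > 0" for t
    using mode_starts[OF c 2[unfolded y_def]] unfolding y_def by blast
  have "\<exists>\<delta>>0. \<forall>t\<in>{0..<\<delta>}. x1 t = x2 t"
  proof (rule mode_solutions_agree[OF st1 x1 x2 e1(1) _ e2(1)])
    show "c \<bullet> x1 t + f \<le> 0" if "t \<in> {0<..<eps1}" for t using e1(2)[OF that] by simp
    show "c \<bullet> x2 t + f \<ge> 0" if "t \<in> {0<..<eps2}" for t using e2(2)[OF that] by simp
  qed
  then obtain \<delta> where \<delta>: "\<delta> > 0" "\<And>t. t \<in> {0..<\<delta>} \<Longrightarrow> x1 t = x2 t" by blast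
  \<comment> \<open>At a time inside all three intervals the two weak signs force the common output
    to be 0, against either strict sign.\<close>
  define t where "t = min \<delta> (min eps1 eps2) / 2"
  have t: "t \<in> {0..<\<delta>}" "t \<in> {0<..<eps1}" "t \<in> {0<..<eps2}" using \<delta>(1) e1(1) e2(1) by (auto simp: t_def)
  show ?thesis using e1(2)[OF t(2)] e1(3)[OF _ t(2)] e2(2)[OF t(3)] e2(3)[OF _ t(3)] \<delta>(2)[OF t(1)] by auto
qed

text \<open>Supplies the hypothesis \<open>neg\<close> of \<open>stacks_alternative\<close>: with a
  positive first sign or only zero outputs, mode 2 could start as well.\<close>

lemma statement1_negative:
  fixes A :: "nat \<Rightarrow> real^'n^'n"
  assumes "c \<noteq> 0" "statement1 A e c f"
    and "\<And>j. j < k \<Longrightarrow> affine_output c f (A 1) (e 1) j \<xi> = 0" "affine_output c f (A 1) (e 1) k \<xi> < 0"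
  shows "\<exists>l\<le>Suc (obs_index c (A 2)). (\<forall>j<l. affine_output c f (A 2) (e 2) j \<xi> = 0) \<and> affine_output c f (A 2) (e 2) l \<xi> < 0"
proof -
  have 1: "first_sign (-1) (\<lambda>j. affine_output c f (A 1) (e 1) j \<xi>)"
    unfolding first_sign_def using assms(3,4) by (intro exI[of _ k]) auto
  show ?thesis
  proof (cases rule: first_nonzero_cases[of "Suc (obs_index c (A 2))" "\<lambda>j. affine_output c f (A 2) (e 2) j \<xi>"])
    case (pos l)
    then have "first_sign 1 (\<lambda>j. affine_output c f (A 2) (e 2) j \<xi>)"
      unfolding first_sign_def by (intro exI[of _ l]) auto
    then show ?thesis using statement1_no_splitting[OF assms(1,2), of \<xi>] 1 by blast
  qed (use statement1_no_splitting[OF assms(1,2), of \<xi>] 1 in blast)+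
qed

lemma statement1_positive:
  fixes A :: "nat \<Rightarrow> real^'n^'n"
  assumes "c \<noteq> 0" "statement1 A e c f"
    and "\<And>j. j < k \<Longrightarrow> affine_output c f (A 2) (e 2) j \<xi> = 0" "affine_output c f (A 2) (e 2) k \<xi> > 0"
  shows "\<exists>l\<le>Suc (obs_index c (A 1)). (\<forall>j<l. affine_output c f (A 1) (e 1) j \<xi> = 0) \<and> affine_output c f (A 1) (e 1) l \<xi> > 0"
proof -
  have 2: "first_sign 1 (\<lambda>j. affine_output c f (A 2) (e 2) j \<xi>)"
    unfolding first_sign_def using assms(3,4) by (intro exI[of _ k]) auto
  show ?thesis
  proof (cases rule: first_nonzero_cases[of "Suc (obs_index c (A 1))" "\<lambda>j. affine_output c f (A 1) (e 1) j \<xi>"])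
    case (neg l)
    then have "first_sign (-1) (\<lambda>j. affine_output c f (A 1) (e 1) j \<xi>)"
      unfolding first_sign_def by (intro exI[of _ l]) auto
    then show ?thesis using statement1_no_splitting[OF assms(1,2), of \<xi>] 2 by blast
  qed (use statement1_no_splitting[OF assms(1,2), of \<xi>] 2 in blast)+
qed

section \<open>The coefficients \<open>p\<^sub>i\<close> and the constants in statement 4\<close>

lemma independent_coeffs_zero:
  fixes r :: "nat \<Rightarrow> 'a::real_vector"
  assumes "\<And>j. j < k \<Longrightarrow> r j \<notin> span (r ` {..<j})" "(\<Sum>j<k. a j *\<^sub>R r j) = 0"
  shows "\<forall>j<k. a j = 0"
  using assms
proof (induction k)
  case (Suc k)
  have mem: "(\<Sum>j<k. a j *\<^sub>R r j) \<in> span (r ` {..<k})" by (intro span_sum span_scale span_base) auto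
  have "a k = 0"
  proof (rule ccontr)
    assume "a k \<noteq> 0"
    have "a k *\<^sub>R r k = - (\<Sum>j<k. a j *\<^sub>R r j)"
      using Suc.prems(2) by (simp add: eq_neg_iff_add_eq_0 add.commute)
    then have "a k *\<^sub>R r k \<in> span (r ` {..<k})" using span_neg[OF mem] by simp
    then have "(1 / a k) *\<^sub>R (a k *\<^sub>R r k) \<in> span (r ` {..<k})" by (rule span_scale)
    then have "r k \<in> span (r ` {..<k})" using \<open>a k \<noteq> 0\<close> by simp
    then show False using Suc.prems(1)[of k] by simp
  qed
  then show ?case using Suc by (auto simp: less_Suc_eq)
qed simp

text \<open>Dependence of row h + 1 gives existence for the \<open>THE\<close> in the definition;
  independence of the earlier rows and the zero convention beyond \<open>h\<close> make the function
  unique.\<close>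

lemma obs_coeffs:
  fixes B :: "real^'n^'n"
  assumes c: "c \<noteq> 0"
  shows "obs_row c B (Suc (obs_index c B)) = (\<Sum>j\<le>obs_index c B. obs_coeffs c B j *\<^sub>R obs_row c B j)"
proof -
  let ?h = "obs_index c B" and ?R = "obs_row c B"
  let ?P = "\<lambda>p. (\<forall>j>?h. p j = 0) \<and> ?R (?h + 1) = (\<Sum>j\<le>?h. p j *\<^sub>R ?R j)"
  obtain a where a: "?R (Suc ?h) = (\<Sum>j<Suc ?h. a j *\<^sub>R ?R j)"
    using span_lessThan_coeffs[OF obs_index_rank(2)[OF c]] by blast
  have "\<exists>!p. ?P p"
  proof (rule ex1I[of _ "\<lambda>j. if j \<le> ?h then a j else 0"])
    show "?P (\<lambda>j. if j \<le> ?h then a j else 0)" using a by (simp add: lessThan_Suc_atMost del: sum.lessThan_Suc)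
    fix p assume p: "?P p"
    have "(\<Sum>j<Suc ?h. (p j - a j) *\<^sub>R ?R j) = 0"
      using a p by (simp add: lessThan_Suc_atMost scaleR_diff_left sum_subtractf del: sum.lessThan_Suc)
    then have "\<forall>j<Suc ?h. p j - a j = 0"
      using obs_index_rank(1)[OF c] by (intro independent_coeffs_zero) auto
    then show "p = (\<lambda>j. if j \<le> ?h then a j else 0)" using p by (auto simp: fun_eq_iff)
  qed
  from theI'[OF this] show ?thesis unfolding obs_coeffs_def by simp
qed

text \<open>On common zeros each earlier row takes the value minus its offset, so the next output is
  constant there. This constant is what statement 4 tests for its sign.\<close>

lemma affine_output_top:
  fixes B :: "real^'n^'n"
  assumes c: "c \<noteq> 0" and zero: "\<And>j. j \<le> obs_index c B \<Longrightarrow> affine_output c f B d j \<xi> = 0"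
  shows "affine_output c f B d (Suc (obs_index c B)) \<xi> =
    obs_row c B (obs_index c B) \<bullet> d - (\<Sum>j\<le>obs_index c B. obs_coeffs c B j * obs_offset c f B d j)"
proof -
  let ?h = "obs_index c B"
  have "obs_row c B (Suc ?h) \<bullet> \<xi> = (\<Sum>j\<le>?h. obs_coeffs c B j * (obs_row c B j \<bullet> \<xi>))"
    unfolding obs_coeffs[OF c] by (simp add: inner_sum_left)
  also have "\<dots> = (\<Sum>j\<le>?h. - (obs_coeffs c B j * obs_offset c f B d j))"
  proof (intro sum.cong refl)
    fix j assume "j \<in> {..?h}"
    then have "obs_row c B j \<bullet> \<xi> = - obs_offset c f B d j" using zero[of j] by (simp add: affine_output_def)
    then show "obs_coeffs c B j * (obs_row c B j \<bullet> \<xi>) = - (obs_coeffs c B j * obs_offset c f B d j)" by simp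
  qed
  finally show ?thesis by (simp add: affine_output_def sum_negf)
qed

theorem statement1_imp_345:
  fixes A :: "nat \<Rightarrow> real^'n^'n"
  assumes c: "c \<noteq> 0" and st1: "statement1 A e c f"
  shows "statement3 A e c f \<or> statement4 A e c f \<or> statement5 A e c f"
proof -
  define h1 h2 where "h1 = obs_index c (A 1)" and "h2 = obs_index c (A 2)"
  let ?r1 = "obs_row c (A 1)" and ?r2 = "obs_row c (A 2)"
  let ?o1 = "obs_offset c f (A 1) (e 1)" and ?o2 = "obs_offset c f (A 2) (e 2)"
  have h: "min_obs_index A c = min h1 h2" by (simp add: min_obs_index_def h1_def h2_def)
  have "(\<exists>k\<le>min h1 h2. stacks_greater (Suc (Suc k)) ?r1 ?r2 ?o1 ?o2) \<or>
    stacks_related (Suc (min h1 h2)) ?r1 ?r2 ?o1 ?o2 \<and>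
     (h1 < h2 \<and> (\<exists>\<xi>. (\<forall>j\<le>h1. ?r1 j \<bullet> \<xi> + ?o1 j = 0) \<and> ?r1 (Suc h1) \<bullet> \<xi> + ?o1 (Suc h1) > 0) \<or>
      h2 < h1 \<and> (\<exists>\<xi>. (\<forall>j\<le>h2. ?r2 j \<bullet> \<xi> + ?o2 j = 0) \<and> ?r2 (Suc h2) \<bullet> \<xi> + ?o2 (Suc h2) < 0)) \<or>
    h1 = h2 \<and> stacks_related (Suc (Suc (min h1 h2))) ?r1 ?r2 ?o1 ?o2" (is "?G \<or> ?L \<or> ?E")
  proof (rule stacks_alternative)
    show "?r1 j \<notin> span (?r1 ` {..<j})" if "j \<le> h1" for j using obs_index_rank(1)[OF c] that by (simp add: h1_def)
    show "?r2 j \<notin> span (?r2 ` {..<j})" if "j \<le> h2" for j using obs_index_rank(1)[OF c] that by (simp add: h2_def)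
    show "?r1 (Suc h1) \<in> span (?r1 ` {..<Suc h1})" unfolding h1_def by (rule obs_index_rank(2)[OF c])
    show "?r2 (Suc h2) \<in> span (?r2 ` {..<Suc h2})" unfolding h2_def by (rule obs_index_rank(2)[OF c])
    show "\<exists>l\<le>Suc h2. (\<forall>j<l. ?r2 j \<bullet> \<xi> + ?o2 j = 0) \<and> ?r2 l \<bullet> \<xi> + ?o2 l < 0"
      if "\<And>j. j < k \<Longrightarrow> ?r1 j \<bullet> \<xi> + ?o1 j = 0" "?r1 k \<bullet> \<xi> + ?o1 k < 0" for \<xi> k
      using statement1_negative[OF c st1, of k \<xi>] that by (simp add: affine_output_def h2_def)
    show "\<exists>l\<le>Suc h1. (\<forall>j<l. ?r1 j \<bullet> \<xi> + ?o1 j = 0) \<and> ?r1 l \<bullet> \<xi> + ?o1 l > 0"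
      if "\<And>j. j < k \<Longrightarrow> ?r2 j \<bullet> \<xi> + ?o2 j = 0" "?r2 k \<bullet> \<xi> + ?o2 k > 0" for \<xi> k
      using statement1_positive[OF c st1, of k \<xi>] that by (simp add: affine_output_def h1_def)
  qed simp_all
  then consider ?G | ?L | ?E by blast
  then show ?thesis
  proof cases
    case 1
    then obtain k where k: "k \<le> min h1 h2" "stacks_greater (Suc (Suc k)) ?r1 ?r2 ?o1 ?o2" by blast
    \<comment> \<open>A relation on k + 2 rows is statement 3 with index k + 1, which ranges from 1
      to h + 1.\<close>
    then have "statement3 A e c f"
      unfolding statement3_def stacks_greater_def h by (intro exI[of _ "Suc k"]) auto
    then show ?thesis by blast
  next
    case 2
    then have rel: "stacks_related (Suc (min h1 h2)) ?r1 ?r2 ?o1 ?o2" by blast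
    note top1 = affine_output_top[OF c, of "A 1" f "e 1", unfolded affine_output_def, folded h1_def]
    note top2 = affine_output_top[OF c, of "A 2" f "e 2", unfolded affine_output_def, folded h2_def]
    from 2 have "h1 < h2 \<and> ?r1 h1 \<bullet> e 1 - (\<Sum>j\<le>h1. obs_coeffs c (A 1) j * ?o1 j) > 0 \<or>
      h2 < h1 \<and> ?r2 h2 \<bullet> e 2 - (\<Sum>j\<le>h2. obs_coeffs c (A 2) j * ?o2 j) < 0"
    proof (elim conjE disjE exE)
      fix \<xi> assume "h1 < h2" "\<forall>j\<le>h1. ?r1 j \<bullet> \<xi> + ?o1 j = 0" "?r1 (Suc h1) \<bullet> \<xi> + ?o1 (Suc h1) > 0"
      then show ?thesis using top1[of \<xi>] by simp
    next
      fix \<xi> assume "h2 < h1" "\<forall>j\<le>h2. ?r2 j \<bullet> \<xi> + ?o2 j = 0" "?r2 (Suc h2) \<bullet> \<xi> + ?o2 (Suc h2) < 0"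
      then show ?thesis using top2[of \<xi>] by simp
    qed
    then have "statement4 A e c f"
      using rel unfolding statement4_def Let_def h stacks_related_def h1_def[symmetric] h2_def[symmetric] by simp
    then show ?thesis by blast
  next
    case 3
    then have "h1 = h2" "stacks_related (Suc (Suc h2)) ?r1 ?r2 ?o1 ?o2" by auto
    then have "statement5 A e c f"
      unfolding statement5_def Let_def h stacks_related_def h1_def[symmetric] h2_def[symmetric] by simp
    then show ?thesis by blast
  qed
qed

text \<open>The inverse is again lower triangular. It matters that the sum stops at
  \<open>i\<close>: a coupling term in the chain for index \<open>j\<close> may only involve outputs
  up to \<open>j\<close>.\<close>

lemma lower_tri_inverse_bound:
  assumes M: "lower_tri_pos m M"
  shows "\<exists>K\<ge>0. \<forall>y1 y2. stack_eq m y1 (stack_mult m M y2) \<longrightarrow> (\<forall>i<m. \<bar>y2 i :: real\<bar> \<le> K * (\<Sum>l\<le>i. \<bar>y1 l\<bar>))"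
proof -
  have "\<exists>K\<ge>0. \<forall>y1 y2. stack_eq m y1 (stack_mult m M y2) \<longrightarrow> \<bar>y2 i :: real\<bar> \<le> K * (\<Sum>l\<le>i. \<bar>y1 l\<bar>)" if "i < m" for i
    using that
  proof (induction i rule: less_induct)
    case (less i)
    then have "\<forall>j\<in>{..<i}. \<exists>K\<ge>0. \<forall>y1 y2. stack_eq m y1 (stack_mult m M y2) \<longrightarrow> \<bar>y2 j :: real\<bar> \<le> K * (\<Sum>l\<le>j. \<bar>y1 l\<bar>)"
      by auto
    from bchoice[OF this] obtain K where K: "\<And>j. j < i \<Longrightarrow> K j \<ge> 0"
      "\<And>j y1 y2. j < i \<Longrightarrow> stack_eq m y1 (stack_mult m M y2) \<Longrightarrow> \<bar>y2 j :: real\<bar> \<le> K j * (\<Sum>l\<le>j. \<bar>y1 l\<bar>)" by auto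
    have Mi: "M i i > 0" using M less.prems by (simp add: lower_tri_pos_def)
    \<comment> \<open>Forward substitution: the entry \<open>y1 i\<close> contributes 1, the earlier
      unknowns their own constants, and the diagonal entry divides the total.\<close>
    define C where "C = (1 + (\<Sum>j<i. \<bar>M i j\<bar> * K j)) / M i i"
    have "C \<ge> 0" using Mi K(1) by (auto simp: C_def intro!: divide_nonneg_pos add_nonneg_nonneg sum_nonneg mult_nonneg_nonneg)
    moreover have "\<bar>y2 i\<bar> \<le> C * (\<Sum>l\<le>i. \<bar>y1 l\<bar>)" if eq: "stack_eq m y1 (stack_mult m M y2)" for y1 y2
    proof -
      let ?Y = "\<Sum>l\<le>i. \<bar>y1 l\<bar>"
      have Y: "?Y \<ge> 0" by (intro sum_nonneg) auto
      have "y1 i = (\<Sum>j<i. M i j * y2 j) + M i i * y2 i"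
        using eq stack_mult_lower[OF M less.prems, of y2] less.prems by (simp add: stack_eq_def)
      then have "y1 i - (\<Sum>j<i. M i j * y2 j) = M i i * y2 i" by simp
      then have "M i i * \<bar>y2 i\<bar> = \<bar>y1 i - (\<Sum>j<i. M i j * y2 j)\<bar>" using Mi by (simp add: abs_mult)
      also have "\<dots> \<le> \<bar>y1 i\<bar> + (\<Sum>j<i. \<bar>M i j * y2 j\<bar>)"
        using sum_abs[of "\<lambda>j. M i j * y2 j" "{..<i}"] by linarith
      also have "\<dots> \<le> ?Y + (\<Sum>j<i. \<bar>M i j\<bar> * K j * ?Y)"
      proof (intro add_mono sum_mono)
        show "\<bar>y1 i\<bar> \<le> ?Y" by (intro member_le_sum) auto
        fix j assume j: "j \<in> {..<i}"
        have "\<bar>y2 j\<bar> \<le> K j * (\<Sum>l\<le>j. \<bar>y1 l\<bar>)" using K(2)[OF _ eq, of j] j by simp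
        also have "\<dots> \<le> K j * ?Y" using K(1)[of j] j by (intro mult_left_mono sum_mono2) auto
        finally show "\<bar>M i j * y2 j\<bar> \<le> \<bar>M i j\<bar> * K j * ?Y" by (simp add: abs_mult mult.assoc mult_left_mono)
      qed
      also have "\<dots> = (1 + (\<Sum>j<i. \<bar>M i j\<bar> * K j)) * ?Y" by (simp add: distrib_right sum_distrib_right)
      also have "\<dots> = M i i * (C * ?Y)" using Mi by (simp add: C_def)
      finally show ?thesis using Mi by simp
    qed
    ultimately show ?case by blast
  qed
  then have "\<forall>i\<in>{..<m}. \<exists>K\<ge>0. \<forall>y1 y2. stack_eq m y1 (stack_mult m M y2) \<longrightarrow> \<bar>y2 i :: real\<bar> \<le> K * (\<Sum>l\<le>i. \<bar>y1 l\<bar>)" by auto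
  from bchoice[OF this] obtain K where K: "\<And>j. j < m \<Longrightarrow> K j \<ge> 0"
      "\<And>j y1 y2. j < m \<Longrightarrow> stack_eq m y1 (stack_mult m M y2) \<Longrightarrow> \<bar>y2 j :: real\<bar> \<le> K j * (\<Sum>l\<le>j. \<bar>y1 l\<bar>)" by auto
  have "\<bar>y2 i\<bar> \<le> (\<Sum>j<m. K j) * (\<Sum>l\<le>i. \<bar>y1 l\<bar>)" if "stack_eq m y1 (stack_mult m M y2)" "i < m" for y1 y2 i
  proof -
    have "K i \<le> (\<Sum>j<m. K j)" using that K(1) by (intro member_le_sum) auto
    then have "K i * (\<Sum>l\<le>i. \<bar>y1 l\<bar>) \<le> (\<Sum>j<m. K j) * (\<Sum>l\<le>i. \<bar>y1 l\<bar>)" by (intro mult_right_mono sum_nonneg) auto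
    then show ?thesis using K(2)[OF that(2,1)] by linarith
  qed
  moreover have "(\<Sum>j<m. K j) \<ge> 0" using K(1) by (intro sum_nonneg) auto
  ultimately show ?thesis by blast
qed

lemma affine_output_stack:
  assumes "stack_eq m (obs_row c B) (stack_mult m M (obs_row c B'))"
    "stack_eq m (obs_offset c f B d) (stack_mult m M (obs_offset c f B' d'))"
  shows "stack_eq m (\<lambda>j. affine_output c f B d j \<xi>) (stack_mult m M (\<lambda>j. affine_output c f B' d' j \<xi>))"
  using assms by (simp add: stack_eq_def affine_output_def stack_mult_add stack_mult_inner)

text \<open>From a common zero of all outputs both modes stay in the hyperplane for a while, so both
  trajectories extend to solutions; right-uniqueness makes them agree, and with them their
  velocities at time 0.\<close>

theorem statement15_imp_6:
  fixes A :: "nat \<Rightarrow> real^'n^'n"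
  assumes c: "c \<noteq> 0" and st1: "statement1 A e c f" and st5: "statement5 A e c f"
  shows "statement6 A e c f"
  unfolding statement6_def
proof (intro allI impI)
  fix \<xi> assume z: "\<forall>j\<le>min_obs_index A c + 1. obs_row c (A 1) j \<bullet> \<xi> + obs_offset c f (A 1) (e 1) j = 0"
  define h where "h = min_obs_index A c"
  have h: "obs_index c (A 1) = h" "obs_index c (A 2) = h" using st5 by (auto simp: h_def min_obs_index_def statement5_def)
  obtain M where M: "lower_tri_pos (h+2) M" "stack_eq (h+2) (obs_row c (A 1)) (stack_mult (h+2) M (obs_row c (A 2)))"
           "stack_eq (h+2) (obs_offset c f (A 1) (e 1)) (stack_mult (h+2) M (obs_offset c f (A 2) (e 2)))"
    using st5 unfolding statement5_def Let_def h_def by blast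
  have y1: "affine_output c f (A 1) (e 1) j \<xi> = 0" if "j \<le> Suc h" for j using z that by (simp add: affine_output_def h_def)
  obtain K where K: "\<And>y1 y2 i. stack_eq (h+2) y1 (stack_mult (h+2) M y2) \<Longrightarrow> i < h + 2 \<Longrightarrow> \<bar>y2 i :: real\<bar> \<le> K * (\<Sum>l\<le>i. \<bar>y1 l\<bar>)"
    using lower_tri_inverse_bound[OF M(1)] by blast
  have y2: "affine_output c f (A 2) (e 2) j \<xi> = 0" if "j \<le> Suc h" for j
    using K[OF affine_output_stack[OF M(2,3)], of j \<xi>] y1 that by simp
  obtain x1 where x1: "x1 0 = \<xi>" "locally_lipschitz x1" "\<And>t. (x1 has_vector_derivative A 1 *v x1 t + e 1) (at t)"
    using linear_ode_exists[of \<xi> "A 1" "e 1"] by blast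
  obtain x2 where x2: "x2 0 = \<xi>" "locally_lipschitz x2" "\<And>t. (x2 has_vector_derivative A 2 *v x2 t + e 2) (at t)"
    using linear_ode_exists[of \<xi> "A 2" "e 2"] by blast
  obtain eps1 where e1: "eps1 > 0" "\<And>t. t \<in> {0<..<eps1} \<Longrightarrow> c \<bullet> x1 t + f = 0"
    using mode_output_zero[OF c x1(2,3), of f] y1 x1(1) h by auto
  obtain eps2 where e2: "eps2 > 0" "\<And>t. t \<in> {0<..<eps2} \<Longrightarrow> c \<bullet> x2 t + f = 0"
    using mode_output_zero[OF c x2(2,3), of f] y2 x2(1) h by auto
  have "\<exists>\<delta>>0. \<forall>t\<in>{0..<\<delta>}. x1 t = x2 t"
    by (rule mode_solutions_agree[OF st1 x1 x2 e1(1) _ e2(1)]) (use e1(2) e2(2) in auto)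
  then obtain \<delta> where \<delta>: "\<delta> > 0" "\<And>t. t \<in> {0..<\<delta>} \<Longrightarrow> x1 t = x2 t" by blast
  \<comment> \<open>Agreement is known only for t \<ge> 0, so the derivatives are compared
    one-sidedly, within a closed interval starting at 0.\<close>
  let ?I = "{0..\<delta> / 2}"
  have "(x1 has_vector_derivative A 1 *v \<xi> + e 1) (at 0 within ?I)"
    using has_vector_derivative_at_within[OF x1(3)[of 0]] x1(1) by simp
  moreover have "(x2 has_vector_derivative A 2 *v \<xi> + e 2) (at 0 within ?I)"
    using has_vector_derivative_at_within[OF x2(3)[of 0]] x2(1) by simp
  then have "(x1 has_vector_derivative A 2 *v \<xi> + e 2) (at 0 within ?I)"
    by (rule has_vector_derivative_transform[rotated 2]) (use \<delta> in auto)
  ultimately show "A 1 *v \<xi> + e 1 = A 2 *v \<xi> + e 2"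
    using vector_derivative_unique_within_closed_interval[of 0 "\<delta> / 2" 0 x1] \<delta>(1) by auto
qed

section \<open>Filippov solutions under statements 5 and 6\<close>

lemma filippov_solutionE:
  assumes "filippov_solution A e c f \<xi> x"
  obtains N where "negligible N" "\<And>t. t \<notin> N \<Longrightarrow> \<exists>v\<in>pwa_G A e c f (x t). (x has_vector_derivative v) (at t)"
proof -
  have "AE t in lebesgue. \<exists>v\<in>pwa_G A e c f (x t). (x has_vector_derivative v) (at t)"
    using assms unfolding filippov_solution_def inclusion_solution_def by blast
  then obtain N where "N \<in> null_sets lebesgue"
    "{t \<in> space lebesgue. \<not> (\<exists>v\<in>pwa_G A e c f (x t). (x has_vector_derivative v) (at t))} \<subseteq> N"
    by (auto simp: eventually_ae_filter)
  then show ?thesis using that[of N] by (auto simp: negligible_iff_null_sets)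
qed

lemma filippov_abs_cont:
  "filippov_solution A e c f \<xi> x \<Longrightarrow> a \<le> b \<Longrightarrow> abs_cont_on_interval a b x"
  by (simp add: filippov_solution_def inclusion_solution_def loc_abs_cont_def)

lemma filippov_continuous:
  assumes "filippov_solution A e c f \<xi> x"
  shows "isCont x t"
proof -
  have "continuous_on {t - 1<..<t + 1} x"
    by (rule continuous_on_subset[OF abs_cont_continuous_on[OF filippov_abs_cont[OF assms, of "t - 1" "t + 1"]]]) auto
  then show ?thesis by (simp add: continuous_on_eq_continuous_at)
qed

text \<open>The growth bound confines both modes to a ball, and balls are convex, so the convexified
  velocity obeys the same bound; absolute continuity turns it into a Lipschitz constant.\<close>

lemma filippov_locally_lipschitz:
  fixes A :: "nat \<Rightarrow> real^'n^'n"
  assumes x: "filippov_solution A e c f \<xi> x"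
  shows "locally_lipschitz x"
  unfolding locally_lipschitz_def
proof (intro allI)
  fix a b :: real
  obtain N where N: "negligible N" "\<And>t. t \<notin> N \<Longrightarrow> \<exists>v\<in>pwa_G A e c f (x t). (x has_vector_derivative v) (at t)"
    by (rule filippov_solutionE[OF x]) (rule that)
  obtain K where K: "K > 0" "\<And>z u. u \<in> pwa_F A e c f z \<Longrightarrow> norm u \<le> K * (1 + norm z)"
    by (rule pwa_F_growth[of A e c f]) (rule that)
  have "compact (x ` {a..b})"
    using filippov_continuous[OF x] by (intro compact_continuous_image) (auto simp: continuous_at_imp_continuous_on)
  from compact_imp_bounded[OF this] obtain R where R: "\<And>t. t \<in> {a..b} \<Longrightarrow> norm (x t) \<le> R"
    unfolding bounded_iff by blast
  define L where "L = K * (1 + \<bar>R\<bar>)"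
  have GL: "norm v \<le> L" if t: "t \<in> {a..b}" and v: "v \<in> pwa_G A e c f (x t)" for t v
  proof -
    have "pwa_F A e c f (x t) \<subseteq> cball 0 (K * (1 + norm (x t)))" using K(2) by auto
    then have "pwa_G A e c f (x t) \<subseteq> cball 0 (K * (1 + norm (x t)))"
      unfolding pwa_G_def by (rule hull_minimal) (rule convex_cball)
    then have "norm v \<le> K * (1 + norm (x t))" using v by auto
    also have "\<dots> \<le> L" unfolding L_def using K(1) R[OF t] by (intro mult_left_mono) auto
    finally show ?thesis .
  qed
  have "L-lipschitz_on {a..b} x"
  proof (rule lipschitz_on_leI)
    fix s t assume st: "s \<in> {a..b}" "t \<in> {a..b}" "s \<le> t"
    have "norm (x t - x s - (t - s) *\<^sub>R 0) \<le> L * (t - s)"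
    proof (rule abs_cont_increment[OF st(3) filippov_abs_cont[OF x st(3)] N(1)])
      fix r assume "r \<in> {s<..<t} - N"
      then show "\<exists>v. (x has_vector_derivative v) (at r) \<and> norm (v - 0) \<le> L"
        using N(2)[of r] GL[of r] st by auto
    qed
    then show "dist (x s) (x t) \<le> L * dist s t" using st by (simp add: dist_norm norm_minus_commute)
  qed (use K in \<open>auto simp: L_def\<close>)
  then show "\<exists>L. L-lipschitz_on {a..b} x" by blast
qed

section \<open>Time reparametrisation and intervals with a single mode\<close>

lemma locally_lipschitz_reparam:
  assumes x: "locally_lipschitz x" and \<sigma>: "\<sigma> = 1 \<or> \<sigma> = - 1"
  shows "locally_lipschitz (\<lambda>\<tau>. x (s + \<sigma> * \<tau>))"
  unfolding locally_lipschitz_def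
proof (intro allI)
  fix a b :: real
  define m where "m = max \<bar>a\<bar> \<bar>b\<bar>"
  obtain L where L: "L-lipschitz_on {s - m..s + m} x" using x unfolding locally_lipschitz_def by blast
  have "L-lipschitz_on {a..b} (\<lambda>\<tau>. x (s + \<sigma> * \<tau>))"
  proof (rule lipschitz_onI)
    fix p q assume "p \<in> {a..b}" "q \<in> {a..b}"
    then have "dist (x (s + \<sigma> * p)) (x (s + \<sigma> * q)) \<le> L * dist (s + \<sigma> * p) (s + \<sigma> * q)"
      using \<sigma> by (intro lipschitz_onD[OF L]) (auto simp: m_def)
    also have "dist (s + \<sigma> * p) (s + \<sigma> * q) = dist p q" using \<sigma> by (auto simp: dist_real_def)
    finally show "dist (x (s + \<sigma> * p)) (x (s + \<sigma> * q)) \<le> L * dist p q" .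
  qed (rule lipschitz_on_nonneg[OF L])
  then show "\<exists>L. L-lipschitz_on {a..b} (\<lambda>\<tau>. x (s + \<sigma> * \<tau>))" by blast
qed

lemma negligible_reparam:
  fixes N :: "real set"
  assumes N: "negligible N" and \<sigma>: "\<sigma> = 1 \<or> \<sigma> = - 1"
  shows "negligible {\<tau>. s + \<sigma> * \<tau> \<in> N}"
proof -
  have "negligible ((\<lambda>t. \<sigma> * (t - s)) ` N)"
    using N by (intro negligible_differentiable_image_negligible) (auto intro!: derivative_intros simp: differentiable_on_def)
  moreover have "{\<tau>. s + \<sigma> * \<tau> \<in> N} \<subseteq> (\<lambda>t. \<sigma> * (t - s)) ` N"
    using \<sigma> by (auto simp: image_iff intro!: bexI[of _ "s + \<sigma> * _"])
  ultimately show ?thesis by (rule negligible_subset)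
qed

text \<open>Forward and backward solutions must satisfy the mode equation at every time of an
  interval; the affine velocity is continuous along the solution, so the almost everywhere inclusion
  improves to that.\<close>

lemma mode_on_interval:
  fixes A :: "nat \<Rightarrow> real^'n^'n"
  assumes x: "filippov_solution A e c f \<xi> x" and t: "t \<in> {p<..<q}"
    and G: "\<And>s. s \<in> {p<..<q} \<Longrightarrow> pwa_G A e c f (x s) = {A i *v x s + e i}"
  shows "(x has_vector_derivative A i *v x t + e i) (at t)"
proof -
  obtain N where N: "negligible N" "\<And>t. t \<notin> N \<Longrightarrow> \<exists>v\<in>pwa_G A e c f (x t). (x has_vector_derivative v) (at t)"
    by (rule filippov_solutionE[OF x]) (rule that)
  show ?thesis
  proof (rule abs_cont_derivative_everywhere[where G = "\<lambda>t. A i *v x t + e i", OF t _ N(1)])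
    show "abs_cont_on_interval p q x" using filippov_abs_cont[OF x] t by simp
    show "(x has_vector_derivative A i *v x s + e i) (at s)" if "s \<in> {p<..<q} - N" for s
      using N(2)[of s] G[of s] that by auto
    show "isCont (\<lambda>t. A i *v x t + e i) t"
      by (intro isCont_add[OF isCont_o2[OF filippov_continuous[OF x] linear_continuous_at[OF matrix_vector_mul_bounded_linear]]] continuous_const)
  qed
qed

lemma pwa_G_segment:
  assumes "v \<in> pwa_G A e c f x"
  obtains \<theta> where "0 \<le> \<theta>" "\<theta> \<le> 1" "v = (1 - \<theta>) *\<^sub>R (A 1 *v x + e 1) + \<theta> *\<^sub>R (A 2 *v x + e 2)"
proof -
  have "pwa_G A e c f x \<subseteq> closed_segment (A 1 *v x + e 1) (A 2 *v x + e 2)"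
    unfolding pwa_G_def segment_convex_hull by (rule hull_mono) (rule pwa_F_subset)
  then show ?thesis using assms that by (auto simp: closed_segment_def)
qed

text \<open>Mode 1 differentiates the j-th output to the next one exactly. Along mode 2, row
  \<open>j\<close> of \<open>M\<close> gives the leading term \<open>M j j\<close> times output j +
  1 of mode 2, and row j + 1 converts it into \<nu> j times the next output of mode 1. The rest
  involves mode 2 outputs up to \<open>j\<close>, which \<open>lower_tri_inverse_bound\<close>
  controls by those of mode 1.\<close>

lemma statement5_chain:
  fixes A :: "nat \<Rightarrow> real^'n^'n"
  assumes M: "lower_tri_pos (h+2) M" "stack_eq (h+2) (obs_row c (A 1)) (stack_mult (h+2) M (obs_row c (A 2)))"
     "stack_eq (h+2) (obs_offset c f (A 1) (e 1)) (stack_mult (h+2) M (obs_offset c f (A 2) (e 2)))"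
  defines "y \<equiv> affine_output c f (A 1) (e 1)"
  shows "\<exists>m>0. \<exists>K\<ge>0. \<forall>j\<le>h. \<forall>x. \<forall>v\<in>pwa_G A e c f x. \<exists>\<mu>. m \<le> \<mu> \<and> \<mu> \<le> K \<and>
    \<bar>obs_row c (A 1) j \<bullet> v - \<mu> * y (Suc j) x\<bar> \<le> K * (\<Sum>l\<le>j. \<bar>y l x\<bar>)"
proof -
  let ?y2 = "affine_output c f (A 2) (e 2)"
  define \<nu> where "\<nu> j = M j j / M (Suc j) (Suc j)" for j
  have Mpos: "M j j > 0" if "j \<le> Suc h" for j using M(1) that by (simp add: lower_tri_pos_def)
  have \<nu>: "\<nu> j > 0" if "j \<le> h" for j using Mpos[of j] Mpos[of "Suc j"] that by (simp add: \<nu>_def)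
  obtain K0 where K0: "K0 \<ge> 0" "\<And>y1 y2 i. stack_eq (h+2) y1 (stack_mult (h+2) M y2) \<Longrightarrow> i < h + 2 \<Longrightarrow> \<bar>y2 i :: real\<bar> \<le> K0 * (\<Sum>l\<le>i. \<bar>y1 l\<bar>)"
    using lower_tri_inverse_bound[OF M(1)] by blast
  have stack: "stack_eq (h+2) (\<lambda>j. y j x) (stack_mult (h+2) M (\<lambda>j. ?y2 j x))" for x
    unfolding y_def by (rule affine_output_stack[OF M(2,3)])
  have y2: "\<bar>?y2 i x\<bar> \<le> K0 * (\<Sum>l\<le>i. \<bar>y l x\<bar>)" if "i \<le> Suc h" for i x
    using K0(2)[OF stack, of i x] that by simp
  \<comment> \<open>Total weight of the terms below the leading one in rows \<open>j\<close> and j +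
    1.\<close>
  define C where "C j = (\<Sum>l<j. \<bar>M j l\<bar>) + \<nu> j * (\<Sum>l\<le>j. \<bar>M (Suc j) l\<bar>)" for j
  have C0: "C j \<ge> 0" if "j \<le> h" for j
    using \<nu>[OF that] unfolding C_def by (intro add_nonneg_nonneg mult_nonneg_nonneg sum_nonneg) auto
  have f2: "\<bar>obs_row c (A 1) j \<bullet> (A 2 *v x + e 2) - \<nu> j * y (Suc j) x\<bar> \<le> C j * (K0 * (\<Sum>l\<le>j. \<bar>y l x\<bar>))"
    if j: "j \<le> h" for j x
  proof -
    let ?Z = "K0 * (\<Sum>l\<le>j. \<bar>y l x\<bar>)"
    have small: "\<bar>?y2 i x\<bar> \<le> ?Z" if "i \<le> j" for i
    proof -
      have "(\<Sum>l\<le>i. \<bar>y l x\<bar>) \<le> (\<Sum>l\<le>j. \<bar>y l x\<bar>)" using that by (intro sum_mono2) auto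
      then have "K0 * (\<Sum>l\<le>i. \<bar>y l x\<bar>) \<le> ?Z" using K0(1) by (rule mult_left_mono)
      then show ?thesis using y2[of i x] that j by linarith
    qed
    have "obs_row c (A 1) j = stack_mult (h+2) M (obs_row c (A 2)) j"
      using M(2) j by (simp add: stack_eq_def)
    also have "\<dots> = (\<Sum>l<j. M j l *\<^sub>R obs_row c (A 2) l) + M j j *\<^sub>R obs_row c (A 2) j"
      using j by (intro stack_mult_lower[OF M(1)]) simp
    finally have row: "obs_row c (A 1) j \<bullet> (A 2 *v x + e 2) = (\<Sum>l<j. M j l * ?y2 (Suc l) x) + M j j * ?y2 (Suc j) x"
      using obs_row_field[of c "A 2" _ x "e 2" f] by (simp add: inner_add_left inner_sum_left)
    have "y (Suc j) x = (\<Sum>l<Suc j. M (Suc j) l * ?y2 l x) + M (Suc j) (Suc j) * ?y2 (Suc j) x"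
      using stack[of x] stack_mult_lower[OF M(1), of "Suc j" "\<lambda>j. ?y2 j x"] j by (simp add: stack_eq_def del: sum.lessThan_Suc)
    then have "\<nu> j * y (Suc j) x = \<nu> j * (\<Sum>l\<le>j. M (Suc j) l * ?y2 l x) + M j j * ?y2 (Suc j) x"
      using Mpos[of "Suc j"] j by (simp add: \<nu>_def distrib_left lessThan_Suc_atMost del: sum.lessThan_Suc)
    then have "obs_row c (A 1) j \<bullet> (A 2 *v x + e 2) - \<nu> j * y (Suc j) x
       = (\<Sum>l<j. M j l * ?y2 (Suc l) x) - \<nu> j * (\<Sum>l\<le>j. M (Suc j) l * ?y2 l x)" using row by simp
    moreover have "\<bar>\<Sum>l<j. M j l * ?y2 (Suc l) x\<bar> \<le> (\<Sum>l<j. \<bar>M j l\<bar> * ?Z)"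
      using small by (intro order_trans[OF sum_abs] sum_mono) (auto simp: abs_mult intro!: mult_left_mono)
    moreover have "\<bar>\<Sum>l\<le>j. M (Suc j) l * ?y2 l x\<bar> \<le> (\<Sum>l\<le>j. \<bar>M (Suc j) l\<bar> * ?Z)"
      using small by (intro order_trans[OF sum_abs] sum_mono) (auto simp: abs_mult intro!: mult_left_mono)
    then have "\<bar>\<nu> j * (\<Sum>l\<le>j. M (Suc j) l * ?y2 l x)\<bar> \<le> \<nu> j * (\<Sum>l\<le>j. \<bar>M (Suc j) l\<bar> * ?Z)"
      using \<nu>[OF j] by (simp add: abs_mult)
    ultimately have "\<bar>obs_row c (A 1) j \<bullet> (A 2 *v x + e 2) - \<nu> j * y (Suc j) x\<bar>
       \<le> (\<Sum>l<j. \<bar>M j l\<bar> * ?Z) + \<nu> j * (\<Sum>l\<le>j. \<bar>M (Suc j) l\<bar> * ?Z)" by linarith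
    then show ?thesis by (simp only: C_def distrib_right sum_distrib_right mult.assoc)
  qed
  define K where "K = 1 + (\<Sum>j\<le>h. \<nu> j) + (\<Sum>j\<le>h. C j) * K0"
  \<comment> \<open>The multiplier of a convex combination lies between 1 and \<nu> j, hence the 1
    among the candidates.\<close>
  define m where "m = Min (insert 1 (\<nu> ` {..h}))"
  have m: "m > 0" "m \<le> 1" using \<nu> by (auto simp: m_def)
  have m\<nu>: "m \<le> \<nu> j" if "j \<le> h" for j unfolding m_def using that by (intro Min_le) auto
  have sumC: "C j \<le> (\<Sum>j\<le>h. C j)" "0 \<le> (\<Sum>j\<le>h. C j)" and sum\<nu>: "\<nu> j \<le> (\<Sum>j\<le>h. \<nu> j)" "0 \<le> (\<Sum>j\<le>h. \<nu> j)" if "j \<le> h" for j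
    using C0 less_imp_le[OF \<nu>] that by (auto intro!: member_le_sum sum_nonneg)
  have "\<exists>\<mu>. m \<le> \<mu> \<and> \<mu> \<le> K \<and> \<bar>obs_row c (A 1) j \<bullet> v - \<mu> * y (Suc j) x\<bar> \<le> K * (\<Sum>l\<le>j. \<bar>y l x\<bar>)"
    if j: "j \<le> h" and v: "v \<in> pwa_G A e c f x" for j x v
  proof -
    obtain \<theta> where \<theta>: "0 \<le> \<theta>" "\<theta> \<le> 1" "v = (1 - \<theta>) *\<^sub>R (A 1 *v x + e 1) + \<theta> *\<^sub>R (A 2 *v x + e 2)"
      using pwa_G_segment[OF v] by blast
    define \<mu> where "\<mu> = (1 - \<theta>) + \<theta> * \<nu> j"
    let ?S = "\<Sum>l\<le>j. \<bar>y l x\<bar>"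
    have S: "?S \<ge> 0" by (intro sum_nonneg) auto
    have KC: "C j * K0 \<le> (\<Sum>j\<le>h. C j) * K0" "0 \<le> (\<Sum>j\<le>h. C j) * K0" "0 \<le> C j * K0"
      using sumC[OF j] K0(1) C0[OF j] by (auto intro: mult_right_mono)
    have "(1 - \<theta>) * m \<le> (1 - \<theta>) * 1" "\<theta> * m \<le> \<theta> * \<nu> j"
      using \<theta>(1,2) m(2) m\<nu>[OF j] by (auto intro!: mult_left_mono simp del: mult_1_right)
    from add_mono[OF this] have "(1 - \<theta>) * m + \<theta> * m \<le> \<mu>" by (simp add: \<mu>_def)
    then have "m \<le> \<mu>" by (simp add: algebra_simps)
    moreover have "\<mu> \<le> K"
    proof -
      have "\<theta> * \<nu> j \<le> \<nu> j" using \<theta> \<nu>[OF j] by simp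
      then show ?thesis using \<theta> sum\<nu>[OF j] KC unfolding \<mu>_def K_def by linarith
    qed
    moreover have "\<bar>obs_row c (A 1) j \<bullet> v - \<mu> * y (Suc j) x\<bar> \<le> K * ?S"
    proof -
      have "obs_row c (A 1) j \<bullet> v = (1 - \<theta>) * y (Suc j) x + \<theta> * (obs_row c (A 1) j \<bullet> (A 2 *v x + e 2))"
        unfolding \<theta>(3) inner_add_right inner_scaleR_right
        using obs_row_field[of c "A 1" j x "e 1" f] by (simp add: y_def inner_add_right)
      then have "obs_row c (A 1) j \<bullet> v - \<mu> * y (Suc j) x = \<theta> * (obs_row c (A 1) j \<bullet> (A 2 *v x + e 2) - \<nu> j * y (Suc j) x)"
        by (simp add: \<mu>_def algebra_simps)
      then have "\<bar>obs_row c (A 1) j \<bullet> v - \<mu> * y (Suc j) x\<bar> = \<theta> * \<bar>obs_row c (A 1) j \<bullet> (A 2 *v x + e 2) - \<nu> j * y (Suc j) x\<bar>"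
        using \<theta>(1) by (simp add: abs_mult)
      also have "\<dots> \<le> 1 * (C j * (K0 * ?S))" using \<theta> f2[OF j, of x] by (intro mult_mono) auto
      also have "\<dots> = C j * K0 * ?S" by simp
      also have "\<dots> \<le> K * ?S" using KC sum\<nu>[OF j] S unfolding K_def by (intro mult_right_mono) auto
      finally show ?thesis .
    qed
    ultimately show ?thesis by blast
  qed
  moreover have "K \<ge> 0" using sum\<nu>[of 0] sumC[of 0] K0(1) by (auto simp: K_def intro!: add_nonneg_nonneg)
  ultimately show ?thesis using m(1) by blast
qed

text \<open>The parameter \<open>\<sigma>\<close> is the direction of time. Reversing time changes the sign of the \<open>j\<close>-th output
  derivative by \<open>\<sigma>^j\<close>, and these signed functions form a chain again.\<close>

lemma filippov_local_mode:
  fixes A :: "nat \<Rightarrow> real^'n^'n" and e :: "nat \<Rightarrow> real^'n" and c :: "real^'n" and f s :: real and x :: "real \<Rightarrow> real^'n"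
  assumes c: "c \<noteq> 0" and st5: "statement5 A e c f" and st6: "statement6 A e c f"
    and x: "filippov_solution A e c f \<xi> x" and \<sigma>: "\<sigma> = 1 \<or> \<sigma> = - 1"
  defines "y \<equiv> affine_output c f (A 1) (e 1)"
  defines "i \<equiv> if first_sign 1 (\<lambda>j. \<sigma> ^ j * y j (x s)) then 2 else 1"
  shows "\<exists>eps>0. \<forall>\<tau>\<in>{0<..<eps}. pwa_G A e c f (x (s + \<sigma> * \<tau>)) = {A i *v x (s + \<sigma> * \<tau>) + e i} \<and>
     (-1)^(i-1) * (c \<bullet> x (s + \<sigma> * \<tau>) + f) \<le> 0"
proof -
  define h where "h = min_obs_index A c"
  have h: "obs_index c (A 1) = h" using st5 by (auto simp: h_def min_obs_index_def statement5_def)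
  obtain M where M: "lower_tri_pos (h+2) M" "stack_eq (h+2) (obs_row c (A 1)) (stack_mult (h+2) M (obs_row c (A 2)))"
           "stack_eq (h+2) (obs_offset c f (A 1) (e 1)) (stack_mult (h+2) M (obs_offset c f (A 2) (e 2)))"
    using st5 unfolding statement5_def Let_def h_def by blast
  obtain m K where m: "m > 0" and K: "K \<ge> 0" and chain: "\<And>j z v. j \<le> h \<Longrightarrow> v \<in> pwa_G A e c f z \<Longrightarrow> \<exists>\<mu>. m \<le> \<mu> \<and> \<mu> \<le> K \<and>
    \<bar>obs_row c (A 1) j \<bullet> v - \<mu> * y (Suc j) z\<bar> \<le> K * (\<Sum>l\<le>j. \<bar>y l z\<bar>)"
    using statement5_chain[OF M] unfolding y_def by blast
  obtain N where N: "negligible N" "\<And>t. t \<notin> N \<Longrightarrow> \<exists>v\<in>pwa_G A e c f (x t). (x has_vector_derivative v) (at t)"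
    by (rule filippov_solutionE[OF x]) (rule that)
  define X where "X \<tau> = x (s + \<sigma> * \<tau>)" for \<tau>
  define z where "z j \<tau> = \<sigma> ^ j * y j (X \<tau>)" for j \<tau>
  have absz: "\<bar>z j \<tau>\<bar> = \<bar>y j (X \<tau>)\<bar>" for j \<tau> using \<sigma> by (auto simp: z_def abs_mult power_abs)
  have z_eq: "z j \<tau> = 0 \<longleftrightarrow> y j (X \<tau>) = 0" for j \<tau> using absz[of j \<tau>] by auto
  have X0: "X 0 = x s" by (simp add: X_def)
  have acX: "abs_cont_on_interval 0 1 X"
    using locally_lipschitz_imp_loc_abs_cont[OF locally_lipschitz_reparam[OF filippov_locally_lipschitz[OF x] \<sigma>, of s]]
    unfolding X_def by (simp add: loc_abs_cont_def)
  have ac: "abs_cont_on_interval 0 1 (z j)" for j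
    using abs_cont_inner[OF abs_cont_affine_output[OF acX], of "\<sigma> ^ j" c f "A 1" "e 1" j 0]
    by (simp add: z_def[abs_def] y_def)
  have der: "\<exists>d \<mu>. (z j has_real_derivative d) (at \<tau>) \<and> m \<le> \<mu> \<and> \<mu> \<le> K \<and> \<bar>d - \<mu> * z (Suc j) \<tau>\<bar> \<le> K * (\<Sum>l\<le>j. \<bar>z l \<tau>\<bar>)"
    if \<tau>: "\<tau> \<in> {0<..<1} - {\<tau>. s + \<sigma> * \<tau> \<in> N}" and j: "j \<le> h" for \<tau> j
  proof -
    obtain v where v: "v \<in> pwa_G A e c f (X \<tau>)" "(x has_vector_derivative v) (at (s + \<sigma> * \<tau>))"
      using N(2)[of "s + \<sigma> * \<tau>"] \<tau> by (auto simp: X_def)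
    have "((\<lambda>\<tau>. s + \<sigma> * \<tau>) has_vector_derivative \<sigma>) (at \<tau>)"
      by (auto intro!: derivative_eq_intros simp: has_real_derivative_iff_has_vector_derivative[symmetric])
    from vector_diff_chain_at[OF this, of x v] v(2)
    have "(X has_vector_derivative \<sigma> *\<^sub>R v) (at \<tau>)" by (simp add: X_def[abs_def] o_def)
    from DERIV_cmult[OF affine_output_has_derivative[OF this, of c f "A 1" "e 1" j], of "\<sigma> ^ j"]
    have d: "(z j has_real_derivative \<sigma> ^ Suc j * (obs_row c (A 1) j \<bullet> v)) (at \<tau>)"
      by (simp add: z_def[abs_def] y_def algebra_simps)
    obtain \<mu> where \<mu>: "m \<le> \<mu>" "\<mu> \<le> K" "\<bar>obs_row c (A 1) j \<bullet> v - \<mu> * y (Suc j) (X \<tau>)\<bar> \<le> K * (\<Sum>l\<le>j. \<bar>y l (X \<tau>)\<bar>)"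
      using chain[OF j v(1)] by blast
    have "\<bar>\<sigma> ^ Suc j * (obs_row c (A 1) j \<bullet> v) - \<mu> * z (Suc j) \<tau>\<bar> = \<bar>\<sigma> ^ Suc j\<bar> * \<bar>obs_row c (A 1) j \<bullet> v - \<mu> * y (Suc j) (X \<tau>)\<bar>"
      unfolding abs_mult[symmetric] z_def by (simp only: algebra_simps)
    also have "\<bar>\<sigma> ^ Suc j\<bar> = 1" using \<sigma> by (auto simp: power_abs)
    finally have "\<bar>\<sigma> ^ Suc j * (obs_row c (A 1) j \<bullet> v) - \<mu> * z (Suc j) \<tau>\<bar> \<le> K * (\<Sum>l\<le>j. \<bar>z l \<tau>\<bar>)"
      using \<mu>(3) by (simp add: absz)
    then show ?thesis using d \<mu>(1,2) by blast
  qed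
  have close: "\<exists>P. \<forall>\<tau>. \<bar>z (Suc h) \<tau>\<bar> \<le> P * (\<Sum>l\<le>h. \<bar>z l \<tau>\<bar>)" if "\<And>j. j \<le> Suc h \<Longrightarrow> z j 0 = 0"
    using affine_output_close[OF c, of "A 1" f "e 1" "x s"] that unfolding absz h z_eq X0 y_def by blast
  have out: "z 0 \<tau> = c \<bullet> x (s + \<sigma> * \<tau>) + f" for \<tau> by (simp add: z_def y_def X_def)
  \<comment> \<open>The mode is read off the state \<open>x s\<close> and the direction of time
    alone; right-uniqueness later rests on this.\<close>
  have i: "i = (if first_sign 1 (\<lambda>j. z j 0) then 2 else 1)" by (simp add: i_def z_def X0)
  show ?thesis
  proof (rule chain_trichotomy[where z = z and h = h, OF zero_less_one ac negligible_reparam[OF N(1) \<sigma>] der m K close])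
    fix eps assume *: "eps > 0" "\<And>t. t \<in> {0<..<0 + eps} \<Longrightarrow> z 0 t > 0" "first_sign 1 (\<lambda>j. z j 0)"
    have "c \<bullet> x (s + \<sigma> * \<tau>) + f > 0" if "\<tau> \<in> {0<..<eps}" for \<tau> using *(2)[of \<tau>] that out by simp
    then have "pwa_G A e c f (x (s + \<sigma> * \<tau>)) = {A 2 *v x (s + \<sigma> * \<tau>) + e 2} \<and> (-1)^(2-1) * (c \<bullet> x (s + \<sigma> * \<tau>) + f) \<le> 0"
      if "\<tau> \<in> {0<..<eps}" for \<tau> using that by (fastforce simp: pwa_G_def pwa_F_def)
    then show ?thesis using *(1,3) i by auto
  next
    fix eps assume *: "eps > 0" "\<And>t. t \<in> {0<..<0 + eps} \<Longrightarrow> z 0 t < 0" "\<not> first_sign 1 (\<lambda>j. z j 0)"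
    have "c \<bullet> x (s + \<sigma> * \<tau>) + f < 0" if "\<tau> \<in> {0<..<eps}" for \<tau> using *(2)[of \<tau>] that out by simp
    then have "pwa_G A e c f (x (s + \<sigma> * \<tau>)) = {A 1 *v x (s + \<sigma> * \<tau>) + e 1} \<and> (-1)^(1-1) * (c \<bullet> x (s + \<sigma> * \<tau>) + f) \<le> 0"
      if "\<tau> \<in> {0<..<eps}" for \<tau> using that by (fastforce simp: pwa_G_def pwa_F_def)
    then show ?thesis using *(1,3) i by auto
  next
    \<comment> \<open>With all outputs zero, statement 6 collapses the convex hull to one point, so
      either mode describes the motion.\<close>
    fix eps assume *: "eps > 0" "\<And>t j. t \<in> {0..0 + eps} \<Longrightarrow> j \<le> Suc h \<Longrightarrow> z j t = 0"
    have "pwa_G A e c f (x (s + \<sigma> * \<tau>)) = {A i *v x (s + \<sigma> * \<tau>) + e i} \<and> (-1)^(i-1) * (c \<bullet> x (s + \<sigma> * \<tau>) + f) \<le> 0"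
      if "\<tau> \<in> {0<..<eps}" for \<tau>
    proof -
      have z: "z j \<tau> = 0" if "j \<le> Suc h" for j using *(2)[of \<tau> j] that \<open>\<tau> \<in> {0<..<eps}\<close> by simp
      have "c \<bullet> x (s + \<sigma> * \<tau>) + f = 0" using z[of 0] out by simp
      moreover have "y j (X \<tau>) = 0" if "j \<le> Suc h" for j using z[OF that] z_eq by simp
      then have "A 1 *v x (s + \<sigma> * \<tau>) + e 1 = A 2 *v x (s + \<sigma> * \<tau>) + e 2"
        using st6 unfolding statement6_def y_def affine_output_def h_def X_def by simp
      ultimately show ?thesis by (simp add: i_def pwa_G_def pwa_F_def)
    qed
    then show ?thesis using *(1) by blast
  qed
qed

corollary filippov_local_mode_exists:
  fixes A :: "nat \<Rightarrow> real^'n^'n"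
  assumes "c \<noteq> 0" "statement5 A e c f" "statement6 A e c f" "filippov_solution A e c f \<xi> x" "\<sigma> = 1 \<or> \<sigma> = - 1"
  shows "\<exists>i\<in>{1,2}. \<exists>eps>0. \<forall>\<tau>\<in>{0<..<eps}. pwa_G A e c f (x (s + \<sigma> * \<tau>)) = {A i *v x (s + \<sigma> * \<tau>) + e i} \<and>
     (-1)^(i-1) * (c \<bullet> x (s + \<sigma> * \<tau>) + f) \<le> 0"
proof -
  define i :: nat where "i = (if first_sign 1 (\<lambda>j. \<sigma> ^ j * affine_output c f (A 1) (e 1) j (x s)) then 2 else 1)"
  have "i \<in> {1,2}" by (simp add: i_def)
  then show ?thesis using filippov_local_mode[OF assms, of s, folded i_def] by blast
qed

text \<open>To each \<open>t\<close> belongs a rational to its right with no point of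
  \<open>E\<close> strictly between; on \<open>E\<close> this assignment is strictly increasing,
  hence injective.\<close>

lemma countable_right_isolated:
  fixes E :: "real set"
  assumes "\<And>t. \<exists>eps>0. {t<..<t + eps} \<inter> E = {}"
  shows "countable E"
proof -
  have "\<forall>t. \<exists>q\<in>\<rat>. t < q \<and> {t<..<q} \<inter> E = {}"
  proof
    fix t
    obtain eps where e: "eps > 0" "{t<..<t + eps} \<inter> E = {}" using assms by blast
    obtain q where "q \<in> \<rat>" "t < q" "q < t + eps" using Rats_dense_in_real[of t "t + eps"] e(1) by auto
    moreover from this have "{t<..<q} \<subseteq> {t<..<t + eps}" by auto
    ultimately show "\<exists>q\<in>\<rat>. t < q \<and> {t<..<q} \<inter> E = {}" using e(2) by blast
  qed
  then obtain q where q: "\<And>t. q t \<in> \<rat>" "\<And>t. t < q t" "\<And>t. {t<..<q t} \<inter> E = {}" by metis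
  have lt: "q s < q t" if "s \<in> E" "t \<in> E" "s < t" for s t
  proof -
    have "t \<notin> {s<..<q s}" using q(3)[of s] that(2) by blast
    then show ?thesis using that(3) q(2)[of t] by auto
  qed
  have "inj_on q E" by (rule linorder_inj_onI') (use lt in fastforce)
  moreover have "countable (q ` E)" by (rule countable_subset[OF _ countable_rat]) (use q(1) in auto)
  ultimately show ?thesis by (rule countable_image_inj_on[rotated])
qed

theorem statement56_imp_2:
  fixes A :: "nat \<Rightarrow> real^'n^'n"
  assumes c: "c \<noteq> 0" and st5: "statement5 A e c f" and st6: "statement6 A e c f"
  shows "statement2 A e c f"
  unfolding statement2_def
proof (intro allI impI)
  fix \<xi> x assume x: "filippov_solution A e c f \<xi> x"
  have fwd: "\<exists>i\<in>{1,2}. \<exists>eps>0. \<forall>t\<in>{s<..<s+eps}.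
        (x has_vector_derivative (A i *v x t + e i)) (at t) \<and> (-1)^(i-1) * (c \<bullet> x t + f) \<le> 0" for s
  proof -
    obtain i :: nat and eps where i: "i \<in> {1,2}" "eps > 0" and *: "\<And>\<tau>. \<tau> \<in> {0<..<eps} \<Longrightarrow>
      pwa_G A e c f (x (s + 1 * \<tau>)) = {A i *v x (s + 1 * \<tau>) + e i} \<and> (-1)^(i-1) * (c \<bullet> x (s + 1 * \<tau>) + f) \<le> 0"
      using filippov_local_mode_exists[OF c st5 st6 x, of 1 s] by blast
    have **: "pwa_G A e c f (x t) = {A i *v x t + e i} \<and> (-1)^(i-1) * (c \<bullet> x t + f) \<le> 0" if "t \<in> {s<..<s+eps}" for t
      using *[of "t - s"] that by simp
    have "(x has_vector_derivative (A i *v x t + e i)) (at t)" if "t \<in> {s<..<s+eps}" for t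
      using ** by (intro mode_on_interval[OF x that]) blast
    then show ?thesis using i ** by blast
  qed
  have bwd: "\<exists>i\<in>{1,2}. \<exists>eps>0. \<forall>t\<in>{s-eps<..<s}.
        (x has_vector_derivative (A i *v x t + e i)) (at t) \<and> (-1)^(i-1) * (c \<bullet> x t + f) \<le> 0" for s
  proof -
    obtain i :: nat and eps where i: "i \<in> {1,2}" "eps > 0" and *: "\<And>\<tau>. \<tau> \<in> {0<..<eps} \<Longrightarrow>
      pwa_G A e c f (x (s + - 1 * \<tau>)) = {A i *v x (s + - 1 * \<tau>) + e i} \<and> (-1)^(i-1) * (c \<bullet> x (s + - 1 * \<tau>) + f) \<le> 0"
      using filippov_local_mode_exists[OF c st5 st6 x, of "- 1" s] by blast
    have **: "pwa_G A e c f (x t) = {A i *v x t + e i} \<and> (-1)^(i-1) * (c \<bullet> x t + f) \<le> 0" if "t \<in> {s-eps<..<s}" for t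
      using *[of "s - t"] that by simp
    have "(x has_vector_derivative (A i *v x t + e i)) (at t)" if "t \<in> {s-eps<..<s}" for t
      using ** by (intro mode_on_interval[OF x that]) blast
    then show ?thesis using i ** by blast
  qed
  \<comment> \<open>The times violating the Caratheodory inclusion. By \<open>fwd\<close> every time
    has a right neighbourhood free of them, so they form a countable and therefore null set.\<close>
  define E where "E = {t. \<not> (\<exists>v\<in>pwa_F A e c f (x t). (x has_vector_derivative v) (at t))}"
  have "countable E"
  proof (rule countable_right_isolated)
    fix s
    obtain i eps where i: "i \<in> {1,2}" "eps > 0" and *: "\<And>t. t \<in> {s<..<s+eps} \<Longrightarrow>
        (x has_vector_derivative (A i *v x t + e i)) (at t) \<and> (-1)^(i-1) * (c \<bullet> x t + f) \<le> 0"
      using fwd[of s] by blast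
    have "t \<notin> E" if "t \<in> {s<..<s+eps}" for t
    proof -
      have "A i *v x t + e i \<in> pwa_F A e c f (x t)" using *[OF that] i(1) by (auto simp: pwa_F_def)
      then show ?thesis using *[OF that] by (auto simp: E_def)
    qed
    then show "\<exists>eps>0. {s<..<s + eps} \<inter> E = {}" using i(2) by blast
  qed
  then have "E \<in> null_sets lebesgue" by (intro null_sets_completionI countable_imp_null_set_lborel)
  then have "AE t in lebesgue. \<exists>v\<in>pwa_F A e c f (x t). (x has_vector_derivative v) (at t)"
    by (rule AE_I') (auto simp: E_def)
  then have "caratheodory_solution A e c f \<xi> x"
    using x unfolding caratheodory_solution_def filippov_solution_def inclusion_solution_def by blast
  then show "forward_caratheodory_solution A e c f \<xi> x \<and> backward_caratheodory_solution A e c f \<xi> x"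
    unfolding forward_caratheodory_solution_def backward_caratheodory_solution_def using fwd bwd by blast
qed

text \<open>The difference of the two curves is a list with the single entry 0 in
  \<open>abs_cont_zero_unique\<close>; the interval is shortened until K * eps < 1.\<close>

lemma linear_ode_unique:
  fixes B :: "real^'n^'n"
  assumes lip: "locally_lipschitz x" "locally_lipschitz x'" and b: "b > 0" and x0: "x 0 = x' 0"
    and der: "\<And>t. t \<in> {0<..<b} \<Longrightarrow> (x has_vector_derivative B *v x t + d) (at t)"
      "\<And>t. t \<in> {0<..<b} \<Longrightarrow> (x' has_vector_derivative B *v x' t + d) (at t)"
  shows "\<exists>eps>0. \<forall>t\<in>{0..<eps}. x t = x' t"
proof -
  obtain K where K: "K > 0" "\<And>z. norm (B *v z) \<le> norm z * K"
    using bounded_linear.pos_bounded[OF matrix_vector_mul_bounded_linear[of B]] by blast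
  define eps where "eps = min b (1 / (2 * K))"
  have e: "eps > 0" "eps \<le> b" "K * eps < 1"
  proof -
    show "eps > 0" "eps \<le> b" using K(1) b by (auto simp: eps_def)
    have "K * eps \<le> K * (1 / (2 * K))" using K(1) by (intro mult_left_mono) (auto simp: eps_def)
    then show "K * eps < 1" using K(1) by simp
  qed
  have "(\<lambda>j t. x t - x' t) (0::nat) t = 0" if t: "t \<in> {0..eps}" for t
  proof (rule abs_cont_zero_unique[of 0 eps 0 "\<lambda>j t. x t - x' t" "{}" K])
    obtain L L' where "L-lipschitz_on {0..eps} x" "L'-lipschitz_on {0..eps} x'"
      using lip unfolding locally_lipschitz_def by blast
    then show "abs_cont_on_interval 0 eps (\<lambda>t. x t - x' t)"
      by (rule abs_cont_lipschitz[OF lipschitz_on_diff])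
    fix t and j :: nat assume "t \<in> {0<..<eps} - {}"
    then have "t \<in> {0<..<b}" using e by auto
    then have "((\<lambda>t. x t - x' t) has_vector_derivative B *v (x t - x' t)) (at t)"
      using has_vector_derivative_diff[OF der] by (simp add: matrix_vector_mult_diff_distrib)
    then show "\<exists>v. ((\<lambda>t. x t - x' t) has_vector_derivative v) (at t) \<and> norm v \<le> K * (\<Sum>l\<le>0::nat. norm (x t - x' t))"
      using K(2)[of "x t - x' t"] by (intro exI[of _ "B *v (x t - x' t)"]) (simp add: mult.commute)
  qed (use x0 K e t in auto)
  then show ?thesis using e(1) by (intro exI[of _ eps]) auto
qed

text \<open>The mode index in \<open>filippov_local_mode\<close> depends only on the initial state,
  so two solutions from it obey the same affine equation for a short time, where uniqueness is
  elementary.\<close>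

theorem statement56_imp_1:
  fixes A :: "nat \<Rightarrow> real^'n^'n"
  assumes c: "c \<noteq> 0" and st5: "statement5 A e c f" and st6: "statement6 A e c f"
  shows "statement1 A e c f"
  unfolding statement1_def right_unique_def
proof (intro allI impI)
  fix \<xi> x x' assume x: "filippov_solution A e c f \<xi> x" and x': "filippov_solution A e c f \<xi> x'"
  have x0: "x 0 = \<xi>" "x' 0 = \<xi>" using x x' by (auto simp: filippov_solution_def inclusion_solution_def)
  define i :: nat where "i = (if first_sign 1 (\<lambda>j. 1 ^ j * affine_output c f (A 1) (e 1) j \<xi>) then 2 else 1)"
  have "\<exists>eps>0. \<forall>t\<in>{0<..<eps}. pwa_G A e c f (w t) = {A i *v w t + e i}" if "filippov_solution A e c f \<xi> w" "w 0 = \<xi>" for w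
    using filippov_local_mode[OF c st5 st6 that(1), of 1 0] that(2) unfolding i_def by auto
  from this[OF x x0(1)] this[OF x' x0(2)] obtain eps1 eps2 where e: "eps1 > 0" "eps2 > 0"
    and G: "\<And>t. t \<in> {0<..<eps1} \<Longrightarrow> pwa_G A e c f (x t) = {A i *v x t + e i}"
      "\<And>t. t \<in> {0<..<eps2} \<Longrightarrow> pwa_G A e c f (x' t) = {A i *v x' t + e i}" by blast
  show "\<exists>eps>0. \<forall>t\<in>{0..<eps}. x t = x' t"
  proof (rule linear_ode_unique[of x x' "min eps1 eps2" "A i" "e i"])
    show "(x has_vector_derivative A i *v x t + e i) (at t)" if "t \<in> {0<..<min eps1 eps2}" for t
      by (rule mode_on_interval[OF x that]) (use G in auto)
    show "(x' has_vector_derivative A i *v x' t + e i) (at t)" if "t \<in> {0<..<min eps1 eps2}" for t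
      by (rule mode_on_interval[OF x' that]) (use G in auto)
  qed (use e x0 filippov_locally_lipschitz[OF x] filippov_locally_lipschitz[OF x'] in auto)
qed

theorem theorem3p1:
  fixes A :: "nat \<Rightarrow> real^'n^'n" and e :: "nat \<Rightarrow> real^'n" and c :: "real^'n" and f :: real
  assumes "c \<noteq> 0"
  shows "(statement1 A e c f \<longrightarrow> statement3 A e c f \<or> statement4 A e c f \<or> statement5 A e c f) \<and>
         (statement1 A e c f \<and> statement5 A e c f \<longrightarrow> statement6 A e c f) \<and>
         (statement5 A e c f \<and> statement6 A e c f \<longrightarrow> statement2 A e c f) \<and>
         (statement5 A e c f \<and> statement6 A e c f \<longrightarrow> statement1 A e c f)"
  using statement1_imp_345[OF assms] statement15_imp_6[OF assms] statement56_imp_2[OF assms] statement56_imp_1[OF assms]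
  by blast

end
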